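(* Let $k$ be a field, $n\ge2$, $\rho\colon F_n\rtimes B_n\to\mathrm{GL}(V)$ a representation on an $N$-dimensional $k$-vector space, $g_j=\rho(x_j)$, $s_i=\rho(\sigma_i)$. Let $\lambda\in k^\times\setminus\{1\}$ and $1\le i\le n-1$. Put $W_j:=\mathrm{Ker}(g_j-I)$, $E_\lambda:=\mathrm{Ker}(\lambda g_1\cdots g_n-I_N)$, $S_i:=\rho^{\mathrm{LM}}_\lambda(\sigma_i)$. Then $$\chi_{\rho^{\mathrm{KLM}}_\lambda(\sigma_i)}(z)=\frac{\chi_{s_i}(z)^{\,n-1}\,\det(zI+s_ig_i)}{\displaystyle\prod_{k\ne i,i+1}\chi_{s_i|_{W_k}}(z)\cdot\det\bigl(z^2I_{W_i}-(s_ig_is_i)|_{W_i}\bigr)\cdot\chi_{s_i|_{E_\lambda}}(z)},$$ where the product runs over indices $1\le k\le n$ with $k\neq i,i+1$, and the denominator divides the numerator. Moreover, for $a,b\in k^\times$, the operators $\rho^{\mathrm{KLM}}_\lambda(\sigma_i)$ satisfy the Hecke relation $(T-a)(T-b)=0$ if and only if $$(S_i-aI)(S_i-bI)\,V^{\oplus n}\subseteq K+L;$$ when $a\ne b$, this containment forces $\rho^{\mathrm{KLM}}_\lambda(\sigma_i)$ to be semisimple with eigenvalue set contained in $\{a,b\}$, i.e. that the set of roots of the displayed quotient of characteristic polynomials lies in $\{a,b\}$.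
   Context: $B_n$ is the Artin braid group with standard generators $\sigma_1,\dots,\sigma_{n-1}$; $F_n$ is the free group on $x_1,\dots,x_n$. The Artin action $\theta\colon B_n\to\mathrm{Aut}(F_n)$ is $\theta_{\sigma_i}(x_i)=x_{i+1}$, $\theta_{\sigma_i}(x_{i+1})=x_{i+1}^{-1}x_ix_{i+1}$, $\theta_{\sigma_i}(x_j)=x_j$ for $j\ne i,i+1$. $F_n\rtimes B_n$ is the corresponding semidirect product, in which $\sigma x\sigma^{-1}=\theta_\sigma(x)$. Twisted Long--Moody construction: for $\lambda\in k^\times$, $\rho^{\mathrm{LM}}_\lambda\colon F_n\rtimes B_n\to\mathrm{GL}(V^{\oplus n})$ is the representation given on generators as follows, in $n\times n$ block form with $N\times N$ blocks. $\rho^{\mathrm{LM}}_\lambda(x_i)$ is the identity matrix except in the $i$-th block row, which equals $(\lambda(g_1-1),\dots,\lambda(g_{i-1}-1),\lambda g_i,g_{i+1}-1,\dots,g_n-1)$. $\rho^{\mathrm{LM}}_\lambda(\sigma_i)=s_i^{\oplus n}\cdot\mathrm{diag}(I_{N(i-1)},R_i,I_{N(n-i-1)})$ with $R_i=\begin{pmatrix}O&g_i\\ I_N&I_N-g_{i+1}\end{pmatrix}$ in block rows and columns $i,i+1$. Katz--Long--Moody (KLM) construction: let $K=\{(w_1,\dots,w_n)^T: w_j\in\mathrm{Ker}(g_j-1)\}$ and $L=\bigcap_{j=1}^n\mathrm{Ker}(\rho^{\mathrm{LM}}_\lambda(x_j)-I)$. The subspace $K+L$ is $\rho^{\mathrm{LM}}_\lambda$-invariant,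 and $\rho^{\mathrm{KLM}}_\lambda$ is the induced representation of $F_n\rtimes B_n$ on $V^{\oplus n}/(K+L)$. $\chi_A(z):=\det(zI-A)$; eigenvalues are taken in an algebraic closure of $k$. The relevant invariance holds: $s_i$ preserves $W_k$ for $k\ne i,i+1$ and preserves $E_\lambda$, and $s_ig_is_i$ preserves $W_i$, so the restrictions above make sense. *)

theory Defs
  imports
    "Jordan_Normal_Form.Char_Poly"
    "Jordan_Normal_Form.VS_Connect"
    "HOL-Algebra.Algebraic_Closure_Type"
    "HOL-Algebra.Bij"
begin

hide_const (open) Polynomial.smult Multiset.mult Modules.module

section \<open>Groups given by generators and relations\<close>

text \<open>A letter \<open>(x, True)\<close> stands for the generator \<open>x\<close>, and \<open>(x, False)\<close> for its inverse.\<close>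

type_synonym 'g word = "('g \<times> bool) list"

inductive pres_eq :: "'g set \<Rightarrow> ('g word \<times> 'g word) set \<Rightarrow> 'g word \<Rightarrow> 'g word \<Rightarrow> bool"
  for Gs :: "'g set" and Rs :: "('g word \<times> 'g word) set"
where
  refl: "w \<in> lists (Gs \<times> UNIV) \<Longrightarrow> pres_eq Gs Rs w w"
| sym: "pres_eq Gs Rs u v \<Longrightarrow> pres_eq Gs Rs v u"
| trans: "pres_eq Gs Rs u v \<Longrightarrow> pres_eq Gs Rs v w \<Longrightarrow> pres_eq Gs Rs u w"
| append: "pres_eq Gs Rs u u' \<Longrightarrow> pres_eq Gs Rs v v' \<Longrightarrow> pres_eq Gs Rs (u @ v) (u' @ v')"
| cancel: "x \<in> Gs \<Longrightarrow> pres_eq Gs Rs [(x, e), (x, \<not> e)] []"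
| rel: "(u, v) \<in> Rs \<Longrightarrow> u \<in> lists (Gs \<times> UNIV) \<Longrightarrow> v \<in> lists (Gs \<times> UNIV) \<Longrightarrow> pres_eq Gs Rs u v"

definition pres_class :: "'g set \<Rightarrow> ('g word \<times> 'g word) set \<Rightarrow> 'g word \<Rightarrow> 'g word set" where
  "pres_class Gs Rs w = {w'. pres_eq Gs Rs w w'}"

definition presented_group :: "'g set \<Rightarrow> ('g word \<times> 'g word) set \<Rightarrow> 'g word set monoid" where
  "presented_group Gs Rs =
     \<lparr>carrier = pres_class Gs Rs ` lists (Gs \<times> UNIV),
      mult = (\<lambda>A B. \<Union>u\<in>A. \<Union>v\<in>B. pres_class Gs Rs (u @ v)),
      one = pres_class Gs Rs []\<rparr>"

definition free_group :: "nat \<Rightarrow> nat word set monoid" where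
  "free_group n = presented_group {1..n} {}"

definition free_gen :: "nat \<Rightarrow> nat \<Rightarrow> nat word set" where
  "free_gen n j = pres_class {1..n} {} [(j, True)]"

definition braid_relations :: "nat \<Rightarrow> (nat word \<times> nat word) set" where
  "braid_relations n =
     {([(i, True), (j, True)], [(j, True), (i, True)]) | i j.
        i \<in> {1..<n} \<and> j \<in> {1..<n} \<and> i + 2 \<le> j}
   \<union> {([(i, True), (i + 1, True), (i, True)], [(i + 1, True), (i, True), (i + 1, True)]) | i.
        i \<in> {1..<n} \<and> i + 1 \<in> {1..<n}}"

definition braid_group :: "nat \<Rightarrow> nat word set monoid" where
  "braid_group n = presented_group {1..<n} (braid_relations n)"

definition braid_gen :: "nat \<Rightarrow> nat \<Rightarrow> nat word set" where
  "braid_gen n i = pres_class {1..<n} (braid_relations n) [(i, True)]"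


section \<open>The Artin action and the semidirect product\<close>

text \<open>The values on the generators determine the homomorphism on the whole braid group.\<close>

definition artin_action :: "nat \<Rightarrow> (nat word set \<Rightarrow> nat word set \<Rightarrow> nat word set) \<Rightarrow> bool" where
  "artin_action n \<theta> \<longleftrightarrow>
     \<theta> \<in> hom (braid_group n) (AutoGroup (free_group n)) \<and>
     (\<forall>i\<in>{1..<n}.
        \<theta> (braid_gen n i) (free_gen n i) = free_gen n (i + 1) \<and>
        \<theta> (braid_gen n i) (free_gen n (i + 1)) =
          inv\<^bsub>free_group n\<^esub> (free_gen n (i + 1)) \<otimes>\<^bsub>free_group n\<^esub> free_gen n i
            \<otimes>\<^bsub>free_group n\<^esub> free_gen n (i + 1) \<and>
        (\<forall>j\<in>{1..n} - {i, i + 1}. \<theta> (braid_gen n i) (free_gen n j) = free_gen n j))"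

text \<open>The pair \<open>(u, \<sigma>)\<close> stands for the product \<open>u \<sigma>\<close>, so that \<open>\<sigma> u \<sigma>\<inverse> = \<theta> \<sigma> u\<close>.\<close>

definition semidirect ::
  "('b \<Rightarrow> 'f \<Rightarrow> 'f) \<Rightarrow> 'f monoid \<Rightarrow> 'b monoid \<Rightarrow> ('f \<times> 'b) monoid" where
  "semidirect \<theta> F B =
     \<lparr>carrier = carrier F \<times> carrier B,
      mult = (\<lambda>(u, \<sigma>) (v, \<tau>). (u \<otimes>\<^bsub>F\<^esub> \<theta> \<sigma> v, \<sigma> \<otimes>\<^bsub>B\<^esub> \<tau>)),
      one = (\<one>\<^bsub>F\<^esub>, \<one>\<^bsub>B\<^esub>)\<rparr>"

abbreviation free_braid_group ::
  "nat \<Rightarrow> (nat word set \<Rightarrow> nat word set \<Rightarrow> nat word set) \<Rightarrow> (nat word set \<times> nat word set) monoid"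
where
  "free_braid_group n \<theta> \<equiv> semidirect \<theta> (free_group n) (braid_group n)"

definition x_gen :: "nat \<Rightarrow> nat \<Rightarrow> nat word set \<times> nat word set" where
  "x_gen n j = (free_gen n j, \<one>\<^bsub>braid_group n\<^esub>)"

definition sigma_gen :: "nat \<Rightarrow> nat \<Rightarrow> nat word set \<times> nat word set" where
  "sigma_gen n i = (\<one>\<^bsub>free_group n\<^esub>, braid_gen n i)"


section \<open>Linear algebra on carrier-based vector spaces\<close>

definition GL :: "('a::field, 'v) module \<Rightarrow> ('v \<Rightarrow> 'v) monoid" where
  "GL V = BijGroup (carrier V)
     \<lparr>carrier := Bij (carrier V) \<inter> module_hom class_ring V V\<rparr>"

definition power_space :: "nat \<Rightarrow> ('a::field, 'v) module \<Rightarrow> ('a, nat \<Rightarrow> 'v) module" where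
  "power_space n V =
     \<lparr>carrier = {1..n} \<rightarrow>\<^sub>E carrier V,
      mult = undefined,
      one = undefined,
      zero = (\<lambda>j\<in>{1..n}. \<zero>\<^bsub>V\<^esub>),
      add = (\<lambda>v w. \<lambda>j\<in>{1..n}. v j \<oplus>\<^bsub>V\<^esub> w j),
      smult = (\<lambda>c v. \<lambda>j\<in>{1..n}. c \<odot>\<^bsub>V\<^esub> v j)\<rparr>"

text \<open>The scalar multiple of a coset \<open>A\<close> is not the pointwise one: for \<open>c = 0\<close> it has to be \<open>U\<close>.\<close>

definition quot_space :: "('a::field, 'v) module \<Rightarrow> 'v set \<Rightarrow> ('a, 'v set) module" where
  "quot_space V U =
     \<lparr>carrier = a_rcosets\<^bsub>V\<^esub> U,
      mult = undefined,
      one = undefined,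
      zero = U,
      add = (\<lambda>A B. A <+>\<^bsub>V\<^esub> B),
      smult = (\<lambda>c A. \<Union>v\<in>A. U +>\<^bsub>V\<^esub> (c \<odot>\<^bsub>V\<^esub> v))\<rparr>"

definition quot_map :: "('a::field, 'v) module \<Rightarrow> 'v set \<Rightarrow> ('v \<Rightarrow> 'v) \<Rightarrow> 'v set \<Rightarrow> 'v set" where
  "quot_map V U T = (\<lambda>A\<in>carrier (quot_space V U). \<Union>v\<in>A. U +>\<^bsub>V\<^esub> T v)"

abbreviation sub_space :: "('a::field, 'v) module \<Rightarrow> 'v set \<Rightarrow> ('a, 'v) module" where
  "sub_space V U \<equiv> V\<lparr>carrier := U\<rparr>"

definition sub_scalar :: "('a::field, 'v) module \<Rightarrow> ('v \<Rightarrow> 'v) \<Rightarrow> 'a \<Rightarrow> 'v \<Rightarrow> 'v" where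
  "sub_scalar V T c = (\<lambda>v. T v \<ominus>\<^bsub>V\<^esub> (c \<odot>\<^bsub>V\<^esub> v))"

definition eigenspace :: "('a::field, 'v) module \<Rightarrow> ('v \<Rightarrow> 'v) \<Rightarrow> 'a \<Rightarrow> 'v set" where
  "eigenspace V T c = {v \<in> carrier V. sub_scalar V T c v = \<zero>\<^bsub>V\<^esub>}"

definition matrix_rep ::
  "('a::field, 'v) module \<Rightarrow> 'v list \<Rightarrow> ('v \<Rightarrow> 'v) \<Rightarrow> 'a mat \<Rightarrow> bool" where
  "matrix_rep V bs T A \<longleftrightarrow>
     distinct bs \<and> vectorspace.basis class_ring V (set bs) \<and>
     A \<in> carrier_mat (length bs) (length bs) \<and>
     (\<forall>j<length bs. T (bs ! j) =
        (\<Oplus>\<^bsub>V\<^esub> i\<in>{..<length bs}. (A $$ (i, j)) \<odot>\<^bsub>V\<^esub> (bs ! i)))"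

text \<open>The value of a similarity-invariant matrix function \<open>f\<close> at an endomorphism, computed in
  an arbitrary basis.\<close>

definition endo_invariant ::
  "('a mat \<Rightarrow> 'b) \<Rightarrow> ('a::field, 'v) module \<Rightarrow> ('v \<Rightarrow> 'v) \<Rightarrow> 'b" where
  "endo_invariant f V T = (THE p. \<exists>bs A. matrix_rep V bs T A \<and> p = f A)"

definition endo_char_poly :: "('a::field, 'v) module \<Rightarrow> ('v \<Rightarrow> 'v) \<Rightarrow> 'a poly" where
  "endo_char_poly = endo_invariant char_poly"

definition det_z_plus :: "('a::field, 'v) module \<Rightarrow> ('v \<Rightarrow> 'v) \<Rightarrow> 'a poly" where
  "det_z_plus = endo_invariant
     (\<lambda>A. det ([:0, 1:] \<cdot>\<^sub>m 1\<^sub>m (dim_row A) + map_mat (\<lambda>c. [:c:]) A))"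

definition det_z2_minus :: "('a::field, 'v) module \<Rightarrow> ('v \<Rightarrow> 'v) \<Rightarrow> 'a poly" where
  "det_z2_minus = endo_invariant
     (\<lambda>A. det ([:0, 1:]^2 \<cdot>\<^sub>m 1\<^sub>m (dim_row A) - map_mat (\<lambda>c. [:c:]) A))"

definition ac_eigenvalues ::
  "('a::field, 'v) module \<Rightarrow> ('v \<Rightarrow> 'v) \<Rightarrow> 'a alg_closure set" where
  "ac_eigenvalues V T = {z. \<exists>bs A. matrix_rep V bs T A \<and> eigenvalue (map_mat to_ac A) z}"

definition semisimple_endo :: "('a::field, 'v) module \<Rightarrow> ('v \<Rightarrow> 'v) \<Rightarrow> bool" where
  "semisimple_endo V T \<longleftrightarrow>
     (\<forall>U. submodule class_ring U V \<and> T ` U \<subseteq> U \<longrightarrow>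
       (\<exists>U'. submodule class_ring U' V \<and> T ` U' \<subseteq> U' \<and>
             U \<inter> U' = {\<zero>\<^bsub>V\<^esub>} \<and> U <+>\<^bsub>V\<^esub> U' = carrier V))"


section \<open>The twisted Long--Moody and Katz--Long--Moody constructions\<close>

text \<open>Block matrices act on columns \<open>(w 1, \<dots>, w n)\<close>; \<open>LM_x\<close> and \<open>LM_sigma\<close> are the resulting
  operators. In \<open>LM_sigma\<close> the block diagonal matrix with the block
  \<open>(0, g i; 1, 1 - g (i + 1))\<close> is applied first and \<open>s i\<close> then to every component.\<close>

definition LM_x ::
  "nat \<Rightarrow> ('a::field, 'v) module \<Rightarrow> (nat \<Rightarrow> 'v \<Rightarrow> 'v) \<Rightarrow> 'a \<Rightarrow> nat \<Rightarrow> (nat \<Rightarrow> 'v) \<Rightarrow> nat \<Rightarrow> 'v" where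
  "LM_x n V g c i = (\<lambda>w\<in>carrier (power_space n V). \<lambda>j\<in>{1..n}.
     if j = i then
       (\<Oplus>\<^bsub>V\<^esub> l\<in>{1..n}.
          if l < i then c \<odot>\<^bsub>V\<^esub> (g l (w l) \<ominus>\<^bsub>V\<^esub> w l)
          else if l = i then c \<odot>\<^bsub>V\<^esub> g i (w i)
          else g l (w l) \<ominus>\<^bsub>V\<^esub> w l)
     else w j)"

definition LM_sigma ::
  "nat \<Rightarrow> ('a::field, 'v) module \<Rightarrow> (nat \<Rightarrow> 'v \<Rightarrow> 'v) \<Rightarrow> (nat \<Rightarrow> 'v \<Rightarrow> 'v) \<Rightarrow> nat \<Rightarrow>
     (nat \<Rightarrow> 'v) \<Rightarrow> nat \<Rightarrow> 'v" where
  "LM_sigma n V g s i = (\<lambda>w\<in>carrier (power_space n V). \<lambda>j\<in>{1..n}.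
     s i (if j = i then g i (w (i + 1))
          else if j = i + 1 then w i \<oplus>\<^bsub>V\<^esub> (w (i + 1) \<ominus>\<^bsub>V\<^esub> g (i + 1) (w (i + 1)))
          else w j))"

text \<open>As for the Artin action, the representation is pinned down by its values on the generators.\<close>

definition twisted_long_moody ::
  "nat \<Rightarrow> (nat word set \<Rightarrow> nat word set \<Rightarrow> nat word set) \<Rightarrow> ('a::field, 'v) module \<Rightarrow>
   (nat word set \<times> nat word set \<Rightarrow> 'v \<Rightarrow> 'v) \<Rightarrow> 'a \<Rightarrow>
   (nat word set \<times> nat word set \<Rightarrow> (nat \<Rightarrow> 'v) \<Rightarrow> (nat \<Rightarrow> 'v)) \<Rightarrow> bool" where
  "twisted_long_moody n \<theta> V \<rho> c \<rho>LM \<longleftrightarrow>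
     \<rho>LM \<in> hom (free_braid_group n \<theta>) (GL (power_space n V)) \<and>
     (\<forall>j\<in>{1..n}. \<rho>LM (x_gen n j) = LM_x n V (\<lambda>l. \<rho> (x_gen n l)) c j) \<and>
     (\<forall>i\<in>{1..<n}. \<rho>LM (sigma_gen n i) =
        LM_sigma n V (\<lambda>l. \<rho> (x_gen n l)) (\<lambda>l. \<rho> (sigma_gen n l)) i)"

definition KLM_K ::
  "nat \<Rightarrow> ('a::field, 'v) module \<Rightarrow> (nat word set \<times> nat word set \<Rightarrow> 'v \<Rightarrow> 'v) \<Rightarrow> (nat \<Rightarrow> 'v) set"
where
  "KLM_K n V \<rho> = {w \<in> carrier (power_space n V). \<forall>j\<in>{1..n}. w j \<in> eigenspace V (\<rho> (x_gen n j)) 1}"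

definition KLM_L ::
  "nat \<Rightarrow> ('a::field, 'v) module \<Rightarrow>
   (nat word set \<times> nat word set \<Rightarrow> (nat \<Rightarrow> 'v) \<Rightarrow> (nat \<Rightarrow> 'v)) \<Rightarrow> (nat \<Rightarrow> 'v) set" where
  "KLM_L n V \<rho>LM = (\<Inter>j\<in>{1..n}. eigenspace (power_space n V) (\<rho>LM (x_gen n j)) 1)"

definition KLM_KL ::
  "nat \<Rightarrow> ('a::field, 'v) module \<Rightarrow> (nat word set \<times> nat word set \<Rightarrow> 'v \<Rightarrow> 'v) \<Rightarrow>
   (nat word set \<times> nat word set \<Rightarrow> (nat \<Rightarrow> 'v) \<Rightarrow> (nat \<Rightarrow> 'v)) \<Rightarrow> (nat \<Rightarrow> 'v) set" where
  "KLM_KL n V \<rho> \<rho>LM = KLM_K n V \<rho> <+>\<^bsub>power_space n V\<^esub> KLM_L n V \<rho>LM"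

definition KLM_space ::
  "nat \<Rightarrow> ('a::field, 'v) module \<Rightarrow> (nat word set \<times> nat word set \<Rightarrow> 'v \<Rightarrow> 'v) \<Rightarrow>
   (nat word set \<times> nat word set \<Rightarrow> (nat \<Rightarrow> 'v) \<Rightarrow> (nat \<Rightarrow> 'v)) \<Rightarrow> ('a, (nat \<Rightarrow> 'v) set) module" where
  "KLM_space n V \<rho> \<rho>LM = quot_space (power_space n V) (KLM_KL n V \<rho> \<rho>LM)"

definition KLM_rep ::
  "nat \<Rightarrow> ('a::field, 'v) module \<Rightarrow> (nat word set \<times> nat word set \<Rightarrow> 'v \<Rightarrow> 'v) \<Rightarrow>
   (nat word set \<times> nat word set \<Rightarrow> (nat \<Rightarrow> 'v) \<Rightarrow> (nat \<Rightarrow> 'v)) \<Rightarrow>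
   nat word set \<times> nat word set \<Rightarrow> (nat \<Rightarrow> 'v) set \<Rightarrow> (nat \<Rightarrow> 'v) set" where
  "KLM_rep n V \<rho> \<rho>LM \<gamma> = quot_map (power_space n V) (KLM_KL n V \<rho> \<rho>LM) (\<rho>LM \<gamma>)"

end

theory Submission
  imports Defs
begin

text \<open>Write \<open>S\<close> for the Long--Moody operator of \<open>\<sigma>\<^sub>i\<close>. On \<open>V\<^sup>n\<close> it mixes only the components \<open>i\<close> and \<open>i + 1\<close> and
acts by \<open>s\<close> on every other one. The characteristic polynomial of an operator is the product of
those on the kernel and on the image of an intertwining linear surjection (\<open>char_poly_exact\<close>), so
each polynomial in the formula is found by exhibiting surjections that intertwine \<open>S\<close> with an
operator on a smaller space. The only input from the group is the set of relations
\<open>s g\<^sub>i = g\<^sub>i\<^sub>+\<^sub>1 s\<close>, \<open>g\<^sub>i\<^sub>+\<^sub>1 s g\<^sub>i\<^sub>+\<^sub>1 = g\<^sub>i g\<^sub>i\<^sub>+\<^sub>1 s\<close> and \<open>s g\<^sub>j = g\<^sub>j s\<close> for the other \<open>j\<close>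
(\<open>braid_rep_relations\<close>).

Numerator (\<open>char_poly_S\<close>). The map \<open>p w = w\<^sub>i - g\<^sub>i\<^sub>+\<^sub>1 w\<^sub>i\<^sub>+\<^sub>1\<close> satisfies \<open>p S = - s g\<^sub>i p\<close>, which gives the
factor \<open>det (z + s g\<^sub>i)\<close>. On its kernel \<open>w \<mapsto> w\<^sub>i\<^sub>+\<^sub>1\<close> intertwines \<open>S\<close> with \<open>s\<close>, and the kernel of that
map consists of the \<open>n - 2\<close> components on which \<open>S\<close> is \<open>s\<close>.

Denominator. On \<open>K\<close> (\<open>char_poly_K\<close>) the components \<open>k \<noteq> i, i + 1\<close> give the restrictions of \<open>s\<close> to
\<open>W\<^sub>k\<close>, while on \<open>W\<^sub>i \<oplus> W\<^sub>i\<^sub>+\<^sub>1\<close> the operator is \<open>(a, b) \<mapsto> (s g\<^sub>i b, s a)\<close>; since \<open>s\<close> maps \<open>W\<^sub>i\<close>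
bijectively to \<open>W\<^sub>i\<^sub>+\<^sub>1\<close>, this is the block matrix with blocks \<open>0, A, 1, 0\<close> for \<open>A = s g\<^sub>i s\<close> on \<open>W\<^sub>i\<close>,
whose characteristic polynomial is \<open>det (z\<^sup>2 - A)\<close>. On \<open>L\<close> (\<open>char_poly_L\<close>) consecutive equations
differ by a multiple of \<open>1 - \<lambda>\<close>, so that, as \<open>\<lambda> \<noteq> 1\<close>, they amount to \<open>w\<^sub>j = g\<^sub>j\<^sub>+\<^sub>1 w\<^sub>j\<^sub>+\<^sub>1\<close>; after
telescoping, the first equation becomes \<open>\<lambda> g\<^sub>1 \<cdots> g\<^sub>n w\<^sub>n = w\<^sub>n\<close>. Hence \<open>w \<mapsto> w\<^sub>n\<close> identifies \<open>L\<close>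
with \<open>E\<^sub>\<lambda>\<close> and \<open>S\<close> with \<open>s\<close>. A vector of \<open>K \<inter> L\<close> has equal components, fixed by every \<open>g\<^sub>j\<close>, and
then \<open>\<lambda> w\<^sub>1 = w\<^sub>1\<close> forces it to vanish (\<open>K_L_zero\<close>). So the sum \<open>K + L\<close> is direct, the
denominator is the characteristic polynomial of \<open>S\<close> on \<open>K + L\<close>, and the quotient of the two
polynomials is the one of the induced operator on \<open>V\<^sup>n/(K + L)\<close>.

For the Hecke relation, \<open>(T - a) (T - b)\<close> on the quotient is induced by \<open>(S - a) (S - b)\<close>. If
\<open>(T - a) (T - b) = 0\<close> with \<open>a \<noteq> b\<close>, then \<open>(a - b) x = (T - b) x - (T - a) x\<close> writes every vector as a
combination of two eigenvectors. An invariant subspace that meets a given one \<open>U\<close> only in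
zero and is maximal with this property can therefore be enlarged by an eigenvector unless it is a complement of \<open>U\<close>.\<close>

section \<open>Linear maps and coordinates\<close>

abbreviation lin :: "('a::field, 'v) module \<Rightarrow> ('a, 'w) module \<Rightarrow> ('v \<Rightarrow> 'w) set" where
  "lin V W \<equiv> module_hom class_ring V W"

lemma linI:
  assumes "\<And>v. v \<in> carrier V \<Longrightarrow> f v \<in> carrier W"
    and "\<And>u v. u \<in> carrier V \<Longrightarrow> v \<in> carrier V \<Longrightarrow> f (u \<oplus>\<^bsub>V\<^esub> v) = f u \<oplus>\<^bsub>W\<^esub> f v"
    and "\<And>c v. v \<in> carrier V \<Longrightarrow> f (c \<odot>\<^bsub>V\<^esub> v) = c \<odot>\<^bsub>W\<^esub> f v"
  shows "f \<in> lin V W"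
  using assms by (auto simp: module_hom_def)

lemma linD:
  assumes "f \<in> lin V W"
  shows "v \<in> carrier V \<Longrightarrow> f v \<in> carrier W"
    and "u \<in> carrier V \<Longrightarrow> v \<in> carrier V \<Longrightarrow> f (u \<oplus>\<^bsub>V\<^esub> v) = f u \<oplus>\<^bsub>W\<^esub> f v"
    and "v \<in> carrier V \<Longrightarrow> f (c \<odot>\<^bsub>V\<^esub> v) = c \<odot>\<^bsub>W\<^esub> f v"
  using assms by (auto simp: module_hom_def)

text \<open>The locale facts about modules, with the operations of \<^const>\<open>class_ring\<close> replaced by those of the
  type class. This form needs no interpretation of the large field locale at each use.\<close>
lemma vsD:
  fixes V :: "('a::field, 'v) module" (structure)
  assumes "vectorspace class_ring V"
  shows vs_module: "module class_ring V" and vs_group: "abelian_group V"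
    and vs_smult_closed: "v \<in> carrier V \<Longrightarrow> c \<odot> v \<in> carrier V"
    and vs_l_distr: "v \<in> carrier V \<Longrightarrow> (a + b) \<odot> v = a \<odot> v \<oplus> b \<odot> v"
    and vs_r_distr: "u \<in> carrier V \<Longrightarrow> v \<in> carrier V \<Longrightarrow>
          c \<odot> (u \<oplus> v) = c \<odot> u \<oplus> c \<odot> v"
    and vs_assoc: "v \<in> carrier V \<Longrightarrow> (a * b) \<odot> v = a \<odot> (b \<odot> v)"
    and vs_one: "v \<in> carrier V \<Longrightarrow> 1 \<odot> v = v"
    and vs_zero_smult: "v \<in> carrier V \<Longrightarrow> 0 \<odot> v = \<zero>"
    and vs_smult_zero: "c \<odot> \<zero> = \<zero>"
    and vs_minus_smult: "v \<in> carrier V \<Longrightarrow> (- c) \<odot> v = \<ominus> (c \<odot> v)"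
    and vs_smult_minus: "v \<in> carrier V \<Longrightarrow> c \<odot> (\<ominus> v) = \<ominus> (c \<odot> v)"
proof -
  interpret vectorspace class_ring V by fact
  show "module class_ring V" "abelian_group V" by unfold_locales
  show "v \<in> carrier V \<Longrightarrow> c \<odot> v \<in> carrier V" by simp
  show "v \<in> carrier V \<Longrightarrow> (a + b) \<odot> v = a \<odot> v \<oplus> b \<odot> v"
    using smult_l_distr[of a b v] by simp
  show "u \<in> carrier V \<Longrightarrow> v \<in> carrier V \<Longrightarrow>
          c \<odot> (u \<oplus> v) = c \<odot> u \<oplus> c \<odot> v"
    using smult_r_distr[of c u v] by simp
  show "v \<in> carrier V \<Longrightarrow> (a * b) \<odot> v = a \<odot> (b \<odot> v)"
    using smult_assoc1[of a b v] by simp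
  show "v \<in> carrier V \<Longrightarrow> 1 \<odot> v = v" using smult_one[of v] by simp
  have z: "0 \<odot> v = \<zero>" if "v \<in> carrier V" for v using lmult_0[OF that] by simp
  then show "v \<in> carrier V \<Longrightarrow> 0 \<odot> v = \<zero>" .
  show "c \<odot> \<zero> = \<zero>" using rmult_0[of c] by simp
  have m1: "v \<in> carrier V \<Longrightarrow> (- 1) \<odot> v = \<ominus> v" for v
  proof -
    assume v: "v \<in> carrier V"
    then have "(- 1) \<odot> v \<oplus> v = \<zero>"
      using smult_l_distr[of "- 1" 1 v] z[OF v] smult_one[of v] by simp
    from M.minus_equality[OF this] v show ?thesis by simp
  qed
  show "v \<in> carrier V \<Longrightarrow> (- c) \<odot> v = \<ominus> (c \<odot> v)"
    using smult_assoc1[of "-1" c v] by (simp add: m1)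
  show "v \<in> carrier V \<Longrightarrow> c \<odot> (\<ominus> v) = \<ominus> (c \<odot> v)"
    using smult_assoc1[of "-1" c v] smult_assoc1[of c "-1" v] by (simp add: m1 flip: m1)
qed

lemma lin_mod_hom:
  assumes "vectorspace class_ring V" "vectorspace class_ring W" "f \<in> lin V W"
  shows "mod_hom class_ring V W f"
  using assms by (simp add: mod_hom_def mod_hom_axioms_def vs_module)

lemma lin_zero:
  assumes "vectorspace class_ring V" "vectorspace class_ring W" "f \<in> lin V W"
  shows "f \<zero>\<^bsub>V\<^esub> = \<zero>\<^bsub>W\<^esub>"
  using mod_hom.f0_is_0[OF lin_mod_hom[OF assms]] .

lemma lin_minus:
  assumes "vectorspace class_ring V" "vectorspace class_ring W" "f \<in> lin V W"
    and "u \<in> carrier V" "v \<in> carrier V"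
  shows "f (u \<ominus>\<^bsub>V\<^esub> v) = f u \<ominus>\<^bsub>W\<^esub> f v"
  using mod_hom.f_minus[OF lin_mod_hom[OF assms(1-3)] assms(4,5)] .

lemma lin_comp:
  assumes "f \<in> lin V W" "g \<in> lin W Z"
  shows "(\<lambda>v. g (f v)) \<in> lin V Z"
  using assms by (auto simp: module_hom_def Pi_def)

lemma lin_inj:
  assumes V: "vectorspace class_ring V" and W: "vectorspace class_ring W" and f: "f \<in> lin V W"
    and k: "\<And>v. v \<in> carrier V \<Longrightarrow> f v = \<zero>\<^bsub>W\<^esub> \<Longrightarrow> v = \<zero>\<^bsub>V\<^esub>"
  shows "inj_on f (carrier V)"
proof (rule inj_onI)
  interpret V: abelian_group V by (rule vs_group[OF V])
  interpret W: abelian_group W by (rule vs_group[OF W])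
  fix u v assume uv: "u \<in> carrier V" "v \<in> carrier V" "f u = f v"
  have "f (u \<ominus>\<^bsub>V\<^esub> v) = \<zero>\<^bsub>W\<^esub>"
    using lin_minus[OF V W f uv(1,2)] linD(1)[OF f uv(1)] uv by (simp add: W.r_neg a_minus_def)
  from k[OF _ this] uv show "u = v" by simp
qed

lemma lin_finsum:
  assumes V: "vectorspace class_ring V" and W: "vectorspace class_ring W" and f: "f \<in> lin V W"
    and "finite A" "g \<in> A \<rightarrow> carrier V"
  shows "f (finsum V g A) = finsum W (\<lambda>a. f (g a)) A"
  using assms(4,5)
proof (induct A rule: finite_induct)
  case empty
  interpret V: abelian_group V by (rule vs_group[OF V])
  interpret W: abelian_group W by (rule vs_group[OF W])
  show ?case using lin_zero[OF V W f] by simp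
next
  case (insert x F)
  interpret V: abelian_group V by (rule vs_group[OF V])
  interpret W: abelian_group W by (rule vs_group[OF W])
  from insert have "f (g x \<oplus>\<^bsub>V\<^esub> finsum V g F) = f (g x) \<oplus>\<^bsub>W\<^esub> f (finsum V g F)"
    by (intro linD(2)[OF f]) auto
  with insert linD(1)[OF f] show ?case by (simp add: Pi_def)
qed

abbreviation vec_sp :: "nat \<Rightarrow> ('a::field, 'a vec) module" where
  "vec_sp m \<equiv> module_vec TYPE('a) m"

lemma vec_sp_simps [simp]:
  "carrier (vec_sp m) = carrier_vec m" "\<zero>\<^bsub>vec_sp m\<^esub> = 0\<^sub>v m"
  "u \<oplus>\<^bsub>vec_sp m\<^esub> v = u + v" "c \<odot>\<^bsub>vec_sp m\<^esub> v = c \<cdot>\<^sub>v v"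
  by (simp_all add: module_vec_simps)

lemma vec_finsum:
  assumes "finite F" "f \<in> F \<rightarrow> carrier_vec m"
  shows "finsum (vec_sp m) f F = (vec m (\<lambda>i. \<Sum>j\<in>F. f j $ i) :: 'a::field vec)"
proof -
  have "finsum (vec_sp m) f F = finsum_vec TYPE('a) m f F" by (simp add: vec_space.finsum_vec)
  moreover have "finsum_vec TYPE('a) m f F = vec m (\<lambda>i. \<Sum>j\<in>F. f j $ i)"
    using assms finsum_vec_closed[of f F m] by (intro eq_vecI) (auto simp: index_finsum_vec)
  ultimately show ?thesis by simp
qed

lemma vec_unit_expand:
  assumes "v \<in> carrier_vec m"
  shows "v = finsum (vec_sp m) (\<lambda>i. v $ i \<cdot>\<^sub>v unit_vec m i) {..<m}"
proof -
  have "(\<Sum>j<m. v $ j * (if i = j then 1 else 0)) = v $ i" if "i < m" for i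
    using that by (simp add: if_distrib cong: if_cong)
  then show ?thesis using assms by (subst vec_finsum) (auto simp: unit_vec_def)
qed

lemma lin_vec_expand:
  fixes V :: "('a::field, 'v) module" (structure)
  assumes V: "vectorspace class_ring V" and f: "f \<in> lin (vec_sp m) V" and v: "v \<in> carrier_vec m"
  shows "f v = (\<Oplus> i\<in>{..<m}. v $ i \<odot> f (unit_vec m i))"
proof -
  interpret V: abelian_group V by (rule vs_group[OF V])
  have "f v = f (finsum (vec_sp m) (\<lambda>i. v $ i \<cdot>\<^sub>v unit_vec m i) {..<m})"
    using vec_unit_expand[OF v] by simp
  also have "\<dots> = (\<Oplus> i\<in>{..<m}. f (v $ i \<cdot>\<^sub>v unit_vec m i))"
    by (rule lin_finsum[OF vec_vs V f]) auto
  also have "\<dots> = (\<Oplus> i\<in>{..<m}. v $ i \<odot> f (unit_vec m i))"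
    using linD[OF f] by (intro V.finsum_cong') (auto simp: vs_smult_closed[OF V])
  finally show ?thesis .
qed

text \<open>A linear map out of a coordinate space is determined by its values on the unit vectors.\<close>
lemma lin_vec_eqI:
  fixes V :: "('a::field, 'v) module" (structure)
  assumes V: "vectorspace class_ring V" and f: "f \<in> lin (vec_sp m) V" and g: "g \<in> lin (vec_sp m) V"
    and e: "\<And>i. i < m \<Longrightarrow> f (unit_vec m i) = g (unit_vec m i)" and v: "v \<in> carrier_vec m"
  shows "f v = g v"
proof -
  interpret V: abelian_group V by (rule vs_group[OF V])
  show ?thesis unfolding lin_vec_expand[OF V f v] lin_vec_expand[OF V g v]
    using linD(1)[OF g] e by (intro V.finsum_cong') (auto simp: vs_smult_closed[OF V])
qed

lemma mat_lin: "A \<in> carrier_mat k m \<Longrightarrow> (\<lambda>v. A *\<^sub>v v) \<in> lin (vec_sp m) (vec_sp k)"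
  by (rule linI) (auto simp: mult_add_distrib_mat_vec mult_mat_vec)

lemma mat_unit_col: "(A :: 'a::field mat) \<in> carrier_mat k m \<Longrightarrow> i < m \<Longrightarrow> A *\<^sub>v unit_vec m i = col A i"
  by (rule eq_vecI) auto

lemma mat_eq_by_action:
  assumes "A \<in> carrier_mat k m" "B \<in> carrier_mat k m"
    and "\<And>v. v \<in> carrier_vec m \<Longrightarrow> A *\<^sub>v v = B *\<^sub>v v"
  shows "A = (B :: 'a::field mat)"
proof -
  have "col A i = col B i" if "i < m" for i
    using assms(3)[of "unit_vec m i"] that assms(1,2) by (simp add: mat_unit_col)
  then show ?thesis using assms(1,2) by (intro mat_col_eqI) auto
qed

lemma lin_vec_matrix:
  assumes f: "f \<in> lin (vec_sp m) (vec_sp k :: ('a::field, 'a vec) module)"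
  shows "\<exists>M\<in>carrier_mat k m. \<forall>v\<in>carrier_vec m. f v = M *\<^sub>v v"
proof -
  define M where "M = mat_of_cols k (map (\<lambda>i. f (unit_vec m i)) [0..<m])"
  have M: "M \<in> carrier_mat k m" unfolding M_def by auto
  have "f v = M *\<^sub>v v" if v: "v \<in> carrier_vec m" for v
  proof (rule lin_vec_eqI[OF vec_vs f mat_lin[OF M] _ v])
    fix i assume i: "i < m"
    have "M *\<^sub>v unit_vec m i = col M i" by (rule mat_unit_col[OF M i])
    also have "\<dots> = f (unit_vec m i)" unfolding M_def using i linD(1)[OF f, of "unit_vec m i"]
      by (subst col_mat_of_cols) auto
    finally show "f (unit_vec m i) = M *\<^sub>v unit_vec m i" by simp
  qed
  with M show ?thesis by blast
qed

text \<open>A linear bijection from the space of coordinate vectors carries the same information as an ordered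
  basis, but it lets matrices act by \<open>*\<^sub>v\<close> and avoids sums indexed by basis vectors.\<close>
definition coords :: "('a::field, 'v) module \<Rightarrow> nat \<Rightarrow> ('a vec \<Rightarrow> 'v) \<Rightarrow> bool" where
  "coords V m \<phi> \<longleftrightarrow> \<phi> \<in> lin (vec_sp m) V \<and> bij_betw \<phi> (carrier_vec m) (carrier V)"

lemma coordsD:
  assumes "coords V m \<phi>"
  shows "\<phi> \<in> lin (vec_sp m) V" "inj_on \<phi> (carrier_vec m)" "\<phi> ` carrier_vec m = carrier V"
    "v \<in> carrier_vec m \<Longrightarrow> \<phi> v \<in> carrier V"
    "u \<in> carrier V \<Longrightarrow> \<exists>v\<in>carrier_vec m. u = \<phi> v"
  using assms unfolding coords_def bij_betw_def by auto

lemma coords_matrix: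
  fixes V :: "('a::field, 'v) module" (structure) and W :: "('a, 'w) module"
  assumes V: "vectorspace class_ring V" and W: "vectorspace class_ring W"
    and f: "f \<in> lin V W" and \<phi>: "coords V m \<phi>" and \<psi>: "coords W k \<psi>"
  shows "\<exists>M\<in>carrier_mat k m. \<forall>v\<in>carrier_vec m. f (\<phi> v) = \<psi> (M *\<^sub>v v)"
proof -
  define h where "h v = inv_into (carrier_vec k) \<psi> (f (\<phi> v))" for v
  have f\<phi>: "f (\<phi> v) \<in> \<psi> ` carrier_vec k" if "v \<in> carrier_vec m" for v
    using coordsD(4)[OF \<phi> that] linD(1)[OF f] coordsD(3)[OF \<psi>] by auto
  have h: "h v \<in> carrier_vec k" "\<psi> (h v) = f (\<phi> v)" if "v \<in> carrier_vec m" for v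
    using inv_into_into[OF f\<phi>[OF that]] f_inv_into_f[OF f\<phi>[OF that]] by (auto simp: h_def)
  have inj: "\<psi> x = \<psi> y \<Longrightarrow> x = y" if "x \<in> carrier_vec k" "y \<in> carrier_vec k" for x y
    using coordsD(2)[OF \<psi>] that by (auto dest: inj_onD)
  note l = linD[OF coordsD(1)[OF \<phi>]] linD[OF coordsD(1)[OF \<psi>]]
  have "h \<in> lin (vec_sp m) (vec_sp k)"
  proof (rule linI)
    fix u v :: "'a vec" assume a: "u \<in> carrier (vec_sp m)" "v \<in> carrier (vec_sp m)"
    then have "\<psi> (h (u + v)) = f (\<phi> (u + v))" by (intro h(2)) auto
    also have "\<dots> = f (\<phi> u) \<oplus>\<^bsub>W\<^esub> f (\<phi> v)"
      using a linD(2)[OF f, of "\<phi> u" "\<phi> v"] l(1,2) by auto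
    also have "\<dots> = \<psi> (h u + h v)" using h a l(5)[of "h u" "h v"] by auto
    finally show "h (u \<oplus>\<^bsub>vec_sp m\<^esub> v) = h u \<oplus>\<^bsub>vec_sp k\<^esub> h v" using h a by (auto intro: inj)
  next
    fix c and v :: "'a vec" assume a: "v \<in> carrier (vec_sp m)"
    then have "\<psi> (h (c \<cdot>\<^sub>v v)) = f (\<phi> (c \<cdot>\<^sub>v v))" by (intro h(2)) auto
    also have "\<dots> = c \<odot>\<^bsub>W\<^esub> f (\<phi> v)" using a linD(3)[OF f, of "\<phi> v"] l(1,3) by auto
    also have "\<dots> = \<psi> (c \<cdot>\<^sub>v h v)" using h a l(6)[of "h v"] by auto
    finally show "h (c \<odot>\<^bsub>vec_sp m\<^esub> v) = c \<odot>\<^bsub>vec_sp k\<^esub> h v" using h a by (auto intro: inj)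
  qed (use h in auto)
  then obtain M where M: "M \<in> carrier_mat k m" "\<forall>v\<in>carrier_vec m. h v = M *\<^sub>v v"
    using lin_vec_matrix by blast
  then have "f (\<phi> v) = \<psi> (M *\<^sub>v v)" if "v \<in> carrier_vec m" for v using h(2)[OF that] that by simp
  with M show ?thesis by blast
qed

definition comb :: "('a::field, 'v) module \<Rightarrow> nat \<Rightarrow> (nat \<Rightarrow> 'v) \<Rightarrow> 'a vec \<Rightarrow> 'v" where
  "comb V m b v = (\<Oplus>\<^bsub>V\<^esub> i\<in>{..<m}. v $ i \<odot>\<^bsub>V\<^esub> b i)"

lemma comb_lin:
  fixes V :: "('a::field, 'v) module" (structure)
  assumes V: "vectorspace class_ring V" and b: "\<And>i. i < m \<Longrightarrow> b i \<in> carrier V"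
  shows "comb V m b \<in> lin (vec_sp m) V"
    and "i < m \<Longrightarrow> comb V m b (unit_vec m i) = b i"
proof -
  interpret V: vectorspace class_ring V by (rule V)
  note [simp] = vs_smult_closed[OF V]
  show "comb V m b \<in> lin (vec_sp m) V"
  proof (rule linI)
    fix u v :: "'a vec" assume uv: "u \<in> carrier (vec_sp m)" "v \<in> carrier (vec_sp m)"
    show "comb V m b (u \<oplus>\<^bsub>vec_sp m\<^esub> v) = comb V m b u \<oplus> comb V m b v"
    proof -
      have "comb V m b (u + v) = (\<Oplus> i\<in>{..<m}. u $ i \<odot> b i \<oplus> v $ i \<odot> b i)"
        unfolding comb_def using b uv by (intro V.finsum_cong') (auto simp: vs_l_distr[OF V])
      also have "\<dots> = comb V m b u \<oplus> comb V m b v"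
        unfolding comb_def using b by (intro V.finsum_addf) auto
      finally show ?thesis by simp
    qed
  next
    fix c and v :: "'a vec" assume "v \<in> carrier (vec_sp m)"
    then show "comb V m b (c \<odot>\<^bsub>vec_sp m\<^esub> v) = c \<odot> comb V m b v"
      unfolding comb_def using b
      by (subst V.finsum_smult) (auto intro!: V.finsum_cong' simp: vs_assoc[OF V])
  qed (use b in \<open>auto simp: comb_def intro!: V.finsum_closed\<close>)
  assume i: "i < m"
  have "comb V m b (unit_vec m i) = (\<Oplus> j\<in>{..<m}. if i = j then b j else \<zero>)"
    unfolding comb_def using b i
    by (intro V.finsum_cong') (auto simp: vs_one[OF V] vs_zero_smult[OF V])
  also have "\<dots> = b i" using i b by (subst V.add.finprod_singleton) auto
  finally show "comb V m b (unit_vec m i) = b i" .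
qed

text \<open>The coefficient functions of the basis criterion live on the set of basis vectors; the inverse of
  \<open>(!) bs\<close> turns them into coordinate vectors.\<close>
lemma basis_coords:
  fixes V :: "('a::field, 'v) module" (structure)
  assumes V: "vectorspace class_ring V" and d: "distinct bs" and B: "vectorspace.basis class_ring V (set bs)"
  shows "coords V (length bs) (comb V (length bs) ((!) bs))"
proof -
  interpret V: vectorspace class_ring V by (rule V)
  note [simp] = vs_smult_closed[OF V]
  let ?m = "length bs" let ?\<phi> = "comb V ?m ((!) bs)"
  have bc: "set bs \<subseteq> carrier V" using B unfolding V.basis_def by auto
  then have nth: "\<And>i. i < ?m \<Longrightarrow> bs ! i \<in> carrier V" by auto
  have bij: "bij_betw ((!) bs) {..<?m} (set bs)" using d by (simp add: bij_betw_nth)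
  define ix where "ix = inv_into {..<?m} ((!) bs)"
  have ix: "\<And>i. i < ?m \<Longrightarrow> ix (bs ! i) = i"
    unfolding ix_def using bij by (auto simp: bij_betw_def intro: inv_into_f_f)
  have lc: "V.lincomb a (set bs) = ?\<phi> (vec ?m (\<lambda>i. a (bs ! i)))" for a
  proof -
    have "V.lincomb a (set bs) = (\<Oplus>v\<in>((!) bs) ` {..<?m}. a v \<odot> v)"
      unfolding V.lincomb_def using bij by (simp add: bij_betw_def)
    also have "\<dots> = (\<Oplus>i\<in>{..<?m}. a (bs ! i) \<odot> bs ! i)"
      using bij bc by (subst V.finsum_reindex) (auto simp: bij_betw_def)
    also have "\<dots> = ?\<phi> (vec ?m (\<lambda>i. a (bs ! i)))"
      unfolding comb_def using nth by (intro V.finsum_cong') auto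
    finally show ?thesis .
  qed
  have crit: "\<exists>! a. a \<in> set bs \<rightarrow>\<^sub>E UNIV \<and> V.lincomb a (set bs) = v" if "v \<in> carrier V" for v
    using V.basis_criterion[OF _ bc] B that by auto
  have \<phi>: "?\<phi> \<in> lin (vec_sp ?m) V" by (rule comb_lin(1)[OF V nth])
  define co where "co v = restrict (\<lambda>b. v $ ix b) (set bs)" for v :: "'a vec"
  have co: "co v \<in> set bs \<rightarrow>\<^sub>E UNIV" for v by (simp add: co_def)
  have vco: "vec ?m (\<lambda>i. co v (bs ! i)) = v" if "v \<in> carrier_vec ?m" for v
    using that by (intro eq_vecI) (auto simp: co_def ix)
  have "inj_on ?\<phi> (carrier_vec ?m)"
  proof (rule inj_onI)
    fix u v assume uv: "u \<in> carrier_vec ?m" "v \<in> carrier_vec ?m" "?\<phi> u = ?\<phi> v"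
    have "V.lincomb (co u) (set bs) = ?\<phi> v" "V.lincomb (co v) (set bs) = ?\<phi> v"
      unfolding lc using uv by (simp_all add: vco)
    with crit[of "?\<phi> v"] co linD(1)[OF \<phi>] uv have "co u = co v" by auto
    with vco[OF uv(1)] vco[OF uv(2)] show "u = v" by metis
  qed
  moreover have "?\<phi> ` carrier_vec ?m = carrier V"
  proof
    show "?\<phi> ` carrier_vec ?m \<subseteq> carrier V" using linD(1)[OF \<phi>] by auto
    show "carrier V \<subseteq> ?\<phi> ` carrier_vec ?m"
    proof
      fix v assume "v \<in> carrier V"
      from crit[OF this] obtain a where "V.lincomb a (set bs) = v" by blast
      then show "v \<in> ?\<phi> ` carrier_vec ?m" using lc[of a] by (auto intro!: image_eqI[of _ _ "vec ?m (\<lambda>i. a (bs ! i))"])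
    qed
  qed
  ultimately show ?thesis using \<phi> by (simp add: coords_def bij_betw_def)
qed

lemma coords_exists:
  fixes V :: "('a::field, 'v) module" (structure)
  assumes V: "vectorspace class_ring V" and fd: "vectorspace.fin_dim class_ring V"
  shows "\<exists>m \<phi>. coords V m \<phi>"
proof -
  interpret V: vectorspace class_ring V by (rule V)
  obtain B where "finite B" "V.basis B" using V.finite_basis_exists[OF fd] by auto
  then obtain bs where "distinct bs" "V.basis (set bs)" using finite_distinct_list by metis
  from basis_coords[OF V this] show ?thesis by blast
qed

lemma coords_basis:
  fixes V :: "('a::field, 'v) module" (structure)
  assumes V: "vectorspace class_ring V" and \<phi>: "coords V m \<phi>"
  shows "distinct (map (\<lambda>i. \<phi> (unit_vec m i)) [0..<m])"
    and "vectorspace.basis class_ring V (set (map (\<lambda>i. \<phi> (unit_vec m i)) [0..<m]))"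
    and "vectorspace.fin_dim class_ring V"
proof -
  interpret L: linear_map class_ring "vec_sp m" V \<phi>
    using vec_vs V coordsD(1)[OF \<phi>] vs_module[OF V] vs_module[OF vec_vs]
    unfolding linear_map_def mod_hom_def mod_hom_axioms_def by blast
  have fd: "vectorspace.fin_dim class_ring (vec_sp m :: ('a,'a vec) module)" by (simp add: vec_space.fin_dim)
  have "vectorspace.basis class_ring V (\<phi> ` set (unit_vecs m))"
    using coordsD(2,3)[OF \<phi>] by (intro L.linear_inj_image_is_basis fd) (auto intro: vec_space.unit_vecs_basis)
  moreover have "set (map (\<lambda>i. \<phi> (unit_vec m i)) [0..<m]) = \<phi> ` set (unit_vecs m)"
    by (auto simp: unit_vecs_def)
  ultimately show "vectorspace.basis class_ring V (set (map (\<lambda>i. \<phi> (unit_vec m i)) [0..<m]))" by simp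
  have "inj_on \<phi> (set (unit_vecs m))" using coordsD(2)[OF \<phi>] unit_vecs_carrier by (rule inj_on_subset)
  then have "distinct (map \<phi> (unit_vecs m))" by (simp add: distinct_map vec_space.unit_vecs_distinct)
  then show "distinct (map (\<lambda>i. \<phi> (unit_vec m i)) [0..<m])" by (simp add: unit_vecs_def comp_def)
  show "vectorspace.fin_dim class_ring V"
    using coordsD(3)[OF \<phi>] by (intro L.surj_fin_dim[OF fd]) auto
qed

lemma coords_matrix_rep:
  fixes V :: "('a::field, 'v) module" (structure)
  assumes V: "vectorspace class_ring V" and \<phi>: "coords V m \<phi>"
    and A: "A \<in> carrier_mat m m" and T: "\<And>v. v \<in> carrier_vec m \<Longrightarrow> T (\<phi> v) = \<phi> (A *\<^sub>v v)"
  shows "matrix_rep V (map (\<lambda>i. \<phi> (unit_vec m i)) [0..<m]) T A"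
proof -
  interpret V: vectorspace class_ring V by (rule V)
  have "T (\<phi> (unit_vec m j)) = (\<Oplus>i\<in>{..<m}. A $$ (i, j) \<odot> map (\<lambda>i. \<phi> (unit_vec m i)) [0..<m] ! i)"
    if j: "j < m" for j
  proof -
    have "T (\<phi> (unit_vec m j)) = \<phi> (col A j)" using T[of "unit_vec m j"] mat_unit_col[OF A j] by simp
    also have "\<dots> = (\<Oplus>i\<in>{..<m}. col A j $ i \<odot> \<phi> (unit_vec m i))"
      using A j by (intro lin_vec_expand[OF V coordsD(1)[OF \<phi>]]) auto
    also have "\<dots> = (\<Oplus>i\<in>{..<m}. A $$ (i, j) \<odot> map (\<lambda>i. \<phi> (unit_vec m i)) [0..<m] ! i)"
      using A j coordsD(4)[OF \<phi>] by (intro V.finsum_cong') (auto simp: vs_smult_closed[OF V])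
    finally show ?thesis .
  qed
  then show ?thesis using A coords_basis[OF V \<phi>] unfolding matrix_rep_def by simp
qed

lemma matrix_rep_coords:
  fixes V :: "('a::field, 'v) module" (structure)
  assumes V: "vectorspace class_ring V" and T: "T \<in> lin V V" and r: "matrix_rep V bs T A"
  shows "\<exists>\<phi>. coords V (length bs) \<phi> \<and> (\<forall>v\<in>carrier_vec (length bs). T (\<phi> v) = \<phi> (A *\<^sub>v v))"
proof -
  interpret V: vectorspace class_ring V by (rule V)
  let ?m = "length bs" let ?\<phi> = "comb V ?m ((!) bs)"
  have B: "V.basis (set bs)" and d: "distinct bs" and A: "A \<in> carrier_mat ?m ?m"
    using r by (auto simp: matrix_rep_def)
  have nth: "\<And>i. i < ?m \<Longrightarrow> bs ! i \<in> carrier V" using B unfolding V.basis_def by auto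
  have \<phi>: "coords V ?m ?\<phi>" by (rule basis_coords[OF V d B])
  have "T (?\<phi> v) = ?\<phi> (A *\<^sub>v v)" if v: "v \<in> carrier_vec ?m" for v
  proof (rule lin_vec_eqI[OF V _ _ _ v])
    show "(\<lambda>v. T (?\<phi> v)) \<in> lin (vec_sp ?m) V" by (rule lin_comp[OF coordsD(1)[OF \<phi>] T])
    show "(\<lambda>v. ?\<phi> (A *\<^sub>v v)) \<in> lin (vec_sp ?m) V" by (rule lin_comp[OF mat_lin[OF A] coordsD(1)[OF \<phi>]])
    fix j assume j: "j < ?m"
    have "T (?\<phi> (unit_vec ?m j)) = (\<Oplus>i\<in>{..<?m}. A $$ (i, j) \<odot> bs ! i)"
      using r j by (simp add: matrix_rep_def comb_lin(2)[OF V nth])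
    also have "\<dots> = ?\<phi> (col A j)" unfolding comb_def
      using A j nth by (intro V.finsum_cong') (auto simp: vs_smult_closed[OF V])
    finally show "T (?\<phi> (unit_vec ?m j)) = ?\<phi> (A *\<^sub>v unit_vec ?m j)" by (simp add: mat_unit_col[OF A j])
  qed
  with \<phi> show ?thesis by blast
qed

text \<open>Both representations come from coordinates of the same length, the dimension. The matrices of the
  two changes of coordinates are inverse to each other and conjugate one matrix into the other.\<close>
lemma matrix_rep_similar:
  fixes V :: "('a::field, 'v) module" (structure)
  assumes V: "vectorspace class_ring V" and T: "T \<in> lin V V"
    and A: "matrix_rep V as T A" and B: "matrix_rep V bs T B"
  shows "similar_mat A B"
proof -
  interpret V: vectorspace class_ring V by (rule V)
  obtain \<phi> where \<phi>: "coords V (length as) \<phi>" "\<forall>v\<in>carrier_vec (length as). T (\<phi> v) = \<phi> (A *\<^sub>v v)"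
    using matrix_rep_coords[OF V T A] by auto
  obtain \<psi> where \<psi>: "coords V (length bs) \<psi>" "\<forall>v\<in>carrier_vec (length bs). T (\<psi> v) = \<psi> (B *\<^sub>v v)"
    using matrix_rep_coords[OF V T B] by auto
  have len: "length as = length bs"
    using A B V.dim_basis[of "set as"] V.dim_basis[of "set bs"] unfolding matrix_rep_def
    by (auto simp: distinct_card)
  let ?m = "length bs"
  have Am: "A \<in> carrier_mat ?m ?m" and Bm: "B \<in> carrier_mat ?m ?m" using A B len by (auto simp: matrix_rep_def)
  have id: "(\<lambda>x. x) \<in> lin V V" by (rule linI) auto
  obtain P where P: "P \<in> carrier_mat ?m ?m" "\<forall>v\<in>carrier_vec ?m. \<phi> v = \<psi> (P *\<^sub>v v)"
    using coords_matrix[OF V V id \<phi>(1) \<psi>(1)] len by auto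
  obtain Q where Q: "Q \<in> carrier_mat ?m ?m" "\<forall>v\<in>carrier_vec ?m. \<psi> v = \<phi> (Q *\<^sub>v v)"
    using coords_matrix[OF V V id \<psi>(1) \<phi>(1)] len by auto
  have i\<phi>: "\<phi> x = \<phi> y \<Longrightarrow> x = y" if "x \<in> carrier_vec ?m" "y \<in> carrier_vec ?m" for x y
    using coordsD(2)[OF \<phi>(1)] that len by (auto dest: inj_onD)
  have i\<psi>: "\<psi> x = \<psi> y \<Longrightarrow> x = y" if "x \<in> carrier_vec ?m" "y \<in> carrier_vec ?m" for x y
    using coordsD(2)[OF \<psi>(1)] that by (auto dest: inj_onD)
  note mv = mult_mat_vec_carrier
  have QP: "Q * P = 1\<^sub>m ?m"
  proof (rule mat_eq_by_action)
    fix v :: "'a vec" assume v: "v \<in> carrier_vec ?m"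
    have "\<phi> (Q *\<^sub>v (P *\<^sub>v v)) = \<phi> v" using P Q v mv[OF P(1) v] by metis
    then have "Q *\<^sub>v (P *\<^sub>v v) = v" using P Q v by (intro i\<phi>) auto
    then show "(Q * P) *\<^sub>v v = 1\<^sub>m ?m *\<^sub>v v" using P Q v by (simp add: assoc_mult_mat_vec[of _ ?m ?m _ ?m])
  qed (use P Q in auto)
  have PQ: "P * Q = 1\<^sub>m ?m"
  proof (rule mat_eq_by_action)
    fix v :: "'a vec" assume v: "v \<in> carrier_vec ?m"
    have "\<psi> (P *\<^sub>v (Q *\<^sub>v v)) = \<psi> v" using P Q v mv[OF Q(1) v] by metis
    then have "P *\<^sub>v (Q *\<^sub>v v) = v" using P Q v by (intro i\<psi>) auto
    then show "(P * Q) *\<^sub>v v = 1\<^sub>m ?m *\<^sub>v v" using P Q v by (simp add: assoc_mult_mat_vec[of _ ?m ?m _ ?m])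
  qed (use P Q in auto)
  have "A = Q * B * P"
  proof (rule mat_eq_by_action)
    fix v :: "'a vec" assume v: "v \<in> carrier_vec ?m"
    have Pv: "P *\<^sub>v v \<in> carrier_vec ?m" using P v by auto
    have BPv: "B *\<^sub>v (P *\<^sub>v v) \<in> carrier_vec ?m" using Bm Pv by auto
    have "\<phi> (A *\<^sub>v v) = T (\<psi> (P *\<^sub>v v))" using \<phi>(2) P v len by metis
    also have "\<dots> = \<psi> (B *\<^sub>v (P *\<^sub>v v))" using \<psi>(2) Pv by metis
    also have "\<dots> = \<phi> (Q *\<^sub>v (B *\<^sub>v (P *\<^sub>v v)))" using Q BPv by metis
    finally have "A *\<^sub>v v = Q *\<^sub>v (B *\<^sub>v (P *\<^sub>v v))" using Am Q BPv v by (intro i\<phi>) auto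
    then show "A *\<^sub>v v = Q * B * P *\<^sub>v v" using P Q Bm Pv v
      by (simp add: assoc_mult_mat_vec[of _ ?m ?m _ ?m])
  qed (use P Q Am Bm in auto)
  with P Q PQ QP Am Bm show ?thesis by (intro similar_matI[of A B Q P ?m]) auto
qed

text \<open>This removes the definite description: any coordinates may be used to evaluate a
  similarity-invariant function at an endomorphism.\<close>
lemma endo_invariant_eq:
  fixes V :: "('a::field, 'v) module" (structure)
  assumes f: "\<And>A B. similar_mat A B \<Longrightarrow> f A = f B"
    and V: "vectorspace class_ring V" and T: "T \<in> lin V V" and \<phi>: "coords V m \<phi>"
    and A: "A \<in> carrier_mat m m" and TA: "\<And>v. v \<in> carrier_vec m \<Longrightarrow> T (\<phi> v) = \<phi> (A *\<^sub>v v)"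
  shows "endo_invariant f V T = f A"
proof -
  have r: "matrix_rep V (map (\<lambda>i. \<phi> (unit_vec m i)) [0..<m]) T A"
    by (rule coords_matrix_rep[OF V \<phi> A TA])
  show ?thesis unfolding endo_invariant_def
  proof (rule the_equality)
    show "\<exists>bs A'. matrix_rep V bs T A' \<and> f A = f A'" using r by blast
    fix p assume "\<exists>bs A. matrix_rep V bs T A \<and> p = f A"
    then obtain bs B where "matrix_rep V bs T B" "p = f B" by auto
    with f[OF matrix_rep_similar[OF V T _ r]] show "p = f A" by blast
  qed
qed

section \<open>Characteristic polynomials of endomorphisms\<close>

lemma endo_char_poly_eq:
  fixes V :: "('a::field, 'v) module" (structure)
  assumes "vectorspace class_ring V" "T \<in> lin V V" "coords V m \<phi>" "A \<in> carrier_mat m m"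
    and "\<And>v. v \<in> carrier_vec m \<Longrightarrow> T (\<phi> v) = \<phi> (A *\<^sub>v v)"
  shows "endo_char_poly V T = char_poly A"
proof -
  have sim: "similar_mat A B \<Longrightarrow> char_poly A = char_poly B" for A B :: "'a mat"
    by (rule char_poly_similar)
  show ?thesis unfolding endo_char_poly_def
    using endo_invariant_eq[where f = char_poly, OF sim assms(1-4)] assms(5) by blast
qed

text \<open>The matrix of \<open>- T\<close> is \<open>- A\<close>, and its characteristic matrix is \<open>z + A\<close>. This reduces the second kind
  of determinant to characteristic polynomials.\<close>
lemma det_z_plus_char_poly:
  fixes V :: "('a::field, 'v) module" (structure)
  assumes V: "vectorspace class_ring V" and T: "T \<in> lin V V" and fd: "vectorspace.fin_dim class_ring V"
  shows "det_z_plus V T = endo_char_poly V (\<lambda>v. \<ominus> T v)"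
proof -
  interpret V: vectorspace class_ring V by (rule V)
  let ?f = "\<lambda>A :: 'a mat. det ([:0, 1:] \<cdot>\<^sub>m 1\<^sub>m (dim_row A) + map_mat (\<lambda>c. [:c:]) A)"
  have f: "?f A = char_poly (- A)" for A
    unfolding char_poly_def char_poly_matrix_def by (rule arg_cong[of _ _ det]) (auto intro!: eq_matI)
  have sim: "?f A = ?f B" if "similar_mat A B" for A B
  proof -
    from that obtain P Q n where *: "{A, B, P, Q} \<subseteq> carrier_mat n n" "P * Q = 1\<^sub>m n" "Q * P = 1\<^sub>m n" "A = P * B * Q"
      using similar_matD by metis
    have "- A = P * (- B) * Q"
      using *(1) unfolding *(4) by auto
    with * have "similar_mat (- A) (- B)" by (intro similar_matI[of _ _ P Q n]) auto
    then show ?thesis unfolding f by (rule char_poly_similar)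
  qed
  obtain m \<phi> where \<phi>: "coords V m \<phi>" using coords_exists[OF V fd] by auto
  obtain A where A: "A \<in> carrier_mat m m" "\<forall>v\<in>carrier_vec m. T (\<phi> v) = \<phi> (A *\<^sub>v v)"
    using coords_matrix[OF V V T \<phi> \<phi>] by auto
  have "det_z_plus V T = ?f A"
    unfolding det_z_plus_def by (rule endo_invariant_eq[where f = ?f, OF sim V T \<phi> A(1)]) (use A in auto)
  also have "\<dots> = char_poly (- A)" by (rule f)
  also have "\<dots> = endo_char_poly V (\<lambda>v. \<ominus> T v)"
  proof (rule endo_char_poly_eq[OF V _ \<phi>, symmetric])
    show "(\<lambda>v. \<ominus> T v) \<in> lin V V"
      by (rule linI) (auto simp: linD[OF T] V.minus_add vs_smult_minus[OF V])
    show "- A \<in> carrier_mat m m" using A by auto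
    fix v :: "'a vec" assume v: "v \<in> carrier_vec m"
    have "\<phi> (- A *\<^sub>v v) = \<phi> (- 1 \<cdot>\<^sub>v (A *\<^sub>v v))"
      using A v by (intro arg_cong[of _ _ \<phi>]) (auto intro!: eq_vecI)
    also have "\<dots> = - 1 \<odot> \<phi> (A *\<^sub>v v)"
      using linD(3)[OF coordsD(1)[OF \<phi>], of "A *\<^sub>v v" "- 1"] A v by auto
    also have "\<dots> = \<ominus> \<phi> (A *\<^sub>v v)"
      using vs_minus_smult[OF V, of "\<phi> (A *\<^sub>v v)" 1] A v coordsD(4)[OF \<phi>, of "A *\<^sub>v v"]
      by (auto simp: vs_one[OF V])
    finally show "\<ominus> T (\<phi> v) = \<phi> (- A *\<^sub>v v)" using A v by simp
  qed
  finally show ?thesis .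
qed

lemma endo_char_poly_nonzero:
  fixes V :: "('a::field, 'v) module" (structure)
  assumes V: "vectorspace class_ring V" and T: "T \<in> lin V V" and fd: "vectorspace.fin_dim class_ring V"
  shows "endo_char_poly V T \<noteq> 0"
proof -
  obtain m \<phi> where \<phi>: "coords V m \<phi>" using coords_exists[OF V fd] by auto
  obtain A where A: "A \<in> carrier_mat m m" "\<forall>v\<in>carrier_vec m. T (\<phi> v) = \<phi> (A *\<^sub>v v)"
    using coords_matrix[OF V V T \<phi> \<phi>] by auto
  have "endo_char_poly V T = char_poly A" by (rule endo_char_poly_eq[OF V T \<phi> A(1)]) (use A in auto)
  with degree_monic_char_poly[OF A(1)] show ?thesis by auto
qed

text \<open>Composing coordinates of \<open>V\<close> with the isomorphism gives coordinates of \<open>W\<close> with the same matrix.\<close>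
lemma char_poly_iso:
  fixes V :: "('a::field, 'v) module" (structure) and W :: "('a, 'w) module"
  assumes V: "vectorspace class_ring V" and W: "vectorspace class_ring W"
    and f: "f \<in> lin V W" "bij_betw f (carrier V) (carrier W)"
    and T: "T \<in> lin V V" and T': "T' \<in> lin W W" and i: "\<And>v. v \<in> carrier V \<Longrightarrow> f (T v) = T' (f v)"
    and fd: "vectorspace.fin_dim class_ring V"
  shows "endo_char_poly V T = endo_char_poly W T'"
    and "vectorspace.fin_dim class_ring W"
proof -
  obtain m \<phi> where \<phi>: "coords V m \<phi>" using coords_exists[OF V fd] by auto
  obtain A where A: "A \<in> carrier_mat m m" "\<forall>v\<in>carrier_vec m. T (\<phi> v) = \<phi> (A *\<^sub>v v)"
    using coords_matrix[OF V V T \<phi> \<phi>] by auto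
  have f\<phi>: "coords W m (\<lambda>v. f (\<phi> v))"
    using lin_comp[OF coordsD(1)[OF \<phi>] f(1)] \<phi> bij_betw_trans[OF _ f(2)]
    unfolding coords_def by (auto simp: comp_def)
  from coords_basis(3)[OF W this] show "vectorspace.fin_dim class_ring W" .
  have "endo_char_poly W T' = char_poly A"
    by (rule endo_char_poly_eq[OF W T' f\<phi> A(1)]) (use A i[symmetric] coordsD(4)[OF \<phi>] in auto)
  moreover have "endo_char_poly V T = char_poly A"
    by (rule endo_char_poly_eq[OF V T \<phi> A(1)]) (use A in auto)
  ultimately show "endo_char_poly V T = endo_char_poly W T'" by simp
qed

lemma char_poly_zero_space:
  fixes V :: "('a::field, 'v) module" (structure)
  assumes V: "vectorspace class_ring V" and z: "carrier V = {\<zero>}" and T: "T \<in> lin V V"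
  shows "endo_char_poly V T = 1" "vectorspace.fin_dim class_ring V"
proof -
  interpret V: vectorspace class_ring V by (rule V)
  have \<phi>: "coords V 0 (\<lambda>v. \<zero>)"
    unfolding coords_def
  proof
    show "(\<lambda>v. \<zero>) \<in> lin (vec_sp 0) V" by (rule linI) (auto simp: vs_smult_zero[OF V])
    have "carrier_vec 0 = {0\<^sub>v 0 :: 'a vec}" by auto
    then show "bij_betw (\<lambda>v. \<zero>) (carrier_vec 0 :: 'a vec set) (carrier V)"
      by (simp add: bij_betw_def z)
  qed
  then show "vectorspace.fin_dim class_ring V" by (rule coords_basis(3)[OF V])
  have "endo_char_poly V T = char_poly (0\<^sub>m 0 0 :: 'a mat)"
    using linD(1)[OF T] z by (intro endo_char_poly_eq[OF V T \<phi>]) auto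
  also have "\<dots> = 1" unfolding char_poly_def char_poly_matrix_def by (simp add: det_dim_zero)
  finally show "endo_char_poly V T = 1" .
qed

lemma append_vec_split:
  assumes "z \<in> carrier_vec (k + l)"
  obtains v w where "v \<in> carrier_vec k" "w \<in> carrier_vec l" "z = v @\<^sub>v w"
  using vec_first_last_append[OF assms] vec_first_carrier vec_last_carrier by metis

text \<open>Two families of coordinates, one after the other, form coordinates of a direct sum. Only the
  decomposition of each vector matters; the two maps need not come from subspaces.\<close>
lemma coords_append:
  fixes V :: "('a::field, 'v) module" (structure)
  assumes V: "vectorspace class_ring V" and f: "f \<in> lin (vec_sp k) V" and h: "h \<in> lin (vec_sp l) V"
    and inj: "\<And>v w. v \<in> carrier_vec k \<Longrightarrow> w \<in> carrier_vec l \<Longrightarrow> f v \<oplus> h w = \<zero> \<Longrightarrow>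
      v = 0\<^sub>v k \<and> w = 0\<^sub>v l"
    and surj: "\<And>x. x \<in> carrier V \<Longrightarrow> \<exists>v\<in>carrier_vec k. \<exists>w\<in>carrier_vec l. x = f v \<oplus> h w"
  shows "\<exists>\<Phi>. coords V (k + l) \<Phi> \<and>
    (\<forall>v\<in>carrier_vec k. \<forall>w\<in>carrier_vec l. \<Phi> (v @\<^sub>v w) = f v \<oplus> h w)"
proof -
  interpret V: abelian_group V by (rule vs_group[OF V])
  note fl = linD[OF f] and hl = linD[OF h]
  define \<Phi> where "\<Phi> z = f (vec_first z k) \<oplus> h (vec_last z l)" for z
  have \<Phi>a: "\<Phi> (v @\<^sub>v w) = f v \<oplus> h w" if "v \<in> carrier_vec k" "w \<in> carrier_vec l" for v w
  proof -
    have "vec_first (v @\<^sub>v w) k = v" "vec_last (v @\<^sub>v w) l = w"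
      using that by (auto simp: vec_first_def vec_last_def)
    then show ?thesis by (simp add: \<Phi>_def)
  qed
  have \<Phi>l: "\<Phi> \<in> lin (vec_sp (k + l)) V"
  proof (rule linI)
    fix z :: "'a vec" assume "z \<in> carrier (vec_sp (k + l))"
    then show "\<Phi> z \<in> carrier V" unfolding \<Phi>_def using fl(1) hl(1) by (auto intro!: V.a_closed)
  next
    fix y z :: "'a vec" assume yz: "y \<in> carrier (vec_sp (k + l))" "z \<in> carrier (vec_sp (k + l))"
    obtain v w where vw: "v \<in> carrier_vec k" "w \<in> carrier_vec l" "y = v @\<^sub>v w"
      using yz(1) append_vec_split[of y k l] by auto
    obtain v' w' where vw': "v' \<in> carrier_vec k" "w' \<in> carrier_vec l" "z = v' @\<^sub>v w'"
      using yz(2) append_vec_split[of z k l] by auto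
    have "y + z = (v + v') @\<^sub>v (w + w')" using vw vw' by (simp add: append_vec_add)
    with vw vw' show "\<Phi> (y \<oplus>\<^bsub>vec_sp (k + l)\<^esub> z) = \<Phi> y \<oplus> \<Phi> z"
      using fl(2)[of v v'] hl(2)[of w w'] fl(1) hl(1) by (simp add: \<Phi>a V.a_ac)
  next
    fix c and z :: "'a vec" assume "z \<in> carrier (vec_sp (k + l))"
    then obtain v w where *: "v \<in> carrier_vec k" "w \<in> carrier_vec l" "z = v @\<^sub>v w"
      using append_vec_split[of z k l] by auto
    then have "c \<cdot>\<^sub>v z = (c \<cdot>\<^sub>v v) @\<^sub>v (c \<cdot>\<^sub>v w)" by (auto intro!: eq_vecI)
    with * show "\<Phi> (c \<odot>\<^bsub>vec_sp (k + l)\<^esub> z) = c \<odot> \<Phi> z"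
      using fl(3)[of v] hl(3)[of w] fl(1) hl(1) by (simp add: \<Phi>a vs_r_distr[OF V])
  qed
  have "inj_on \<Phi> (carrier (vec_sp (k + l)))"
  proof (rule lin_inj[OF vec_vs V \<Phi>l])
    fix z :: "'a vec" assume "z \<in> carrier (vec_sp (k + l))" and z: "\<Phi> z = \<zero>"
    then obtain v w where *: "v \<in> carrier_vec k" "w \<in> carrier_vec l" "z = v @\<^sub>v w"
      using append_vec_split[of z k l] by auto
    with z inj[OF *(1,2)] show "z = \<zero>\<^bsub>vec_sp (k + l)\<^esub>" by (auto simp: \<Phi>a intro!: eq_vecI)
  qed
  moreover have "carrier V \<subseteq> \<Phi> ` carrier_vec (k + l)"
  proof
    fix x assume "x \<in> carrier V"
    from surj[OF this] obtain v w where "v \<in> carrier_vec k" "w \<in> carrier_vec l" "x = f v \<oplus> h w" by auto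
    then show "x \<in> \<Phi> ` carrier_vec (k + l)" by (intro image_eqI[of _ _ "v @\<^sub>v w"]) (auto simp: \<Phi>a)
  qed
  ultimately have "coords V (k + l) \<Phi>"
    using \<Phi>l linD(1)[OF \<Phi>l] unfolding coords_def bij_betw_def by auto
  with \<Phi>a show ?thesis by blast
qed

lemma char_poly_block_upper:
  fixes A :: "'a::field mat"
  assumes A: "A \<in> carrier_mat k k" and C: "C \<in> carrier_mat k l" and B: "B \<in> carrier_mat l l"
  shows "char_poly (four_block_mat A C (0\<^sub>m l k) B) = char_poly A * char_poly B"
proof -
  have "char_poly_matrix (four_block_mat A C (0\<^sub>m l k) B) =
      four_block_mat (char_poly_matrix A) (map_mat (\<lambda>a. [:- a:]) C) (0\<^sub>m l k) (char_poly_matrix B)"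
    unfolding char_poly_matrix_def by (rule eq_matI) (use A B C in \<open>auto simp: four_block_mat_def Let_def\<close>)
  then show ?thesis unfolding char_poly_def
    using A B C by (subst det_four_block_mat_lower_left_zero[symmetric, of _ k _ l]) auto
qed

lemma submodule_vs:
  fixes V :: "('a::field, 'v) module" (structure)
  assumes V: "vectorspace class_ring V" and U: "submodule class_ring U V"
  shows "vectorspace class_ring (sub_space V U)"
  using vectorspace.subspace_is_vs[OF V] subspace.intro[OF V U] by blast

text \<open>Coordinates of the kernel, followed by lifts of coordinates of the image, make the matrix of \<open>T\<close>
  block upper triangular. The upper right block measures by how much the chosen linear section \<open>\<sigma>\<close>
  of \<open>p\<close> fails to intertwine the two operators. All later computations rest on this lemma.\<close>
lemma char_poly_exact:
  fixes V :: "('a::field, 'v) module" (structure) and Y :: "('a, 'w) module"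
  assumes V: "vectorspace class_ring V" and Y: "vectorspace class_ring Y"
    and p: "p \<in> lin V Y" and surj: "p ` carrier V = carrier Y"
    and U: "U = {v \<in> carrier V. p v = \<zero>\<^bsub>Y\<^esub>}"
    and T: "T \<in> lin V V" and T': "T' \<in> lin Y Y" and i: "\<And>v. v \<in> carrier V \<Longrightarrow> p (T v) = T' (p v)"
    and fdU: "vectorspace.fin_dim class_ring (sub_space V U)" and fdY: "vectorspace.fin_dim class_ring Y"
  shows "endo_char_poly V T = endo_char_poly (sub_space V U) T * endo_char_poly Y T'"
    and "vectorspace.fin_dim class_ring V"
    and "submodule class_ring U V" and "T \<in> lin (sub_space V U) (sub_space V U)"
proof -
  interpret V: vectorspace class_ring V by (rule V)
  interpret Y: vectorspace class_ring Y by (rule Y)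
  note [simp] = vs_smult_closed[OF V] vs_smult_closed[OF Y]
  have "mod_hom.ker V Y p = U" using mod_hom.ker_def[OF lin_mod_hom[OF V Y p]] U by simp
  with mod_hom.ker_is_submodule[OF lin_mod_hom[OF V Y p]]
  show sub: "submodule class_ring U V" by simp
  have VU: "vectorspace class_ring (sub_space V U)" by (rule submodule_vs[OF V sub])
  show TU: "T \<in> lin (sub_space V U) (sub_space V U)"
    by (rule linI) (use linD[OF T] i U lin_zero[OF Y Y T'] in auto)
  obtain k \<phi> where \<phi>: "coords (sub_space V U) k \<phi>" using coords_exists[OF VU fdU] by auto
  obtain l \<psi> where \<psi>: "coords Y l \<psi>" using coords_exists[OF Y fdY] by auto
  obtain A where A: "A \<in> carrier_mat k k" "\<forall>v\<in>carrier_vec k. T (\<phi> v) = \<phi> (A *\<^sub>v v)"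
    using coords_matrix[OF VU VU TU \<phi> \<phi>] by auto
  obtain B where B: "B \<in> carrier_mat l l" "\<forall>v\<in>carrier_vec l. T' (\<psi> v) = \<psi> (B *\<^sub>v v)"
    using coords_matrix[OF Y Y T' \<psi> \<psi>] by auto
  note \<phi>l = linD[OF coordsD(1)[OF \<phi>]] note \<psi>l = linD[OF coordsD(1)[OF \<psi>]]
  \<comment> \<open>A linear section of \<open>p\<close>, built from lifts of the coordinate vectors of \<open>Y\<close>.\<close>
  have "\<forall>j. \<exists>b. j < l \<longrightarrow> b \<in> carrier V \<and> p b = \<psi> (unit_vec l j)"
  proof
    fix j
    have "j < l \<Longrightarrow> \<psi> (unit_vec l j) \<in> p ` carrier V" using coordsD(4)[OF \<psi>] surj by auto
    then show "\<exists>b. j < l \<longrightarrow> b \<in> carrier V \<and> p b = \<psi> (unit_vec l j)" by force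
  qed
  then obtain b where b: "\<And>j. j < l \<Longrightarrow> b j \<in> carrier V" "\<And>j. j < l \<Longrightarrow> p (b j) = \<psi> (unit_vec l j)"
    by metis
  define \<sigma> where "\<sigma> = comb V l b"
  have \<sigma>: "\<sigma> \<in> lin (vec_sp l) V" unfolding \<sigma>_def by (rule comb_lin(1)[OF V b(1)])
  have p\<sigma>: "p (\<sigma> w) = \<psi> w" if "w \<in> carrier_vec l" for w
    by (rule lin_vec_eqI[OF Y lin_comp[OF \<sigma> p] coordsD(1)[OF \<psi>] _ that])
       (simp add: \<sigma>_def comb_lin(2)[OF V b(1)] b(2))
  note \<sigma>l = linD[OF \<sigma>]
  have \<phi>c: "\<phi> v \<in> carrier V" "p (\<phi> v) = \<zero>\<^bsub>Y\<^esub>" if "v \<in> carrier_vec k" for v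
    using coordsD(4)[OF \<phi> that] U by auto
  \<comment> \<open>The defect of the section as an intertwiner takes values in the kernel.\<close>
  define D where "D w = T (\<sigma> w) \<ominus> \<sigma> (B *\<^sub>v w)" for w
  have Tc: "\<And>v. v \<in> carrier V \<Longrightarrow> T v \<in> carrier V" using linD(1)[OF T] by simp
  have D: "D \<in> lin (vec_sp l) (sub_space V U)"
  proof (rule linI)
    fix w :: "'a vec" assume w: "w \<in> carrier (vec_sp l)"
    then have Bw: "B *\<^sub>v w \<in> carrier_vec l" using B by auto
    have "p (D w) = p (T (\<sigma> w)) \<ominus>\<^bsub>Y\<^esub> p (\<sigma> (B *\<^sub>v w))"
      unfolding D_def using w \<sigma>l Bw Tc by (intro lin_minus[OF V Y p]) auto
    also have "\<dots> = \<zero>\<^bsub>Y\<^esub>" using w B p\<sigma> p\<sigma>[OF Bw] i[of "\<sigma> w"] \<sigma>l(1)[of w] coordsD(4)[OF \<psi> Bw]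
      by (auto simp: a_minus_def Y.r_neg)
    finally show "D w \<in> carrier (sub_space V U)"
      unfolding U D_def using w Bw \<sigma>l Tc by (auto simp: D_def)
  next
    fix u v :: "'a vec" assume uv: "u \<in> carrier (vec_sp l)" "v \<in> carrier (vec_sp l)"
    then have c: "\<sigma> u \<in> carrier V" "\<sigma> v \<in> carrier V" "\<sigma> (B *\<^sub>v u) \<in> carrier V" "\<sigma> (B *\<^sub>v v) \<in> carrier V"
      using \<sigma>l B by auto
    have "\<sigma> (B *\<^sub>v (u + v)) = \<sigma> (B *\<^sub>v u) \<oplus> \<sigma> (B *\<^sub>v v)"
      using uv B \<sigma>l(2)[of "B *\<^sub>v u" "B *\<^sub>v v"] by (simp add: mult_add_distrib_mat_vec)
    then show "D (u \<oplus>\<^bsub>vec_sp l\<^esub> v) = D u \<oplus>\<^bsub>sub_space V U\<^esub> D v"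
      unfolding D_def using uv c \<sigma>l(2)[of u v] linD(2)[OF T] Tc
      by (simp add: a_minus_def V.minus_add V.a_ac)
  next
    fix c and v :: "'a vec" assume v: "v \<in> carrier (vec_sp l)"
    then have c: "\<sigma> v \<in> carrier V" "\<sigma> (B *\<^sub>v v) \<in> carrier V" using \<sigma>l B by auto
    have "\<sigma> (B *\<^sub>v (c \<cdot>\<^sub>v v)) = c \<odot> \<sigma> (B *\<^sub>v v)"
      using v B \<sigma>l(3)[of "B *\<^sub>v v"] by (simp add: mult_mat_vec)
    then show "D (c \<odot>\<^bsub>vec_sp l\<^esub> v) = c \<odot>\<^bsub>sub_space V U\<^esub> D v"
      unfolding D_def using v c \<sigma>l(3)[of v] linD(3)[OF T] Tc
      by (simp add: a_minus_def vs_r_distr[OF V] vs_smult_minus[OF V])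
  qed
  have idc: "coords (vec_sp l :: ('a, 'a vec) module) l (\<lambda>v. v)"
    unfolding coords_def by (auto intro!: linI simp: bij_betw_def)
  obtain C where C: "C \<in> carrier_mat k l" "\<forall>w\<in>carrier_vec l. D w = \<phi> (C *\<^sub>v w)"
    using coords_matrix[OF vec_vs VU D idc \<phi>] by auto
  let ?M = "four_block_mat A C (0\<^sub>m l k) B"
  have p\<Phi>: "p (\<phi> v \<oplus> \<sigma> w) = \<psi> w" if "v \<in> carrier_vec k" "w \<in> carrier_vec l" for v w
    using that \<phi>c \<sigma>l(1) linD(2)[OF p, of "\<phi> v" "\<sigma> w"] p\<sigma> coordsD(4)[OF \<psi>] by simp
  have inj: "v = 0\<^sub>v k \<and> w = 0\<^sub>v l"
    if *: "v \<in> carrier_vec k" "w \<in> carrier_vec l" and z: "\<phi> v \<oplus> \<sigma> w = \<zero>" for v w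
  proof -
    have "\<psi> w = \<zero>\<^bsub>Y\<^esub>" using p\<Phi>[OF *] z lin_zero[OF V Y p] by simp
    also have "\<dots> = \<psi> (0\<^sub>v l)" using lin_zero[OF vec_vs Y coordsD(1)[OF \<psi>]] by simp
    finally have w: "w = 0\<^sub>v l" using coordsD(2)[OF \<psi>] * by (auto dest: inj_onD)
    have "\<sigma> (0\<^sub>v l) = \<zero>" using lin_zero[OF vec_vs V \<sigma>] by simp
    then have "\<phi> v = \<zero>" using z * w \<phi>c by simp
    also have "\<dots> = \<phi> (0\<^sub>v k)" using lin_zero[OF vec_vs VU coordsD(1)[OF \<phi>]] by simp
    finally have "v = 0\<^sub>v k" using coordsD(2)[OF \<phi>] * by (auto dest: inj_onD)
    with w show ?thesis by simp
  qed
  have onto: "\<exists>v\<in>carrier_vec k. \<exists>w\<in>carrier_vec l. x = \<phi> v \<oplus> \<sigma> w" if x: "x \<in> carrier V" for x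
  proof -
    obtain w where w: "w \<in> carrier_vec l" "p x = \<psi> w" using coordsD(5)[OF \<psi>] linD(1)[OF p x] by blast
    have "p (x \<ominus> \<sigma> w) = \<zero>\<^bsub>Y\<^esub>"
      using lin_minus[OF V Y p x, of "\<sigma> w"] w \<sigma>l(1) p\<sigma> coordsD(4)[OF \<psi>] by (simp add: a_minus_def Y.r_neg)
    then have "x \<ominus> \<sigma> w \<in> carrier (sub_space V U)" using x \<sigma>l(1) w U by simp
    then obtain v where v: "v \<in> carrier_vec k" "x \<ominus> \<sigma> w = \<phi> v" using coordsD(5)[OF \<phi>] by blast
    have "\<phi> v \<oplus> \<sigma> w = x"
      unfolding v(2)[symmetric] using x w \<sigma>l(1) by (simp add: a_minus_def V.a_assoc V.l_neg)
    with v w show ?thesis by blast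
  qed
  have \<phi>V: "\<phi> \<in> lin (vec_sp k) V"
    by (rule linI) (use linD(2,3)[OF coordsD(1)[OF \<phi>]] \<phi>c in auto)
  obtain \<Phi> where \<Phi>: "coords V (k + l) \<Phi>"
    and \<Phi>a: "\<And>v w. v \<in> carrier_vec k \<Longrightarrow> w \<in> carrier_vec l \<Longrightarrow> \<Phi> (v @\<^sub>v w) = \<phi> v \<oplus> \<sigma> w"
    using coords_append[where V = V and f = \<phi> and h = \<sigma>, OF V \<phi>V \<sigma> inj onto] by blast
  from coords_basis(3)[OF V \<Phi>] show "vectorspace.fin_dim class_ring V" .
  have "endo_char_poly V T = char_poly ?M"
  proof (rule endo_char_poly_eq[OF V T \<Phi>])
    show "?M \<in> carrier_mat (k + l) (k + l)" using A B by auto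
    fix z :: "'a vec" assume "z \<in> carrier_vec (k + l)"
    then obtain v w where *: "v \<in> carrier_vec k" "w \<in> carrier_vec l" "z = v @\<^sub>v w"
      by (rule append_vec_split)
    have c: "A *\<^sub>v v \<in> carrier_vec k" "C *\<^sub>v w \<in> carrier_vec k" "B *\<^sub>v w \<in> carrier_vec l"
      using A B C * by auto
    have "T (\<sigma> w) = D w \<oplus> \<sigma> (B *\<^sub>v w)"
      unfolding D_def using * c Tc \<sigma>l(1) by (simp add: a_minus_def V.a_assoc V.l_neg)
    then have "T (\<Phi> z) = \<phi> (A *\<^sub>v v) \<oplus> (\<phi> (C *\<^sub>v w) \<oplus> \<sigma> (B *\<^sub>v w))"
      using * linD(2)[OF T, of "\<phi> v" "\<sigma> w"] \<phi>c \<sigma>l(1) A C by (simp add: \<Phi>a)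
    also have "\<dots> = \<Phi> ((A *\<^sub>v v + C *\<^sub>v w) @\<^sub>v (B *\<^sub>v w))"
      using c \<phi>l(2)[of "A *\<^sub>v v" "C *\<^sub>v w"] \<phi>c \<sigma>l(1) by (simp add: \<Phi>a V.a_assoc)
    also have "(A *\<^sub>v v + C *\<^sub>v w) @\<^sub>v (B *\<^sub>v w) = ?M *\<^sub>v z"
      unfolding *(3) using * A B C c
      by (subst four_block_mat_mult_vec[of A k k C l "0\<^sub>m l k" l B]) auto
    finally show "T (\<Phi> z) = \<Phi> (?M *\<^sub>v z)" .
  qed
  also have "\<dots> = char_poly A * char_poly B" by (rule char_poly_block_upper[OF A(1) C(1) B(1)])
  also have "char_poly A = endo_char_poly (sub_space V U) T"
    by (rule endo_char_poly_eq[OF VU TU \<phi> A(1), symmetric]) (use A in auto)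
  also have "char_poly B = endo_char_poly Y T'"
    by (rule endo_char_poly_eq[OF Y T' \<psi> B(1), symmetric]) (use B in auto)
  finally show "endo_char_poly V T = endo_char_poly (sub_space V U) T * endo_char_poly Y T'" .
qed

text \<open>A subset of \<open>U\<close> that is linearly independent in \<open>U\<close> is so in \<open>V\<close>, hence has at most \<open>dim V\<close> elements;
  a maximal one is a basis of \<open>U\<close>.\<close>
lemma submodule_fin_dim:
  fixes V :: "('a::field, 'v) module" (structure)
  assumes V: "vectorspace class_ring V" and fd: "vectorspace.fin_dim class_ring V"
    and U: "submodule class_ring U V"
  shows "vectorspace.fin_dim class_ring (sub_space V U)"
proof -
  interpret V: vectorspace class_ring V by (rule V)
  interpret U: vectorspace class_ring "sub_space V U" by (rule submodule_vs[OF V U])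
  have UV: "U \<subseteq> carrier V" using U by (rule submodule.subset)
  have small: "finite A \<and> card A \<le> V.dim" if "A \<subseteq> carrier (sub_space V U) \<and> U.lin_indpt A" for A
  proof -
    have "V.lin_indpt A" using V.span_li_not_depend(2)[of A U] U that by auto
    with V.li_le_dim[OF fd, of A] that UV show ?thesis by auto
  qed
  have "{} \<subseteq> carrier (sub_space V U) \<and> U.lin_indpt {}" by (auto simp: U.lin_dep_def)
  from maximal_exists[where P = "\<lambda>A. A \<subseteq> carrier (sub_space V U) \<and> U.lin_indpt A", OF small this]
  obtain A where "finite A" "maximal A (\<lambda>A. A \<subseteq> carrier (sub_space V U) \<and> U.lin_indpt A)" by auto
  with U.max_li_is_basis[of A] show ?thesis unfolding U.fin_dim_def U.basis_def by auto
qed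

lemma lin_image_fin_dim:
  fixes V :: "('a::field, 'v) module" (structure) and Y :: "('a, 'w) module"
  assumes V: "vectorspace class_ring V" and Y: "vectorspace class_ring Y"
    and p: "p \<in> lin V Y" and surj: "p ` carrier V = carrier Y"
    and fd: "vectorspace.fin_dim class_ring V"
  shows "vectorspace.fin_dim class_ring Y"
proof -
  interpret L: linear_map class_ring V Y p
    using V Y p vs_module[OF V] vs_module[OF Y]
    unfolding linear_map_def mod_hom_def mod_hom_axioms_def by blast
  show ?thesis by (rule L.surj_fin_dim[OF fd surj])
qed

text \<open>Substituting \<open>z\<^sup>2\<close> for \<open>z\<close> is a ring homomorphism, so it commutes with the determinant. This shows
  that the left-hand side depends only on the similarity class of \<open>A\<close>.\<close>
lemma char_poly_pcompose_square:
  fixes A :: "'a::field mat"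
  assumes A: "A \<in> carrier_mat m m"
  shows "det ([:0, 1:]^2 \<cdot>\<^sub>m 1\<^sub>m (dim_row A) - map_mat (\<lambda>c. [:c:]) A) = char_poly A \<circ>\<^sub>p [:0, 1:]^2"
proof -
  have "map_mat (\<lambda>p. p \<circ>\<^sub>p [:0, 1:]^2) (char_poly_matrix A) =
      [:0, 1:]^2 \<cdot>\<^sub>m 1\<^sub>m (dim_row A) - map_mat (\<lambda>c. [:c:]) A"
    unfolding char_poly_matrix_def by (rule eq_matI) (use A in \<open>auto simp: pcompose_pCons pcompose_add\<close>)
  then show ?thesis unfolding char_poly_def using comm_ring_hom.hom_det[OF pcompose_hom.comm_ring_hom_axioms, of "[:0, 1:]^2" "char_poly_matrix A"] by simp
qed

text \<open>The lower blocks \<open>- 1\<close> and \<open>z\<close> of the characteristic matrix commute, so its determinant is the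
  determinant of \<open>z z - (- A) (- 1)\<close>.\<close>
lemma char_poly_four_block_swap:
  fixes A :: "'a::field mat"
  assumes A: "A \<in> carrier_mat m m"
  shows "char_poly (four_block_mat (0\<^sub>m m m) A (1\<^sub>m m) (0\<^sub>m m m)) =
    det ([:0, 1:]^2 \<cdot>\<^sub>m 1\<^sub>m (dim_row A) - map_mat (\<lambda>c. [:c:]) A)"
proof -
  let ?z = "[:0, 1:] \<cdot>\<^sub>m 1\<^sub>m m :: 'a poly mat"
  let ?A = "map_mat (\<lambda>c. [:- c:]) A"
  have m1: "- 1\<^sub>m m * ?z = - ?z" "?z * - 1\<^sub>m m = - ?z"
    using left_mult_one_mat[of ?z m m] right_mult_one_mat[of ?z m m] by simp_all
  have "char_poly_matrix (four_block_mat (0\<^sub>m m m) A (1\<^sub>m m) (0\<^sub>m m m)) =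
      four_block_mat ?z ?A (- 1\<^sub>m m) ?z"
    unfolding char_poly_matrix_def by (rule eq_matI) (use A in \<open>auto simp: one_pCons\<close>)
  then have "char_poly (four_block_mat (0\<^sub>m m m) A (1\<^sub>m m) (0\<^sub>m m m)) = det (?z * ?z - ?A * (- 1\<^sub>m m))"
    unfolding char_poly_def using A m1 by (simp add: det_four_block_mat[of _ m])
  also have "?A * (- 1\<^sub>m m) = map_mat (\<lambda>c. [:c:]) A"
    using A right_mult_one_mat[of ?A m m] by (auto intro!: eq_matI)
  also have "?z * ?z = [:0, 1:]^2 \<cdot>\<^sub>m 1\<^sub>m m"
    using mult_smult_assoc_mat[of "1\<^sub>m m" m m ?z m "[:0, 1:]"] left_mult_one_mat[of ?z m m]
    by (auto simp: power2_eq_square intro!: eq_matI)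
  finally show ?thesis using A by simp
qed

text \<open>An operator that swaps two copies \<open>j1 W\<close> and \<open>j2 W\<close> of \<open>W\<close>, going back through \<open>f\<close>, has the matrix with
  blocks \<open>0, A, 1, 0\<close>, where \<open>A\<close> is the matrix of \<open>f\<close>.\<close>
lemma det_z2_minus_char_poly:
  fixes W :: "('a::field, 'v) module" and Y :: "('a, 'w) module"
  assumes W: "vectorspace class_ring W" and Y: "vectorspace class_ring Y"
    and fd: "vectorspace.fin_dim class_ring W"
    and f: "f \<in> lin W W" and j1: "j1 \<in> lin W Y" and j2: "j2 \<in> lin W Y" and T: "T \<in> lin Y Y"
    and inj: "\<And>a b. a \<in> carrier W \<Longrightarrow> b \<in> carrier W \<Longrightarrow> j1 a \<oplus>\<^bsub>Y\<^esub> j2 b = \<zero>\<^bsub>Y\<^esub> \<Longrightarrow> a = \<zero>\<^bsub>W\<^esub> \<and> b = \<zero>\<^bsub>W\<^esub>"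
    and surj: "\<And>y. y \<in> carrier Y \<Longrightarrow> \<exists>a\<in>carrier W. \<exists>b\<in>carrier W. y = j1 a \<oplus>\<^bsub>Y\<^esub> j2 b"
    and T1: "\<And>a. a \<in> carrier W \<Longrightarrow> T (j1 a) = j2 a"
    and T2: "\<And>a. a \<in> carrier W \<Longrightarrow> T (j2 a) = j1 (f a)"
  shows "endo_char_poly Y T = det_z2_minus W f" and "vectorspace.fin_dim class_ring Y"
proof -
  interpret W: vectorspace class_ring W by (rule W)
  interpret Y: vectorspace class_ring Y by (rule Y)
  note [simp] = vs_smult_closed[OF W] vs_smult_closed[OF Y]
  let ?f = "\<lambda>A :: 'a mat. det ([:0, 1:]^2 \<cdot>\<^sub>m 1\<^sub>m (dim_row A) - map_mat (\<lambda>c. [:c:]) A)"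
  obtain m \<phi> where \<phi>: "coords W m \<phi>" using coords_exists[OF W fd] by auto
  obtain A where A: "A \<in> carrier_mat m m" "\<forall>v\<in>carrier_vec m. f (\<phi> v) = \<phi> (A *\<^sub>v v)"
    using coords_matrix[OF W W f \<phi> \<phi>] by auto
  note c1 = linD[OF lin_comp[OF coordsD(1)[OF \<phi>] j1]] note c2 = linD[OF lin_comp[OF coordsD(1)[OF \<phi>] j2]]
  have \<phi>0: "v = 0\<^sub>v m" if "v \<in> carrier_vec m" "\<phi> v = \<zero>\<^bsub>W\<^esub>" for v
    using inj_onD[OF coordsD(2)[OF \<phi>], of v "0\<^sub>v m"] lin_zero[OF vec_vs W coordsD(1)[OF \<phi>]] that by simp
  have inj': "v = 0\<^sub>v m \<and> w = 0\<^sub>v m"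
    if "v \<in> carrier_vec m" "w \<in> carrier_vec m" "j1 (\<phi> v) \<oplus>\<^bsub>Y\<^esub> j2 (\<phi> w) = \<zero>\<^bsub>Y\<^esub>" for v w
    using inj[OF coordsD(4)[OF \<phi> that(1)] coordsD(4)[OF \<phi> that(2)] that(3)] \<phi>0 that by blast
  have onto: "\<exists>v\<in>carrier_vec m. \<exists>w\<in>carrier_vec m. y = j1 (\<phi> v) \<oplus>\<^bsub>Y\<^esub> j2 (\<phi> w)" if "y \<in> carrier Y" for y
    using surj[OF that] coordsD(5)[OF \<phi>] by metis
  obtain \<Phi> where \<Phi>: "coords Y (m + m) \<Phi>"
    and \<Phi>a: "\<And>v w. v \<in> carrier_vec m \<Longrightarrow> w \<in> carrier_vec m \<Longrightarrow> \<Phi> (v @\<^sub>v w) = j1 (\<phi> v) \<oplus>\<^bsub>Y\<^esub> j2 (\<phi> w)"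
    using coords_append[where V = Y and f = "\<lambda>v. j1 (\<phi> v)" and h = "\<lambda>v. j2 (\<phi> v)",
      OF Y lin_comp[OF coordsD(1)[OF \<phi>] j1] lin_comp[OF coordsD(1)[OF \<phi>] j2] inj' onto] by blast
  from coords_basis(3)[OF Y \<Phi>] show "vectorspace.fin_dim class_ring Y" .
  let ?M = "four_block_mat (0\<^sub>m m m) A (1\<^sub>m m) (0\<^sub>m m m)"
  have "endo_char_poly Y T = char_poly ?M"
  proof (rule endo_char_poly_eq[OF Y T \<Phi>])
    show "?M \<in> carrier_mat (m + m) (m + m)" using A by auto
    fix z :: "'a vec" assume "z \<in> carrier_vec (m + m)"
    then obtain v w where *: "v \<in> carrier_vec m" "w \<in> carrier_vec m" "z = v @\<^sub>v w"
      by (rule append_vec_split)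
    have c: "A *\<^sub>v w \<in> carrier_vec m" using A * by auto
    have "T (\<Phi> z) = j2 (\<phi> v) \<oplus>\<^bsub>Y\<^esub> j1 (f (\<phi> w))"
      using * linD(2)[OF T, of "j1 (\<phi> v)" "j2 (\<phi> w)"] c1(1) c2(1) T1 T2 coordsD(4)[OF \<phi>] by (simp add: \<Phi>a)
    also have "\<dots> = \<Phi> ((A *\<^sub>v w) @\<^sub>v v)" using * A c c1(1)[of "A *\<^sub>v w"] c2(1)[of v] by (simp add: \<Phi>a Y.a_comm)
    also have "(A *\<^sub>v w) @\<^sub>v v = ?M *\<^sub>v z"
      unfolding *(3) using * A c by (subst four_block_mat_mult_vec[of _ m m _ m _ m]) auto
    finally show "T (\<Phi> z) = \<Phi> (?M *\<^sub>v z)" .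
  qed
  also have "\<dots> = ?f A" by (rule char_poly_four_block_swap[OF A(1)])
  also have "\<dots> = det_z2_minus W f"
  proof -
    have sim: "?f A = ?f B" if AB: "similar_mat A B" for A B
    proof -
      obtain n where "A \<in> carrier_mat n n" "B \<in> carrier_mat n n" using similar_matD[OF AB] by blast
      then show ?thesis
        using char_poly_pcompose_square[of A n] char_poly_pcompose_square[of B n] char_poly_similar[OF that] by simp
    qed
    show ?thesis unfolding det_z2_minus_def
      by (rule endo_invariant_eq[where f = ?f, OF sim W f \<phi> A(1), symmetric]) (use A in auto)
  qed
  finally show "endo_char_poly Y T = det_z2_minus W f" .
qed

section \<open>Subspaces, powers, direct sums and quotients\<close>

lemma submoduleI:
  fixes V :: "('a::field, 'v) module" (structure)
  assumes "vectorspace class_ring V" "U \<subseteq> carrier V" "\<zero> \<in> U"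
    and "\<And>u v. u \<in> U \<Longrightarrow> v \<in> U \<Longrightarrow> u \<oplus> v \<in> U" and "\<And>c v. v \<in> U \<Longrightarrow> c \<odot> v \<in> U"
  shows "submodule class_ring U V"
  using assms by (intro submodule.intro vs_module) auto

lemma submoduleD:
  fixes V :: "('a::field, 'v) module" (structure)
  assumes V: "vectorspace class_ring V" and U: "submodule class_ring U V"
  shows "u \<in> U \<Longrightarrow> u \<in> carrier V" "\<zero> \<in> U" "u \<in> U \<Longrightarrow> v \<in> U \<Longrightarrow> u \<oplus> v \<in> U"
    "u \<in> U \<Longrightarrow> c \<odot> u \<in> U" "u \<in> U \<Longrightarrow> \<ominus> u \<in> U" "u \<in> U \<Longrightarrow> v \<in> U \<Longrightarrow> u \<ominus> v \<in> U"
proof -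
  have s: "u \<in> U \<Longrightarrow> c \<odot> u \<in> U" for c u
    using submodule.smult_closed[OF U, of c u] by simp
  have n: "u \<in> U \<Longrightarrow> \<ominus> u \<in> U" for u
    using s[of u "- 1"] vs_minus_smult[OF V, of u 1] submodule.subset[OF U] by (auto simp: vs_one[OF V])
  show "u \<in> U \<Longrightarrow> u \<in> carrier V" "\<zero> \<in> U" "u \<in> U \<Longrightarrow> v \<in> U \<Longrightarrow> u \<oplus> v \<in> U"
    using submodule.subset[OF U] submodule.zero_closed[OF U] submodule.m_closed[OF U] by auto
  show "u \<in> U \<Longrightarrow> c \<odot> u \<in> U" "u \<in> U \<Longrightarrow> \<ominus> u \<in> U" by (fact s n)+
  show "u \<in> U \<Longrightarrow> v \<in> U \<Longrightarrow> u \<ominus> v \<in> U"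
    unfolding a_minus_def using n submodule.m_closed[OF U] by auto
qed

lemma lin_sub_space:
  assumes "T \<in> lin V V" "U \<subseteq> carrier V" "\<And>u. u \<in> U \<Longrightarrow> T u \<in> U"
  shows "T \<in> lin (sub_space V U) (sub_space V U)"
proof -
  have "\<And>u. u \<in> U \<Longrightarrow> u \<in> carrier V" using assms(2) by auto
  with assms(3) linD(2,3)[OF assms(1)] show ?thesis by (intro linI) auto
qed

lemma eigenspace_one_iff:
  fixes Y :: "('a::field, 'w) module"
  assumes Y: "vectorspace class_ring Y" and T: "\<And>v. v \<in> carrier Y \<Longrightarrow> T v \<in> carrier Y"
  shows "eigenspace Y T 1 = {v \<in> carrier Y. T v = v}"
proof -
  interpret Y: abelian_group Y by (rule vs_group[OF Y])
  have "sub_scalar Y T 1 v = \<zero>\<^bsub>Y\<^esub> \<longleftrightarrow> T v = v" if "v \<in> carrier Y" for v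
    unfolding sub_scalar_def vs_one[OF Y that] using T[OF that] that by (simp only: Y.minus_other_side)
  then show ?thesis unfolding eigenspace_def by blast
qed

lemma power_space_simps [simp]:
  "carrier (power_space n V) = {1..n} \<rightarrow>\<^sub>E carrier V"
  "\<zero>\<^bsub>power_space n V\<^esub> = (\<lambda>j\<in>{1..n}. \<zero>\<^bsub>V\<^esub>)"
  "v \<oplus>\<^bsub>power_space n V\<^esub> w = (\<lambda>j\<in>{1..n}. v j \<oplus>\<^bsub>V\<^esub> w j)"
  "c \<odot>\<^bsub>power_space n V\<^esub> v = (\<lambda>j\<in>{1..n}. c \<odot>\<^bsub>V\<^esub> v j)"
  by (simp_all add: power_space_def)

lemma power_space_vs:
  fixes V :: "('a::field, 'v) module" (structure)
  assumes V: "vectorspace class_ring V"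
  shows "vectorspace class_ring (power_space n V)"
proof -
  interpret V: abelian_group V by (rule vs_group[OF V])
  note [simp] = vs_smult_closed[OF V]
  show ?thesis
  proof (rule vs_criteria[OF class_field])
    show "\<forall>v\<in>carrier (power_space n V). \<exists>neg_v\<in>carrier (power_space n V).
        v \<oplus>\<^bsub>power_space n V\<^esub> neg_v = \<zero>\<^bsub>power_space n V\<^esub>"
    proof
      fix v assume v: "v \<in> carrier (power_space n V)"
      then have "(\<lambda>j\<in>{1..n}. \<ominus> v j) \<in> carrier (power_space n V)" by auto
      moreover have "v \<oplus>\<^bsub>power_space n V\<^esub> (\<lambda>j\<in>{1..n}. \<ominus> v j) = \<zero>\<^bsub>power_space n V\<^esub>"
        using v by (auto simp: fun_eq_iff PiE_iff V.r_neg)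
      ultimately show "\<exists>neg_v\<in>carrier (power_space n V).
        v \<oplus>\<^bsub>power_space n V\<^esub> neg_v = \<zero>\<^bsub>power_space n V\<^esub>" by blast
    qed
  qed (auto simp: fun_eq_iff PiE_iff extensional_def vs_l_distr[OF V] vs_r_distr[OF V]
      vs_assoc[OF V] vs_one[OF V] V.a_ac)
qed

text \<open>As subspaces of one power space, direct sums over different index sets \<open>I\<close> can be filtered by enlarging
  \<open>I\<close>, without any change of type.\<close>
definition block_space :: "nat \<Rightarrow> ('a::field, 'v) module \<Rightarrow> (nat \<Rightarrow> 'v set) \<Rightarrow> nat set \<Rightarrow> (nat \<Rightarrow> 'v) set" where
  "block_space n V U I = {w \<in> carrier (power_space n V).
     \<forall>j\<in>{1..n}. (j \<in> I \<longrightarrow> w j \<in> U j) \<and> (j \<notin> I \<longrightarrow> w j = \<zero>\<^bsub>V\<^esub>)}"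

lemma block_spaceD:
  assumes "w \<in> block_space n V U I"
  shows "w \<in> carrier (power_space n V)" "j \<in> {1..n} \<Longrightarrow> j \<in> I \<Longrightarrow> w j \<in> U j"
    "j \<in> {1..n} \<Longrightarrow> j \<notin> I \<Longrightarrow> w j = \<zero>\<^bsub>V\<^esub>"
  using assms by (auto simp: block_space_def)

lemma block_space_submodule:
  fixes V :: "('a::field, 'v) module" (structure)
  assumes V: "vectorspace class_ring V" and U: "\<And>j. j \<in> I \<Longrightarrow> j \<in> {1..n} \<Longrightarrow> submodule class_ring (U j) V"
  shows "submodule class_ring (block_space n V U I) (power_space n V)"
proof -
  interpret V: abelian_group V by (rule vs_group[OF V])
  note D = submoduleD[OF V U]
  have "block_space n V U I \<subseteq> carrier (power_space n V)" unfolding block_space_def by blast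
  then show ?thesis
    by (rule submoduleI[OF power_space_vs[OF V]])
       (use D(1-4) in \<open>auto simp: block_space_def vs_smult_closed[OF V] vs_smult_zero[OF V]\<close>)
qed

text \<open>Evaluation at an index \<open>k \<in> I\<close> intertwines \<open>S\<close> with \<open>s\<close>, and its kernel is the block space without \<open>k\<close>.
  The components in \<open>I\<close> can thus be peeled off one at a time; about the components in \<open>J\<close> nothing
  is assumed beyond invariance.\<close>
lemma char_poly_blocks:
  fixes V :: "('a::field, 'v) module" (structure)
  assumes V: "vectorspace class_ring V" and fd: "vectorspace.fin_dim class_ring V"
    and U: "\<And>j. j \<in> {1..n} \<Longrightarrow> submodule class_ring (U j) V"
    and S: "S \<in> lin (power_space n V) (power_space n V)"
    and SI: "\<And>I' w. I' \<subseteq> I \<Longrightarrow> w \<in> block_space n V U (J \<union> I') \<Longrightarrow> S w \<in> block_space n V U (J \<union> I')"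
    and Ss: "\<And>k w. k \<in> I \<Longrightarrow> w \<in> carrier (power_space n V) \<Longrightarrow> S w k = s (w k)"
    and s: "s \<in> lin V V" and sU: "\<And>k u. k \<in> I \<Longrightarrow> u \<in> U k \<Longrightarrow> s u \<in> U k"
    and fdJ: "vectorspace.fin_dim class_ring (sub_space (power_space n V) (block_space n V U J))"
    and I: "I \<subseteq> {1..n} - J"
  shows "endo_char_poly (sub_space (power_space n V) (block_space n V U (J \<union> I))) S =
      endo_char_poly (sub_space (power_space n V) (block_space n V U J)) S *
      (\<Prod>k\<in>I. endo_char_poly (sub_space V (U k)) s)"
    and "vectorspace.fin_dim class_ring (sub_space (power_space n V) (block_space n V U (J \<union> I)))"
proof -
  interpret V: abelian_group V by (rule vs_group[OF V])
  let ?V = "power_space n V" let ?B = "block_space n V U"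
  have Vn: "vectorspace class_ring ?V" by (rule power_space_vs[OF V])
  have "finite I" using I by (rule finite_subset) auto
  have "endo_char_poly (sub_space ?V (?B (J \<union> I'))) S =
      endo_char_poly (sub_space ?V (?B J)) S * (\<Prod>k\<in>I'. endo_char_poly (sub_space V (U k)) s) \<and>
      vectorspace.fin_dim class_ring (sub_space ?V (?B (J \<union> I')))" if "I' \<subseteq> I" for I'
    using finite_subset[OF that \<open>finite I\<close>] that
  proof (induction I' rule: finite_induct)
    case empty
    then show ?case using fdJ by simp
  next
    case (insert k M)
    let ?X = "sub_space ?V (?B (J \<union> insert k M))"
    have k: "k \<in> {1..n}" "k \<notin> J" using insert.prems I by auto
    have M: "M \<subseteq> I" and kI: "k \<in> I" using insert.prems by auto
    have sub: "submodule class_ring (?B I') ?V" for I' by (rule block_space_submodule[OF V U])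
    have X: "vectorspace class_ring ?X" by (rule submodule_vs[OF Vn sub])
    have Uk: "vectorspace class_ring (sub_space V (U k))" by (rule submodule_vs[OF V U[OF k(1)]])
    have p: "(\<lambda>w. w k) \<in> lin ?X (sub_space V (U k))"
      by (rule linI) (use k in \<open>auto simp: block_space_def\<close>)
    have surj: "(\<lambda>w. w k) ` carrier ?X = carrier (sub_space V (U k))"
    proof
      show "(\<lambda>w. w k) ` carrier ?X \<subseteq> carrier (sub_space V (U k))"
        using k by (auto simp: block_space_def)
      show "carrier (sub_space V (U k)) \<subseteq> (\<lambda>w. w k) ` carrier ?X"
      proof
        fix u assume u: "u \<in> carrier (sub_space V (U k))"
        let ?w = "\<lambda>j\<in>{1..n}. if j = k then u else \<zero>"
        have "?w \<in> carrier ?X" using u k submoduleD(1,2)[OF V U] by (auto simp: block_space_def)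
        then show "u \<in> (\<lambda>w. w k) ` carrier ?X" using k by (intro image_eqI[of _ _ ?w]) auto
      qed
    qed
    have ker: "?B (J \<union> M) = {v \<in> carrier ?X. v k = \<zero>\<^bsub>sub_space V (U k)\<^esub>}"
      using k insert.hyps submoduleD(2)[OF V U[OF k(1)]] by (auto simp: block_space_def)
    have SX: "S \<in> lin ?X ?X"
    proof -
      have "?B (J \<union> insert k M) \<subseteq> carrier ?V" by (rule submodule.subset[OF sub])
      from lin_sub_space[OF S this SI[OF insert.prems]] show ?thesis .
    qed
    have sk: "s \<in> lin (sub_space V (U k)) (sub_space V (U k))"
      by (rule lin_sub_space[OF s submodule.subset[OF U[OF k(1)]] sU[OF kI]])
    have fdU: "vectorspace.fin_dim class_ring (sub_space V (U k))"
      by (rule submodule_fin_dim[OF V fd U[OF k(1)]])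
    have IH: "endo_char_poly (sub_space ?V (?B (J \<union> M))) S =
      endo_char_poly (sub_space ?V (?B J)) S * (\<Prod>k\<in>M. endo_char_poly (sub_space V (U k)) s)"
      "vectorspace.fin_dim class_ring (sub_space ?X (?B (J \<union> M)))"
      using insert.IH[OF M] by simp_all
    have i: "\<And>v. v \<in> carrier ?X \<Longrightarrow> S v k = s (v k)"
      by (rule Ss[OF kI]) (simp add: block_space_def)
    note ex = char_poly_exact[OF X Uk p surj ker SX sk i IH(2) fdU]
    have "endo_char_poly ?X S = endo_char_poly (sub_space ?V (?B (J \<union> M))) S * endo_char_poly (sub_space V (U k)) s"
      using ex(1) by simp
    then show ?case using ex(2) insert.hyps unfolding IH(1) by (simp add: mult_ac)
  qed
  from this[OF order_refl] show "endo_char_poly (sub_space ?V (?B (J \<union> I))) S =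
      endo_char_poly (sub_space ?V (?B J)) S * (\<Prod>k\<in>I. endo_char_poly (sub_space V (U k)) s)"
    "vectorspace.fin_dim class_ring (sub_space ?V (?B (J \<union> I)))" by auto
qed

lemma set_add_iff: "x \<in> A <+>\<^bsub>V\<^esub> B \<longleftrightarrow> (\<exists>a\<in>A. \<exists>b\<in>B. x = a \<oplus>\<^bsub>V\<^esub> b)"
  by (auto simp: set_add_defs)

lemma set_add_submodule:
  fixes V :: "('a::field, 'v) module" (structure)
  assumes V: "vectorspace class_ring V" and A: "submodule class_ring A V" and B: "submodule class_ring B V"
  shows "submodule class_ring (A <+>\<^bsub>V\<^esub> B) V"
proof -
  interpret V: abelian_group V by (rule vs_group[OF V])
  note a = submoduleD[OF V A] note b = submoduleD[OF V B]
  show ?thesis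
  proof (rule submoduleI[OF V])
    show "A <+>\<^bsub>V\<^esub> B \<subseteq> carrier V" using a(1) b(1) by (auto simp: set_add_iff)
    show "\<zero> \<in> A <+>\<^bsub>V\<^esub> B" using a(2) b(2) by (force simp: set_add_iff)
  next
    fix u v assume "u \<in> A <+>\<^bsub>V\<^esub> B" "v \<in> A <+>\<^bsub>V\<^esub> B"
    then obtain x y x' y' where *: "x \<in> A" "y \<in> B" "u = x \<oplus> y" "x' \<in> A" "y' \<in> B" "v = x' \<oplus> y'"
      by (auto simp: set_add_iff)
    then have "u \<oplus> v = (x \<oplus> x') \<oplus> (y \<oplus> y')"
      using a(1) b(1) by (simp add: V.a_ac)
    with * a(3) b(3) show "u \<oplus> v \<in> A <+>\<^bsub>V\<^esub> B" by (force simp: set_add_iff)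
  next
    fix c v assume "v \<in> A <+>\<^bsub>V\<^esub> B"
    then obtain x y where *: "x \<in> A" "y \<in> B" "v = x \<oplus> y" by (auto simp: set_add_iff)
    then have "c \<odot> v = c \<odot> x \<oplus> c \<odot> y" using a(1) b(1) by (simp add: vs_r_distr[OF V])
    with * a(4) b(4) show "c \<odot> v \<in> A <+>\<^bsub>V\<^esub> B" by (force simp: set_add_iff)
  qed
qed

text \<open>The projection to the second summand along the first is an intertwining surjection with kernel \<open>A\<close>.\<close>
lemma char_poly_direct_sum:
  fixes V :: "('a::field, 'v) module" (structure)
  assumes V: "vectorspace class_ring V" and fd: "vectorspace.fin_dim class_ring V"
    and A: "submodule class_ring A V" and B: "submodule class_ring B V"
    and AB: "\<And>x. x \<in> A \<Longrightarrow> x \<in> B \<Longrightarrow> x = \<zero>"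
    and T: "T \<in> lin V V" and TA: "\<And>x. x \<in> A \<Longrightarrow> T x \<in> A" and TB: "\<And>x. x \<in> B \<Longrightarrow> T x \<in> B"
  shows "endo_char_poly (sub_space V (A <+>\<^bsub>V\<^esub> B)) T =
    endo_char_poly (sub_space V A) T * endo_char_poly (sub_space V B) T"
    and "x \<in> A <+>\<^bsub>V\<^esub> B \<Longrightarrow> T x \<in> A <+>\<^bsub>V\<^esub> B"
proof -
  interpret V: abelian_group V by (rule vs_group[OF V])
  note a = submoduleD[OF V A] note b = submoduleD[OF V B]
  let ?C = "A <+>\<^bsub>V\<^esub> B" let ?X = "sub_space V ?C" let ?Y = "sub_space V B"
  have C: "submodule class_ring ?C V" by (rule set_add_submodule[OF V A B])
  have X: "vectorspace class_ring ?X" by (rule submodule_vs[OF V C])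
  have Y: "vectorspace class_ring ?Y" by (rule submodule_vs[OF V B])
  have fdA: "vectorspace.fin_dim class_ring (sub_space V A)" by (rule submodule_fin_dim[OF V fd A])
  have fdB: "vectorspace.fin_dim class_ring (sub_space V B)" by (rule submodule_fin_dim[OF V fd B])
  define p where "p x = (THE y. y \<in> B \<and> (\<exists>a\<in>A. x = a \<oplus> y))" for x
  have p: "p (x \<oplus> y) = y" if xy: "x \<in> A" "y \<in> B" for x y
    unfolding p_def
  proof (rule the_equality)
    show "y \<in> B \<and> (\<exists>a\<in>A. x \<oplus> y = a \<oplus> y)" using xy by auto
    fix y' assume "y' \<in> B \<and> (\<exists>a\<in>A. x \<oplus> y = a \<oplus> y')"
    then obtain x' where *: "y' \<in> B" "x' \<in> A" "x \<oplus> y = x' \<oplus> y'" by auto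
    have c: "x \<in> carrier V" "y \<in> carrier V" "x' \<in> carrier V" "y' \<in> carrier V" using xy * a(1) b(1) by auto
    have mid: "v \<oplus> (w \<oplus> \<ominus> v) = w" if "v \<in> carrier V" "w \<in> carrier V" for v w
      using that V.a_lcomm[of v w "\<ominus> v"] by (simp add: V.r_neg)
    have "y' \<ominus> y = (\<ominus> x' \<oplus> (x' \<oplus> y')) \<ominus> y"
      using c by (simp add: V.r_neg1)
    also have "\<dots> = (\<ominus> x' \<oplus> (x \<oplus> y)) \<ominus> y" using *(3) by simp
    also have "\<dots> = x \<ominus> x'" using c by (simp add: a_minus_def V.a_ac V.r_neg V.r_neg1 mid)
    finally have "y' \<ominus> y = x \<ominus> x'" .
    then have "y' \<ominus> y = \<zero>" using AB[of "y' \<ominus> y"] a(6)[of x x'] b(6)[of y' y] xy * by simp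
    then show "y' = y" using c by simp
  qed
  have pl: "p \<in> lin ?X ?Y"
  proof (rule linI)
    fix v assume "v \<in> carrier ?X" then show "p v \<in> carrier ?Y" by (auto simp: set_add_iff p)
  next
    fix u v assume "u \<in> carrier ?X" "v \<in> carrier ?X"
    then obtain x y x' y' where *: "x \<in> A" "y \<in> B" "u = x \<oplus> y" "x' \<in> A" "y' \<in> B" "v = x' \<oplus> y'"
      by (auto simp: set_add_iff)
    then have "u \<oplus> v = (x \<oplus> x') \<oplus> (y \<oplus> y')"
      using a(1) b(1) by (simp add: V.a_ac)
    with * a(3) b(3) show "p (u \<oplus>\<^bsub>?X\<^esub> v) = p u \<oplus>\<^bsub>?Y\<^esub> p v" by (simp add: p)
  next
    fix c v assume "v \<in> carrier ?X"
    then obtain x y where *: "x \<in> A" "y \<in> B" "v = x \<oplus> y" by (auto simp: set_add_iff)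
    then have "c \<odot> v = c \<odot> x \<oplus> c \<odot> y" using a(1) b(1) by (simp add: vs_r_distr[OF V])
    with * a(4) b(4) show "p (c \<odot>\<^bsub>?X\<^esub> v) = c \<odot>\<^bsub>?Y\<^esub> p v" by (simp add: p)
  qed
  have TC: "T x \<in> ?C" if "x \<in> ?C" for x
  proof -
    from that obtain u v where "u \<in> A" "v \<in> B" "x = u \<oplus> v" by (auto simp: set_add_iff)
    moreover from this have "T x = T u \<oplus> T v" using linD(2)[OF T] a(1) b(1) by simp
    ultimately show ?thesis using TA TB by (auto simp: set_add_iff)
  qed
  then show "x \<in> ?C \<Longrightarrow> T x \<in> ?C" .
  have surj: "p ` carrier ?X = carrier ?Y"
  proof
    show "p ` carrier ?X \<subseteq> carrier ?Y" using linD(1)[OF pl] by blast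
    show "carrier ?Y \<subseteq> p ` carrier ?X"
    proof
      fix y assume y: "y \<in> carrier ?Y"
      then have "\<zero> \<oplus> y \<in> carrier ?X" "p (\<zero> \<oplus> y) = y"
        using a(2) p by (auto simp: set_add_iff)
      then show "y \<in> p ` carrier ?X" by (metis imageI)
    qed
  qed
  have ker: "A = {v \<in> carrier ?X. p v = \<zero>\<^bsub>?Y\<^esub>}"
  proof -
    have "x \<in> ?C \<and> p x = \<zero>" if "x \<in> A" for x
    proof -
      have "x \<oplus> \<zero> = x" using a(1)[OF that] by simp
      with p[OF that b(2)] that b(2) show ?thesis unfolding set_add_iff by metis
    qed
    moreover have "x \<in> A" if "x \<in> ?C" "p x = \<zero>" for x
      using that a(1) by (auto simp: set_add_iff p)
    ultimately show ?thesis by auto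
  qed
  have TX: "T \<in> lin ?X ?X" by (rule lin_sub_space[OF T submodule.subset[OF C] TC])
  have TY: "T \<in> lin ?Y ?Y" by (rule lin_sub_space[OF T submodule.subset[OF B] TB])
  have i: "p (T v) = T (p v)" if "v \<in> carrier ?X" for v
  proof -
    from that obtain x y where "x \<in> A" "y \<in> B" "v = x \<oplus> y" by (auto simp: set_add_iff)
    then show ?thesis using linD(2)[OF T] a(1) b(1) TA TB by (simp add: p)
  qed
  have fdA': "vectorspace.fin_dim class_ring (sub_space ?X A)" using fdA by simp
  show "endo_char_poly ?X T = endo_char_poly (sub_space V A) T * endo_char_poly (sub_space V B) T"
    using char_poly_exact(1)[OF X Y pl surj ker TX TY i fdA' fdB] by simp
qed

lemma quot_space_simps [simp]:
  "carrier (quot_space V U) = a_rcosets\<^bsub>V\<^esub> U" "\<zero>\<^bsub>quot_space V U\<^esub> = U"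
  "A \<oplus>\<^bsub>quot_space V U\<^esub> B = A <+>\<^bsub>V\<^esub> B"
  "c \<odot>\<^bsub>quot_space V U\<^esub> A = (\<Union>v\<in>A. U +>\<^bsub>V\<^esub> (c \<odot>\<^bsub>V\<^esub> v))"
  unfolding quot_space_def by simp_all

context
  fixes V :: "('a::field, 'v) module" (structure) and U :: "'v set"
  assumes V: "vectorspace class_ring V" and U: "submodule class_ring U V"
begin

interpretation V: abelian_group V by (rule vs_group[OF V])

lemma coset_iff: "v \<in> carrier V \<Longrightarrow> x \<in> U +> v \<longleftrightarrow> x \<in> carrier V \<and> x \<ominus> v \<in> U"
proof -
  assume v: "v \<in> carrier V"
  note u = submoduleD[OF V U]
  show ?thesis
  proof
    assume "x \<in> U +> v"
    then obtain w where w: "w \<in> U" "x = w \<oplus> v" by (auto simp: a_r_coset_def')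
    then have "x \<ominus> v = w" using v u(1) by (simp add: a_minus_def V.a_assoc V.r_neg)
    then show "x \<in> carrier V \<and> x \<ominus> v \<in> U" using w v u(1) by simp
  next
    assume x: "x \<in> carrier V \<and> x \<ominus> v \<in> U"
    then have "x = (x \<ominus> v) \<oplus> v" using v by (simp add: a_minus_def V.a_assoc V.l_neg)
    with x show "x \<in> U +> v" unfolding a_r_coset_def' by blast
  qed
qed

lemma coset_eq_iff:
  assumes v: "v \<in> carrier V" and w: "w \<in> carrier V"
  shows "U +> v = U +> w \<longleftrightarrow> v \<ominus> w \<in> U"
proof
  note u = submoduleD[OF V U]
  assume "U +> v = U +> w"
  moreover have "v \<in> U +> v" using v u(2) by (simp add: coset_iff a_minus_def V.r_neg)
  ultimately show "v \<ominus> w \<in> U" using coset_iff[OF w] by blast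
next
  note u = submoduleD[OF V U]
  assume d: "v \<ominus> w \<in> U"
  have "x \<ominus> v \<in> U \<longleftrightarrow> x \<ominus> w \<in> U" if x: "x \<in> carrier V" for x
  proof -
    have mid: "a \<oplus> (b \<oplus> (c \<oplus> \<ominus> a)) = b \<oplus> c"
      if "a \<in> carrier V" "b \<in> carrier V" "c \<in> carrier V" for a b c
      using that V.a_lcomm[of a "b \<oplus> c" "\<ominus> a"] by (simp add: V.r_neg V.a_assoc)
    have e: "x \<ominus> w = (x \<ominus> v) \<oplus> (v \<ominus> w)" "x \<ominus> v = (x \<ominus> w) \<ominus> (v \<ominus> w)"
      using x v w by (simp_all add: a_minus_def V.a_ac V.minus_add V.r_neg V.r_neg1 V.r_neg2 mid)
    show ?thesis using u(3)[OF _ d, of "x \<ominus> v"] u(6)[OF _ d, of "x \<ominus> w"] by (metis e)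
  qed
  then show "U +> v = U +> w" using coset_iff[OF v] coset_iff[OF w] by auto
qed

lemma coset_add:
  assumes v: "v \<in> carrier V" and w: "w \<in> carrier V"
  shows "(U +> v) <+>\<^bsub>V\<^esub> (U +> w) = U +> (v \<oplus> w)"
proof -
  note u = submoduleD[OF V U]
  show ?thesis
  proof
    show "(U +> v) <+>\<^bsub>V\<^esub> (U +> w) \<subseteq> U +> (v \<oplus> w)"
    proof
      fix z assume "z \<in> (U +> v) <+>\<^bsub>V\<^esub> (U +> w)"
      then obtain x y where xy: "x \<in> U" "y \<in> U" "z = (x \<oplus> v) \<oplus> (y \<oplus> w)"
        by (auto simp: set_add_iff a_r_coset_def')
      then have "z = (x \<oplus> y) \<oplus> (v \<oplus> w)" using u(1) v w by (simp add: V.a_ac)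
      moreover have "x \<oplus> y \<in> U" using u(3) xy by simp
      ultimately show "z \<in> U +> (v \<oplus> w)" unfolding a_r_coset_def' by blast
    qed
    show "U +> (v \<oplus> w) \<subseteq> (U +> v) <+>\<^bsub>V\<^esub> (U +> w)"
    proof
      fix z assume "z \<in> U +> (v \<oplus> w)"
      then obtain x where x: "x \<in> U" "z = x \<oplus> (v \<oplus> w)" by (auto simp: a_r_coset_def')
      then have "z = (x \<oplus> v) \<oplus> (\<zero> \<oplus> w)" using u(1) v w by (simp add: V.a_assoc)
      moreover have "x \<oplus> v \<in> U +> v" "\<zero> \<oplus> w \<in> U +> w"
        using x u(2) unfolding a_r_coset_def' by blast+
      ultimately show "z \<in> (U +> v) <+>\<^bsub>V\<^esub> (U +> w)" unfolding set_add_iff by blast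
    qed
  qed
qed

text \<open>The form of \<^const>\<open>quot_map\<close> and of the scalar multiplication of \<^const>\<open>quot_space\<close>: the sets
  in the union are all the same coset, and \<open>U +> v\<close> is not empty.\<close>
lemma coset_union:
  assumes T: "\<And>x y. x \<in> carrier V \<Longrightarrow> y \<in> carrier V \<Longrightarrow> x \<ominus> y \<in> U \<Longrightarrow> T x \<ominus> T y \<in> U"
    and Tc: "\<And>x. x \<in> carrier V \<Longrightarrow> T x \<in> carrier V" and v: "v \<in> carrier V"
  shows "(\<Union>x\<in>U +> v. U +> T x) = U +> T v"
proof -
  have "U +> T x = U +> T v" if "x \<in> U +> v" for x
    using that v T[of x v] Tc by (simp add: coset_iff coset_eq_iff)
  moreover have "v \<in> U +> v" using v submoduleD(2)[OF V U] by (simp add: coset_iff a_minus_def V.r_neg)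
  ultimately show ?thesis by blast
qed

lemma coset_smult:
  assumes v: "v \<in> carrier V"
  shows "(\<Union>x\<in>U +> v. U +> (c \<odot> x)) = U +> (c \<odot> v)"
proof (rule coset_union[OF _ vs_smult_closed[OF V] v])
  fix x y assume xy: "x \<in> carrier V" "y \<in> carrier V" "x \<ominus> y \<in> U"
  then have "c \<odot> x \<ominus> c \<odot> y = c \<odot> (x \<ominus> y)"
    by (simp add: a_minus_def vs_r_distr[OF V] vs_smult_minus[OF V])
  then show "c \<odot> x \<ominus> c \<odot> y \<in> U" using submoduleD(4)[OF V U xy(3)] by simp
qed

lemma quot_carrier: "carrier (quot_space V U) = (\<lambda>v. U +> v) ` carrier V"
  by (auto simp: A_RCOSETS_def')

lemma quot_ops:
  assumes "v \<in> carrier V"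
  shows "w \<in> carrier V \<Longrightarrow> (U +> v) \<oplus>\<^bsub>quot_space V U\<^esub> (U +> w) = U +> (v \<oplus> w)"
    and "c \<odot>\<^bsub>quot_space V U\<^esub> (U +> v) = U +> (c \<odot> v)"
    and "\<zero>\<^bsub>quot_space V U\<^esub> = U +> \<zero>"
    and "U +> v = \<zero>\<^bsub>quot_space V U\<^esub> \<longleftrightarrow> v \<in> U"
proof -
  have m0: "x \<ominus> \<zero> = x" if "x \<in> carrier V" for x
    using that by (simp add: a_minus_def)
  have "U = U +> \<zero>"
  proof -
    have "x \<in> U \<longleftrightarrow> x \<in> U +> \<zero>" for x
      using coset_iff[OF V.zero_closed, of x] m0[of x] submoduleD(1)[OF V U, of x] by metis
    then show ?thesis by blast
  qed
  then show z: "\<zero>\<^bsub>quot_space V U\<^esub> = U +> \<zero>" by simp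
  show "U +> v = \<zero>\<^bsub>quot_space V U\<^esub> \<longleftrightarrow> v \<in> U"
    unfolding z coset_eq_iff[OF assms V.zero_closed] m0[OF assms] ..
  show "(U +> v) \<oplus>\<^bsub>quot_space V U\<^esub> (U +> w) = U +> (v \<oplus> w)" if "w \<in> carrier V"
    unfolding quot_space_simps by (rule coset_add[OF assms that])
  show "c \<odot>\<^bsub>quot_space V U\<^esub> (U +> v) = U +> (c \<odot> v)"
    unfolding quot_space_simps by (rule coset_smult[OF assms])
qed

lemma quot_space_vs: "vectorspace class_ring (quot_space V U)"
proof -
  show ?thesis
    by (rule vs_criteria[OF class_field], unfold quot_carrier)
       (auto simp del: quot_space_simps simp: quot_ops(1,2) quot_ops(3)[OF V.zero_closed] vs_smult_closed[OF V]
         vs_l_distr[OF V] vs_r_distr[OF V] vs_assoc[OF V] vs_one[OF V] V.a_ac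
         intro!: arg_cong[of _ _ "\<lambda>v. U +> v"] bexI[of _ "\<ominus> _"] V.r_neg)
qed

lemma quot_proj: "(\<lambda>v. U +> v) \<in> lin V (quot_space V U)"
  by (rule linI) (auto simp del: quot_space_simps simp: quot_carrier quot_ops)

lemma quot_map_coset:
  assumes T: "T \<in> lin V V" and TU: "\<And>u. u \<in> U \<Longrightarrow> T u \<in> U" and v: "v \<in> carrier V"
  shows "quot_map V U T (U +> v) = U +> T v"
proof -
  have "(\<Union>x\<in>U +> v. U +> T x) = U +> T v"
    by (rule coset_union[OF _ linD(1)[OF T] v]) (use TU lin_minus[OF V V T, symmetric] in auto)
  then show ?thesis unfolding quot_map_def quot_carrier using v by auto
qed

lemma quot_map_lin:
  assumes T: "T \<in> lin V V" and TU: "\<And>u. u \<in> U \<Longrightarrow> T u \<in> U"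
  shows "quot_map V U T \<in> lin (quot_space V U) (quot_space V U)"
  by (rule linI) (use linD[OF T] in \<open>auto simp del: quot_space_simps
    simp: quot_carrier quot_ops quot_map_coset[OF T TU] vs_smult_closed[OF V]\<close>)

lemma char_poly_quot:
  assumes T: "T \<in> lin V V" and TU: "\<And>u. u \<in> U \<Longrightarrow> T u \<in> U" and fd: "vectorspace.fin_dim class_ring V"
  shows "endo_char_poly V T = endo_char_poly (sub_space V U) T * endo_char_poly (quot_space V U) (quot_map V U T)"
    and "vectorspace.fin_dim class_ring (quot_space V U)"
proof -
  show fdQ: "vectorspace.fin_dim class_ring (quot_space V U)"
    by (rule lin_image_fin_dim[OF V quot_space_vs quot_proj quot_carrier[symmetric] fd])
  have ker: "U = {v \<in> carrier V. U +> v = \<zero>\<^bsub>quot_space V U\<^esub>}"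
    using submoduleD(1)[OF V U] quot_ops(4) by blast
  show "endo_char_poly V T = endo_char_poly (sub_space V U) T * endo_char_poly (quot_space V U) (quot_map V U T)"
    by (rule char_poly_exact(1)[OF V quot_space_vs quot_proj quot_carrier[symmetric] ker T quot_map_lin[OF T TU]
          quot_map_coset[OF T TU, symmetric] submodule_fin_dim[OF V fd U] fdQ])
qed

end

section \<open>Generators and relations of the semidirect product\<close>

lemma pres_class_eqI: "pres_eq Gs Rs u v \<Longrightarrow> pres_class Gs Rs u = pres_class Gs Rs v"
  unfolding pres_class_def by (intro Collect_cong iffI) (rule pres_eq.trans[OF pres_eq.sym], assumption+, rule pres_eq.trans)

lemma presented_group_mult:
  assumes "u \<in> lists (Gs \<times> UNIV)" "v \<in> lists (Gs \<times> UNIV)"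
  shows "pres_class Gs Rs u \<otimes>\<^bsub>presented_group Gs Rs\<^esub> pres_class Gs Rs v = pres_class Gs Rs (u @ v)"
proof -
  have "u \<in> pres_class Gs Rs u" "v \<in> pres_class Gs Rs v"
    using assms by (auto simp: pres_class_def intro: pres_eq.refl)
  moreover have "pres_class Gs Rs (u' @ v') = pres_class Gs Rs (u @ v)"
    if "u' \<in> pres_class Gs Rs u" "v' \<in> pres_class Gs Rs v" for u' v'
  proof -
    have "pres_eq Gs Rs u' u" "pres_eq Gs Rs v' v" using that by (auto simp: pres_class_def intro: pres_eq.sym)
    then show ?thesis by (intro pres_class_eqI pres_eq.append)
  qed
  ultimately have "(\<Union>u'\<in>pres_class Gs Rs u. \<Union>v'\<in>pres_class Gs Rs v. pres_class Gs Rs (u' @ v')) =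
      pres_class Gs Rs (u @ v)" by blast
  then show ?thesis by (simp add: presented_group_def)
qed

lemma presented_group_carrier:
  "carrier (presented_group Gs Rs) = pres_class Gs Rs ` lists (Gs \<times> UNIV)"
  "\<one>\<^bsub>presented_group Gs Rs\<^esub> = pres_class Gs Rs []"
  by (simp_all add: presented_group_def)

text \<open>The letters cancel from the middle outwards.\<close>
lemma pres_eq_inverse:
  assumes "w \<in> lists (Gs \<times> UNIV)"
  shows "pres_eq Gs Rs (rev (map (\<lambda>(x, e). (x, \<not> e)) w) @ w) []"
  using assms
proof (induction w rule: lists.induct)
  case Nil
  show ?case by (auto intro: pres_eq.refl)
next
  case (Cons a w)
  obtain x e where a: "a = (x, e)" by (cases a)
  let ?w = "rev (map (\<lambda>(x, e). (x, \<not> e)) w)"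
  note ws = Cons.hyps(2)
  have x: "x \<in> Gs" using Cons.hyps(1) by (simp add: a)
  have "?w \<in> lists (Gs \<times> UNIV)"
  proof (rule in_listsI, rule ballI)
    fix y assume "y \<in> set ?w"
    then obtain z where z: "z \<in> set w" "fst y = fst z" by (auto simp: case_prod_beta)
    have "z \<in> Gs \<times> UNIV" by (rule bspec[OF iffD1[OF in_lists_conv_set ws] z(1)])
    with z(2) show "y \<in> Gs \<times> UNIV" by (simp add: mem_Times_iff)
  qed
  note w = this ws x
  have "pres_eq Gs Rs [(x, \<not> e), (x, e)] []" using pres_eq.cancel[OF w(3), of Rs "\<not> e"] by simp
  then have "pres_eq Gs Rs (?w @ ([(x, \<not> e), (x, e)] @ w)) (?w @ ([] @ w))"
    by (intro pres_eq.append pres_eq.refl w)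
  from pres_eq.trans[OF this] Cons.IH show ?case by (simp add: a)
qed

lemma group_presented_group: "group (presented_group Gs Rs)"
proof (rule groupI)
  fix A assume "A \<in> carrier (presented_group Gs Rs)"
  then obtain w where w: "w \<in> lists (Gs \<times> UNIV)" "A = pres_class Gs Rs w"
    by (auto simp: presented_group_carrier)
  show "\<one>\<^bsub>presented_group Gs Rs\<^esub> \<otimes>\<^bsub>presented_group Gs Rs\<^esub> A = A"
    using presented_group_mult[of "[]" Gs w Rs] w by (simp add: presented_group_carrier)
  let ?w = "rev (map (\<lambda>(x, e). (x, \<not> e)) w)"
  have iw: "?w \<in> lists (Gs \<times> UNIV)" using w by auto
  have "pres_class Gs Rs ?w \<otimes>\<^bsub>presented_group Gs Rs\<^esub> A = \<one>\<^bsub>presented_group Gs Rs\<^esub>"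
    unfolding w(2) presented_group_mult[OF iw w(1)] presented_group_carrier
    by (rule pres_class_eqI[OF pres_eq_inverse[OF w(1)]])
  then show "\<exists>B\<in>carrier (presented_group Gs Rs). B \<otimes>\<^bsub>presented_group Gs Rs\<^esub> A = \<one>\<^bsub>presented_group Gs Rs\<^esub>"
    using iw by (auto simp: presented_group_carrier)
next
  fix A B assume "A \<in> carrier (presented_group Gs Rs)" "B \<in> carrier (presented_group Gs Rs)"
  then obtain u v where *: "u \<in> lists (Gs \<times> UNIV)" "v \<in> lists (Gs \<times> UNIV)"
    "A = pres_class Gs Rs u" "B = pres_class Gs Rs v" by (auto simp: presented_group_carrier)
  then show "A \<otimes>\<^bsub>presented_group Gs Rs\<^esub> B \<in> carrier (presented_group Gs Rs)"
    by (auto simp: presented_group_mult presented_group_carrier(1))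
  fix C assume "C \<in> carrier (presented_group Gs Rs)"
  then obtain w where "w \<in> lists (Gs \<times> UNIV)" "C = pres_class Gs Rs w"
    by (auto simp: presented_group_carrier)
  with * show "A \<otimes>\<^bsub>presented_group Gs Rs\<^esub> B \<otimes>\<^bsub>presented_group Gs Rs\<^esub> C =
      A \<otimes>\<^bsub>presented_group Gs Rs\<^esub> (B \<otimes>\<^bsub>presented_group Gs Rs\<^esub> C)"
    by (simp add: presented_group_mult)
next
  show "\<one>\<^bsub>presented_group Gs Rs\<^esub> \<in> carrier (presented_group Gs Rs)"
    by (auto simp: presented_group_carrier)
qed

lemma GL_rep:
  fixes V :: "('a::field, 'v) module" (structure)
  assumes \<rho>: "\<rho> \<in> hom G (GL V)"
  shows "a \<in> carrier G \<Longrightarrow> \<rho> a \<in> lin V V"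
    and "a \<in> carrier G \<Longrightarrow> bij_betw (\<rho> a) (carrier V) (carrier V)"
    and "a \<in> carrier G \<Longrightarrow> b \<in> carrier G \<Longrightarrow> v \<in> carrier V \<Longrightarrow> \<rho> (a \<otimes>\<^bsub>G\<^esub> b) v = \<rho> a (\<rho> b v)"
proof -
  have c: "\<rho> a \<in> Bij (carrier V) \<inter> lin V V" if "a \<in> carrier G" for a
    using hom_in_carrier[OF \<rho> that] by (simp add: GL_def)
  then show "a \<in> carrier G \<Longrightarrow> \<rho> a \<in> lin V V"
    and "a \<in> carrier G \<Longrightarrow> bij_betw (\<rho> a) (carrier V) (carrier V)"
    by (auto simp: Bij_def)
  show "\<rho> (a \<otimes>\<^bsub>G\<^esub> b) v = \<rho> a (\<rho> b v)" if "a \<in> carrier G" "b \<in> carrier G" "v \<in> carrier V"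
    using hom_mult[OF \<rho> that(1,2)] c[OF that(1)] c[OF that(2)] that(3)
    by (simp add: GL_def BijGroup_def compose_def)
qed

lemma semidirect_simps:
  "carrier (semidirect \<theta> F B) = carrier F \<times> carrier B"
  "(u, \<sigma>) \<otimes>\<^bsub>semidirect \<theta> F B\<^esub> (v, \<tau>) = (u \<otimes>\<^bsub>F\<^esub> \<theta> \<sigma> v, \<sigma> \<otimes>\<^bsub>B\<^esub> \<tau>)"
  by (simp_all add: semidirect_def)

text \<open>In the semidirect product \<open>\<sigma> u = \<theta>\<^sub>\<sigma>(u) \<sigma>\<close>. The relation for \<open>x\<^sub>i\<^sub>+\<^sub>1\<close> is multiplied by
  \<open>x\<^sub>i\<^sub>+\<^sub>1\<close> from the left, which leaves no inverses.\<close>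
lemma free_braid_relations:
  assumes \<theta>: "artin_action n \<theta>" and i: "i \<in> {1..<n}"
  defines "G \<equiv> free_braid_group n \<theta>"
  shows "j \<in> {1..n} \<Longrightarrow> x_gen n j \<in> carrier G"
    and "sigma_gen n i \<in> carrier G"
    and "sigma_gen n i \<otimes>\<^bsub>G\<^esub> x_gen n i = x_gen n (i + 1) \<otimes>\<^bsub>G\<^esub> sigma_gen n i"
    and "x_gen n (i + 1) \<otimes>\<^bsub>G\<^esub> (sigma_gen n i \<otimes>\<^bsub>G\<^esub> x_gen n (i + 1)) =
      x_gen n i \<otimes>\<^bsub>G\<^esub> (x_gen n (i + 1) \<otimes>\<^bsub>G\<^esub> sigma_gen n i)"
    and "j \<in> {1..n} - {i, i + 1} \<Longrightarrow> sigma_gen n i \<otimes>\<^bsub>G\<^esub> x_gen n j = x_gen n j \<otimes>\<^bsub>G\<^esub> sigma_gen n i"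
    and "sigma_gen n i \<otimes>\<^bsub>G\<^esub> x_gen n (i + 1) \<in> carrier G"
    and "x_gen n (i + 1) \<otimes>\<^bsub>G\<^esub> sigma_gen n i \<in> carrier G"
proof -
  let ?F = "free_group n" let ?B = "braid_group n" let ?s = "braid_gen n i"
  interpret F: group ?F unfolding free_group_def by (rule group_presented_group)
  interpret B: group ?B unfolding braid_group_def by (rule group_presented_group)
  have x: "free_gen n j \<in> carrier ?F" if "j \<in> {1..n}" for j
    using that by (auto simp: free_gen_def free_group_def presented_group_carrier)
  have s: "?s \<in> carrier ?B"
    using i by (auto simp: braid_gen_def braid_group_def presented_group_carrier)
  have ii: "i \<in> {1..n}" "i + 1 \<in> {1..n}" using i by auto
  note xi = x[OF ii(1)] x[OF ii(2)]
  have hom: "\<theta> \<in> hom ?B (AutoGroup ?F)" using \<theta> by (simp add: artin_action_def)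
  have "\<theta> \<one>\<^bsub>?B\<^esub> = \<one>\<^bsub>AutoGroup ?F\<^esub>" by (rule hom_one[OF hom B.group_axioms F.AutoGroup])
  then have \<theta>1: "\<theta> \<one>\<^bsub>?B\<^esub> v = v" if "v \<in> carrier ?F" for v
    using that by (simp add: AutoGroup_def BijGroup_def)
  have "\<theta> ?s \<in> auto ?F" using hom_in_carrier[OF hom s] by (simp add: AutoGroup_def)
  then have "\<theta> ?s \<in> hom ?F ?F" by (simp add: auto_def)
  from hom_one[OF this F.group_axioms F.group_axioms] have \<theta>s1: "\<theta> ?s \<one>\<^bsub>?F\<^esub> = \<one>\<^bsub>?F\<^esub>" .
  have act: "\<theta> ?s (free_gen n i) = free_gen n (i + 1)"
    "\<theta> ?s (free_gen n (i + 1)) =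
      inv\<^bsub>?F\<^esub> (free_gen n (i + 1)) \<otimes>\<^bsub>?F\<^esub> free_gen n i \<otimes>\<^bsub>?F\<^esub> free_gen n (i + 1)"
    "\<And>j. j \<in> {1..n} - {i, i + 1} \<Longrightarrow> \<theta> ?s (free_gen n j) = free_gen n j"
    using \<theta> i unfolding artin_action_def by blast+
  note sd = G_def x_gen_def sigma_gen_def semidirect_simps
  show "j \<in> {1..n} \<Longrightarrow> x_gen n j \<in> carrier G" "sigma_gen n i \<in> carrier G"
    using x s by (simp_all add: sd)
  show "sigma_gen n i \<otimes>\<^bsub>G\<^esub> x_gen n i = x_gen n (i + 1) \<otimes>\<^bsub>G\<^esub> sigma_gen n i"
    using xi s by (simp add: sd act \<theta>1)
  show "j \<in> {1..n} - {i, i + 1} \<Longrightarrow> sigma_gen n i \<otimes>\<^bsub>G\<^esub> x_gen n j = x_gen n j \<otimes>\<^bsub>G\<^esub> sigma_gen n i"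
    using x s by (simp add: sd act \<theta>1)
  have y: "\<theta> ?s (free_gen n (i + 1)) \<in> carrier ?F" unfolding act using xi by simp
  show "sigma_gen n i \<otimes>\<^bsub>G\<^esub> x_gen n (i + 1) \<in> carrier G" "x_gen n (i + 1) \<otimes>\<^bsub>G\<^esub> sigma_gen n i \<in> carrier G"
    using xi s y by (simp_all add: sd \<theta>1)
  have "free_gen n (i + 1) \<otimes>\<^bsub>?F\<^esub> \<theta> ?s (free_gen n (i + 1)) = free_gen n i \<otimes>\<^bsub>?F\<^esub> free_gen n (i + 1)"
    unfolding act using xi by (simp add: F.m_assoc[symmetric])
  then show "x_gen n (i + 1) \<otimes>\<^bsub>G\<^esub> (sigma_gen n i \<otimes>\<^bsub>G\<^esub> x_gen n (i + 1)) =
      x_gen n i \<otimes>\<^bsub>G\<^esub> (x_gen n (i + 1) \<otimes>\<^bsub>G\<^esub> sigma_gen n i)"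
    using xi s y by (simp add: sd \<theta>1)
qed

lemma braid_rep_relations:
  fixes V :: "('a::field, 'v) module" (structure)
  assumes \<theta>: "artin_action n \<theta>" and i: "i \<in> {1..<n}" and \<rho>: "\<rho> \<in> hom (free_braid_group n \<theta>) (GL V)"
    and g: "\<And>j. g j = \<rho> (x_gen n j)" and s: "s = \<rho> (sigma_gen n i)"
  shows "j \<in> {1..n} \<Longrightarrow> g j \<in> lin V V" "s \<in> lin V V" "bij_betw s (carrier V) (carrier V)"
    and "v \<in> carrier V \<Longrightarrow> s (g i v) = g (i + 1) (s v)"
    and "v \<in> carrier V \<Longrightarrow> g (i + 1) (s (g (i + 1) v)) = g i (g (i + 1) (s v))"
    and "j \<in> {1..n} - {i, i + 1} \<Longrightarrow> v \<in> carrier V \<Longrightarrow> s (g j v) = g j (s v)"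
proof -
  note r = free_braid_relations[OF \<theta> i]
  note R = GL_rep[OF \<rho>]
  have ii: "i \<in> {1..n}" "i + 1 \<in> {1..n}" using i by auto
  show "j \<in> {1..n} \<Longrightarrow> g j \<in> lin V V" "s \<in> lin V V" "bij_betw s (carrier V) (carrier V)"
    using R(1,2) r(1,2) by (simp_all add: g s)
  show "s (g i v) = g (i + 1) (s v)" if "v \<in> carrier V"
    unfolding g s R(3)[OF r(2) r(1)[OF ii(1)] that, symmetric] R(3)[OF r(1)[OF ii(2)] r(2) that, symmetric] r(3) ..
  show "s (g j v) = g j (s v)" if j: "j \<in> {1..n} - {i, i + 1}" and v: "v \<in> carrier V"
  proof -
    have "j \<in> {1..n}" using j by auto
    then show ?thesis
      unfolding g s using R(3)[OF r(2) r(1) v, of j] R(3)[OF r(1) r(2) v, of j] r(5)[OF j] by simp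
  qed
  show "g (i + 1) (s (g (i + 1) v)) = g i (g (i + 1) (s v))" if v: "v \<in> carrier V"
    using R(3)[OF r(1)[OF ii(2)] r(6) v] R(3)[OF r(2) r(1)[OF ii(2)] v]
      R(3)[OF r(1)[OF ii(1)] r(7) v] R(3)[OF r(1)[OF ii(2)] r(2) v] r(4) by (simp add: g s)
qed

section \<open>Endomorphisms annihilated by a product of two linear factors\<close>

context abelian_group begin

text \<open>Cancellation across one summand; with these rules the AC simplifier decides the small identities
  that occur below.\<close>
lemma cancel_past:
  assumes "x \<in> carrier G" "y \<in> carrier G" "z \<in> carrier G"
  shows "x \<oplus> (y \<oplus> (\<ominus> x \<oplus> z)) = y \<oplus> z" "\<ominus> x \<oplus> (y \<oplus> (x \<oplus> z)) = y \<oplus> z"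
    "x \<oplus> (y \<oplus> \<ominus> x) = y" "\<ominus> x \<oplus> (y \<oplus> x) = y"
  using a_lcomm[of x y "\<ominus> x \<oplus> z"] a_lcomm[of "\<ominus> x" y "x \<oplus> z"] a_lcomm[of x y "\<ominus> x"]
    a_lcomm[of "\<ominus> x" y x] assms by (simp_all add: r_neg1 r_neg2 r_neg l_neg)

end

lemma sub_scalar_lin:
  fixes V :: "('a::field, 'v) module" (structure)
  assumes V: "vectorspace class_ring V" and T: "T \<in> lin V V"
  shows "sub_scalar V T c \<in> lin V V"
proof -
  interpret V: abelian_group V by (rule vs_group[OF V])
  note l = linD[OF T]
  show ?thesis
  proof (rule linI)
    fix u v assume uv: "u \<in> carrier V" "v \<in> carrier V"
    then show "sub_scalar V T c (u \<oplus> v) = sub_scalar V T c u \<oplus> sub_scalar V T c v"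
      using l(1)[of u] l(1)[of v]
      by (simp add: sub_scalar_def l(2) vs_r_distr[OF V] vs_smult_closed[OF V] a_minus_def V.minus_add V.a_ac)
  next
    fix d v assume v: "v \<in> carrier V"
    have "c \<odot> (d \<odot> v) = d \<odot> (c \<odot> v)"
      using vs_assoc[OF V v, of c d] vs_assoc[OF V v, of d c] by (simp add: mult.commute)
    with v l(1)[OF v] show "sub_scalar V T c (d \<odot> v) = d \<odot> sub_scalar V T c v"
      by (simp add: sub_scalar_def l(3) vs_smult_closed[OF V] a_minus_def vs_r_distr[OF V] vs_smult_minus[OF V])
  qed (use l in \<open>simp add: sub_scalar_def vs_smult_closed[OF V]\<close>)
qed

lemma quot_sub_scalar:
  fixes V :: "('a::field, 'v) module" (structure)
  assumes V: "vectorspace class_ring V" and U: "submodule class_ring U V"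
    and T: "T \<in> lin V V" and TU: "\<And>u. u \<in> U \<Longrightarrow> T u \<in> U" and v: "v \<in> carrier V"
  shows "sub_scalar (quot_space V U) (quot_map V U T) c (U +> v) = U +> sub_scalar V T c v"
proof -
  have q: "quot_map V U T (U +> v) = U +> T v"
    by (rule quot_map_coset[OF V U T _ v]) (rule TU)
  show ?thesis unfolding sub_scalar_def q quot_ops(2)[OF V U v]
  by (rule lin_minus[OF V quot_space_vs[OF V U] quot_proj[OF V U], symmetric])
     (use linD(1)[OF T v] vs_smult_closed[OF V v] in auto)
qed

lemma quadratic_quot_iff:
  fixes V :: "('a::field, 'v) module" (structure)
  assumes V: "vectorspace class_ring V" and U: "submodule class_ring U V"
    and T: "T \<in> lin V V" and TU: "\<And>u. u \<in> U \<Longrightarrow> T u \<in> U"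
  defines "Q \<equiv> quot_space V U" and "T' \<equiv> quot_map V U T"
  shows "(\<forall>q\<in>carrier Q. sub_scalar Q T' a (sub_scalar Q T' b q) = \<zero>\<^bsub>Q\<^esub>) \<longleftrightarrow>
    (\<lambda>w. sub_scalar V T a (sub_scalar V T b w)) ` carrier V \<subseteq> U"
proof -
  note c = linD(1)[OF sub_scalar_lin[OF V T]]
  have "sub_scalar Q T' a (sub_scalar Q T' b (U +> w)) = \<zero>\<^bsub>Q\<^esub> \<longleftrightarrow>
      sub_scalar V T a (sub_scalar V T b w) \<in> U" if "w \<in> carrier V" for w
  proof -
    have q: "sub_scalar Q T' d (U +> v) = U +> sub_scalar V T d v" if "v \<in> carrier V" for d v
      unfolding Q_def T'_def by (rule quot_sub_scalar[OF V U T _ that]) (rule TU)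
    show ?thesis unfolding q[OF that] q[OF c[OF that]]
      unfolding Q_def by (rule quot_ops(4)[OF V U c[OF c[OF that]]])
  qed
  then show ?thesis unfolding Q_def quot_carrier[OF V U] by (simp add: image_subset_iff)
qed

text \<open>The relation holds for the matrix of \<open>T\<close> in any coordinates and survives the embedding into the
  algebraic closure. Applied to an eigenvector for \<open>z\<close> it yields \<open>(z - a) (z - b) = 0\<close>. The roots of the
  characteristic polynomial are eigenvalues.\<close>
lemma quadratic_eigenvalues:
  fixes V :: "('a::field, 'v) module" (structure)
  assumes V: "vectorspace class_ring V" and fd: "vectorspace.fin_dim class_ring V" and T: "T \<in> lin V V"
    and h: "\<And>v. v \<in> carrier V \<Longrightarrow> sub_scalar V T a (sub_scalar V T b v) = \<zero>"
  shows "ac_eigenvalues V T \<subseteq> {to_ac a, to_ac b}"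
    and "{z. poly (map_poly to_ac (endo_char_poly V T)) z = 0} \<subseteq> {to_ac a, to_ac b}"
proof -
  interpret V: abelian_group V by (rule vs_group[OF V])
  interpret ac: comm_ring_hom "to_ac :: 'a \<Rightarrow> 'a alg_closure" by unfold_locales auto
  have main: "z \<in> {to_ac a, to_ac b}"
    if \<phi>: "coords V m \<phi>" and A: "A \<in> carrier_mat m m"
      and TA: "\<forall>v\<in>carrier_vec m. T (\<phi> v) = \<phi> (A *\<^sub>v v)" and z: "eigenvalue (map_mat to_ac A) z"
    for m \<phi> A z
  proof -
    have inj: "\<phi> x = \<phi> y \<Longrightarrow> x = y" if "x \<in> carrier_vec m" "y \<in> carrier_vec m" for x y
      using inj_onD[OF coordsD(2)[OF \<phi>]] that by blast
    note l = coordsD(1)[OF \<phi>]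
    have smv: "(c \<cdot>\<^sub>m 1\<^sub>m m) *\<^sub>v v = c \<cdot>\<^sub>v v" if "v \<in> carrier_vec m" for c and v :: "'c::field vec"
    proof (rule eq_vecI)
      fix i assume "i < dim_vec (c \<cdot>\<^sub>v v)"
      then have i: "i < m" using that by simp
      have "((c \<cdot>\<^sub>m 1\<^sub>m m) *\<^sub>v v) $ i = (\<Sum>j = 0..<m. (c \<cdot>\<^sub>m 1\<^sub>m m) $$ (i, j) * v $ j)"
        using i that by (auto simp: scalar_prod_def intro!: sum.cong)
      also have "\<dots> = (\<Sum>j = 0..<m. if j = i then c * v $ i else 0)"
        using i by (intro sum.cong) auto
      finally show "((c \<cdot>\<^sub>m 1\<^sub>m m) *\<^sub>v v) $ i = (c \<cdot>\<^sub>v v) $ i" using i that by simp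
    qed (use that in simp)
    let ?m = "\<lambda>c. A - c \<cdot>\<^sub>m 1\<^sub>m m"
    have act: "?m c *\<^sub>v v = A *\<^sub>v v - c \<cdot>\<^sub>v v" if "v \<in> carrier_vec m" for c v
      using A that by (simp add: minus_mult_distrib_mat_vec[of _ m m] smv)
    have sub: "sub_scalar V T c (\<phi> v) = \<phi> (?m c *\<^sub>v v)" if v: "v \<in> carrier_vec m" for c v
    proof -
      have vm: "u \<ominus>\<^bsub>vec_sp m\<^esub> v = u - v" if "u \<in> carrier_vec m" "v \<in> carrier_vec m" for u v :: "'a vec"
        using that unfolding a_minus_def by (subst vec_space.vec_neg) auto
      have "\<phi> (?m c *\<^sub>v v) = \<phi> (A *\<^sub>v v) \<ominus> \<phi> (c \<cdot>\<^sub>v v)"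
        unfolding act[OF v] using lin_minus[OF vec_vs V l, of "A *\<^sub>v v" "c \<cdot>\<^sub>v v"] vm[of "A *\<^sub>v v" "c \<cdot>\<^sub>v v"] A v by auto
      then show ?thesis using TA v linD(3)[OF l, of v c] by (simp add: sub_scalar_def)
    qed
    have mc: "?m c \<in> carrier_mat m m" for c using A by auto
    have "?m a * ?m b = 0\<^sub>m m m"
    proof (rule mat_eq_by_action[of _ m m])
      fix v :: "'a vec" assume v: "v \<in> carrier_vec m"
      have bv: "?m b *\<^sub>v v \<in> carrier_vec m" by (rule mult_mat_vec_carrier[OF mc v])
      have "\<phi> (?m a *\<^sub>v (?m b *\<^sub>v v)) = \<zero>"
        using h[OF coordsD(4)[OF \<phi> v]] unfolding sub[OF v] sub[OF bv] .
      also have "\<dots> = \<phi> (0\<^sub>v m)" using lin_zero[OF vec_vs V l] by simp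
      finally have "?m a *\<^sub>v (?m b *\<^sub>v v) = 0\<^sub>v m" by (intro inj mult_mat_vec_carrier[OF mc bv] zero_carrier_vec)
      then show "(?m a * ?m b) *\<^sub>v v = 0\<^sub>m m m *\<^sub>v v"
        unfolding assoc_mult_mat_vec[OF mc mc v] using v by (auto intro!: eq_vecI)
    qed (use mult_carrier_mat[OF mc mc] in simp_all)
    then have "map_mat to_ac (?m a * ?m b) = map_mat to_ac (0\<^sub>m m m)" by simp
    then have "map_mat to_ac (?m a) * map_mat to_ac (?m b) = map_mat to_ac (0\<^sub>m m m)"
      using ac.mat_hom_mult[OF mc mc] by simp
    moreover let ?A = "map_mat to_ac A"
    let ?M = "\<lambda>c. ?A - to_ac c \<cdot>\<^sub>m 1\<^sub>m m"
    have "map_mat to_ac (?m c) = ?M c" for c by (rule eq_matI) (use A in auto)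
    ultimately have MM: "?M a * ?M b = 0\<^sub>m m m" by (auto intro!: eq_matI)
    have A': "?A \<in> carrier_mat m m" using A by auto
    obtain v where v: "v \<in> carrier_vec m" "v \<noteq> 0\<^sub>v m" "?A *\<^sub>v v = z \<cdot>\<^sub>v v"
      using z A' unfolding eigenvalue_def eigenvector_def by auto
    have M: "?M c *\<^sub>v v = (z - to_ac c) \<cdot>\<^sub>v v" for c
    proof -
      have "?M c *\<^sub>v v = ?A *\<^sub>v v - to_ac c \<cdot>\<^sub>v v"
        using A' v by (simp add: minus_mult_distrib_mat_vec[of _ m m] smv)
      then show ?thesis unfolding v(3) using v(1) by (auto intro!: eq_vecI simp: algebra_simps)
    qed
    have Mc: "?M c \<in> carrier_mat m m" for c using A' by auto
    have "0\<^sub>v m = (?M a * ?M b) *\<^sub>v v" unfolding MM using v(1) by (auto intro!: eq_vecI)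
    also have "\<dots> = ?M a *\<^sub>v ((z - to_ac b) \<cdot>\<^sub>v v)"
      using assoc_mult_mat_vec[OF Mc Mc v(1)] M by simp
    also have "\<dots> = (z - to_ac b) \<cdot>\<^sub>v ((z - to_ac a) \<cdot>\<^sub>v v)"
      using mult_mat_vec[OF Mc v(1)] M by simp
    finally have e: "(z - to_ac b) \<cdot>\<^sub>v ((z - to_ac a) \<cdot>\<^sub>v v) = 0\<^sub>v m" by simp
    obtain r where r: "r < m" "v $ r \<noteq> 0" using v(1,2) by (auto simp: vec_eq_iff)
    have "(z - to_ac b) * ((z - to_ac a) * v $ r) = 0"
      using arg_cong[OF e, of "\<lambda>x :: 'a alg_closure vec. x $ r"] r v(1) by simp
    with r show ?thesis by auto
  qed
  show "ac_eigenvalues V T \<subseteq> {to_ac a, to_ac b}"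
  proof
    fix z assume "z \<in> ac_eigenvalues V T"
    then obtain bs A where r: "matrix_rep V bs T A" and z: "eigenvalue (map_mat to_ac A) z"
      by (auto simp: ac_eigenvalues_def)
    obtain \<phi> where "coords V (length bs) \<phi>" "\<forall>v\<in>carrier_vec (length bs). T (\<phi> v) = \<phi> (A *\<^sub>v v)"
      using matrix_rep_coords[OF V T r] by auto
    moreover have "A \<in> carrier_mat (length bs) (length bs)" using r by (simp add: matrix_rep_def)
    ultimately show "z \<in> {to_ac a, to_ac b}" using main z by blast
  qed
  obtain m \<phi> where \<phi>: "coords V m \<phi>" using coords_exists[OF V fd] by auto
  obtain A where A: "A \<in> carrier_mat m m" "\<forall>v\<in>carrier_vec m. T (\<phi> v) = \<phi> (A *\<^sub>v v)"
    using coords_matrix[OF V V T \<phi> \<phi>] by auto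
  have cp: "endo_char_poly V T = char_poly A" by (rule endo_char_poly_eq[OF V T \<phi> A(1)]) (use A in auto)
  have A': "map_mat to_ac A \<in> carrier_mat m m" using A by auto
  show "{z. poly (map_poly to_ac (endo_char_poly V T)) z = 0} \<subseteq> {to_ac a, to_ac b}"
  proof
    fix z assume "z \<in> {z. poly (map_poly to_ac (endo_char_poly V T)) z = 0}"
    then have "eigenvalue (map_mat to_ac A) z"
      unfolding cp eigenvalue_root_char_poly[OF A'] ac.char_poly_hom[OF A(1)] by simp
    with main[OF \<phi> A] show "z \<in> {to_ac a, to_ac b}" by blast
  qed
qed

text \<open>By Zorn's lemma some invariant subspace \<open>M\<close> is maximal among those that meet \<open>U\<close> only in zero. An eigenvector
  outside \<open>U + M\<close> could be added to \<open>M\<close>, so \<open>U + M\<close> contains all eigenvectors. Every \<open>x\<close> is a combination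
  of the two eigenvectors \<open>(T - b) x\<close> and \<open>(T - a) x\<close>.\<close>
lemma quadratic_semisimple:
  fixes V :: "('a::field, 'v) module" (structure)
  assumes V: "vectorspace class_ring V" and T: "T \<in> lin V V" and ab: "a \<noteq> b"
    and h: "\<And>v. v \<in> carrier V \<Longrightarrow> sub_scalar V T a (sub_scalar V T b v) = \<zero>"
  shows "semisimple_endo V T"
  unfolding semisimple_endo_def
proof (intro allI impI)
  interpret V: abelian_group V by (rule vs_group[OF V])
  note l = linD[OF T] and sm [simp] = vs_smult_closed[OF V]
  fix U assume "submodule class_ring U V \<and> T ` U \<subseteq> U"
  then have U: "submodule class_ring U V" and TU: "\<And>u. u \<in> U \<Longrightarrow> T u \<in> U" by auto
  note u = submoduleD[OF V U]
  define \<C> where "\<C> = {M. submodule class_ring M V \<and> T ` M \<subseteq> M \<and> U \<inter> M \<subseteq> {\<zero>}}"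
  have "{\<zero>} \<in> \<C>"
    unfolding \<C>_def using lin_zero[OF V V T] by (auto intro!: submoduleI[OF V] simp: vs_smult_zero[OF V])
  then have ne: "\<C> \<noteq> {}" by blast
  have un: "\<Union>\<D> \<in> \<C>" if \<D>: "\<D> \<noteq> {}" "subset.chain \<C> \<D>" for \<D>
  proof -
    have D: "\<D> \<subseteq> \<C>" and ch: "\<And>M N. M \<in> \<D> \<Longrightarrow> N \<in> \<D> \<Longrightarrow> M \<subseteq> N \<or> N \<subseteq> M"
      using \<D>(2) by (auto simp: subset.chain_def)
    have sub: "submodule class_ring M V" "T ` M \<subseteq> M" "U \<inter> M \<subseteq> {\<zero>}" if "M \<in> \<D>" for M
      using that D by (auto simp: \<C>_def)
    have "submodule class_ring (\<Union>\<D>) V"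
    proof (rule submoduleI[OF V])
      show "\<Union>\<D> \<subseteq> carrier V" using submodule.subset[OF sub(1)] by blast
      show "\<zero> \<in> \<Union>\<D>" using \<D>(1) submoduleD(2)[OF V sub(1)] by blast
    next
      fix x y assume "x \<in> \<Union>\<D>" "y \<in> \<Union>\<D>"
      then obtain M N where MN: "M \<in> \<D>" "N \<in> \<D>" "x \<in> M" "y \<in> N" by blast
      then have "\<exists>P\<in>\<D>. x \<in> P \<and> y \<in> P" using ch[OF MN(1,2)] by blast
      then obtain P where "P \<in> \<D>" "x \<in> P" "y \<in> P" by blast
      then show "x \<oplus> y \<in> \<Union>\<D>" using submoduleD(3)[OF V sub(1)] by blast
    next
      fix c x assume "x \<in> \<Union>\<D>"
      then show "c \<odot> x \<in> \<Union>\<D>" using submoduleD(4)[OF V sub(1)] by blast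
    qed
    moreover have "T ` \<Union>\<D> \<subseteq> \<Union>\<D>" using sub(2) by blast
    moreover have "U \<inter> \<Union>\<D> \<subseteq> {\<zero>}" using sub(3) by blast
    ultimately show ?thesis by (simp add: \<C>_def)
  qed
  obtain M where M: "M \<in> \<C>" and max: "\<And>N. N \<in> \<C> \<Longrightarrow> M \<subseteq> N \<Longrightarrow> N = M"
    using subset_Zorn_nonempty[OF ne un] by blast
  have Ms: "submodule class_ring M V" and TM: "\<And>x. x \<in> M \<Longrightarrow> T x \<in> M" and UM: "\<And>x. x \<in> U \<Longrightarrow> x \<in> M \<Longrightarrow> x = \<zero>"
    using M by (auto simp: \<C>_def)
  note m = submoduleD[OF V Ms]
  let ?C = "U <+>\<^bsub>V\<^esub> M"
  have C: "submodule class_ring ?C V" by (rule set_add_submodule[OF V U Ms])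
  note c = submoduleD[OF V C]
  have eig: "y \<in> ?C" if y: "y \<in> carrier V" and Ty: "T y = e \<odot> y" for y e
  proof (rule ccontr)
    assume yC: "y \<notin> ?C"
    define N where "N = {x \<oplus> d \<odot> y | x d. x \<in> M}"
    have MN: "M \<subseteq> N"
    proof
      fix x assume x: "x \<in> M"
      then have "x = x \<oplus> 0 \<odot> y" using m(1) y by (simp add: vs_zero_smult[OF V])
      with x show "x \<in> N" unfolding N_def by blast
    qed
    have yN: "y \<in> N"
    proof -
      have "y = \<zero> \<oplus> 1 \<odot> y" using y by (simp add: vs_one[OF V])
      then show ?thesis unfolding N_def using m(2) by blast
    qed
    have "submodule class_ring N V"
    proof (rule submoduleI[OF V])
      show "N \<subseteq> carrier V" using m(1) y by (auto simp: N_def)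
      show "\<zero> \<in> N" using m(2) MN by auto
    next
      fix p q assume "p \<in> N" "q \<in> N"
      then obtain x d x' d' where *: "x \<in> M" "x' \<in> M" "p = x \<oplus> d \<odot> y" "q = x' \<oplus> d' \<odot> y"
        by (auto simp: N_def)
      then have "p \<oplus> q = (x \<oplus> x') \<oplus> (d + d') \<odot> y"
        using m(1) y by (simp add: vs_l_distr[OF V] V.a_ac)
      then show "p \<oplus> q \<in> N" using m(3)[OF *(1,2)] unfolding N_def by blast
    next
      fix k p assume "p \<in> N"
      then obtain x d where *: "x \<in> M" "p = x \<oplus> d \<odot> y" by (auto simp: N_def)
      then have "k \<odot> p = k \<odot> x \<oplus> (k * d) \<odot> y"
        using m(1) y by (simp add: vs_r_distr[OF V] vs_assoc[OF V])
      then show "k \<odot> p \<in> N" using m(4)[OF *(1)] unfolding N_def by blast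
    qed
    moreover have "T ` N \<subseteq> N"
    proof
      fix q assume "q \<in> T ` N"
      then obtain x d where *: "x \<in> M" "q = T (x \<oplus> d \<odot> y)" by (auto simp: N_def)
      then have "q = T x \<oplus> (d * e) \<odot> y"
        using m(1) y l(2)[of x "d \<odot> y"] l(3)[OF y, of d] Ty by (simp add: vs_assoc[OF V])
      then show "q \<in> N" using TM[OF *(1)] unfolding N_def by blast
    qed
    moreover have "U \<inter> N \<subseteq> {\<zero>}"
    proof
      fix q assume q: "q \<in> U \<inter> N"
      then obtain x d where *: "x \<in> M" "q = x \<oplus> d \<odot> y" by (auto simp: N_def)
      show "q \<in> {\<zero>}"
      proof (cases "d = 0")
        case True
        then have "q = x" using * m(1) y by (simp add: vs_zero_smult[OF V])
        then show ?thesis using UM q * by auto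
      next
        case False
        have qc: "q \<in> carrier V" "x \<in> carrier V" using q u(1) m(1) * by auto
        have "\<zero> \<oplus> x \<in> ?C" "q \<oplus> \<zero> \<in> ?C" using u(2) m(2) * q unfolding set_add_iff by blast+
        then have "q \<ominus> x \<in> ?C" using qc c(6) by simp
        moreover have "q \<ominus> x = d \<odot> y"
          unfolding *(2) using qc y by (simp add: a_minus_def V.a_ac V.r_neg1 V.r_neg2 V.cancel_past)
        ultimately have "inverse d \<odot> (d \<odot> y) \<in> ?C" using c(4) by metis
        moreover have "inverse d \<odot> (d \<odot> y) = y"
          using vs_assoc[OF V y, of "inverse d" d] False y by (simp add: vs_one[OF V])
        ultimately show ?thesis using yC by simp
      qed
    qed
    ultimately have "N \<in> \<C>" by (simp add: \<C>_def)
    from max[OF this MN] yN have "y \<in> M" by simp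
    then have "\<zero> \<oplus> y \<in> ?C" using u(2) unfolding set_add_iff by blast
    with yC y show False by simp
  qed
  have "carrier V \<subseteq> ?C"
  proof
    fix x assume x: "x \<in> carrier V"
    \<comment> \<open>The hypothesis makes \<open>y1\<close> an eigenvector. That \<open>y2 = y1 - (a - b) x\<close> is one as well
      amounts to exchanging the two linear factors.\<close>
    define y1 where "y1 = sub_scalar V T b x"
    define y2 where "y2 = sub_scalar V T a x"
    have Tx: "T x \<in> carrier V" by (rule l(1)[OF x])
    have yc: "y1 \<in> carrier V" "y2 \<in> carrier V" using x Tx by (simp_all add: y1_def y2_def sub_scalar_def)
    have "T y1 \<ominus> a \<odot> y1 = \<zero>" using h[OF x] by (simp add: y1_def[symmetric]) (simp add: sub_scalar_def)
    then have e1: "T y1 = a \<odot> y1" using yc l(1) by simp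
    have Tx1: "T x = y1 \<oplus> b \<odot> x" and Tx2: "T x = y2 \<oplus> a \<odot> x"
      using x Tx by (simp_all add: y1_def y2_def sub_scalar_def a_minus_def V.a_assoc V.l_neg)
    have y12: "y2 \<oplus> a \<odot> x = y1 \<oplus> b \<odot> x" using Tx1 Tx2 by simp
    have "T y2 \<oplus> a \<odot> T x = T y1 \<oplus> b \<odot> T x"
      using arg_cong[OF y12, of T] x yc by (simp add: l(2) l(3))
    also have "\<dots> = a \<odot> y1 \<oplus> b \<odot> (y2 \<oplus> a \<odot> x)" by (simp add: e1 Tx2)
    also have "\<dots> = b \<odot> y2 \<oplus> a \<odot> (y1 \<oplus> b \<odot> x)"
      using x yc by (simp add: vs_r_distr[OF V] vs_assoc[OF V, symmetric] V.a_ac mult.commute)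
    also have "\<dots> = b \<odot> y2 \<oplus> a \<odot> T x" by (simp add: Tx1)
    finally have e2: "T y2 = b \<odot> y2" using x yc l(1)[OF yc(2)] Tx by simp
    have "y1 \<ominus> y2 \<in> ?C" by (rule c(6)[OF eig[OF yc(1) e1] eig[OF yc(2) e2]])
    moreover have "y1 \<ominus> y2 = (a - b) \<odot> x"
    proof -
      have "(a - b) \<odot> x = a \<odot> x \<oplus> \<ominus> (b \<odot> x)"
        using vs_l_distr[OF V x, of a "- b"] vs_minus_smult[OF V x, of b] by simp
      then show ?thesis using x Tx
        by (simp add: y1_def y2_def sub_scalar_def a_minus_def V.minus_add V.a_ac V.r_neg1 V.r_neg2 V.cancel_past)
    qed
    ultimately have "inverse (a - b) \<odot> ((a - b) \<odot> x) \<in> ?C" using c(4) by metis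
    moreover have "inverse (a - b) \<odot> ((a - b) \<odot> x) = x"
      using vs_assoc[OF V x, of "inverse (a - b)" "a - b"] ab x by (simp add: vs_one[OF V])
    ultimately show "x \<in> ?C" by simp
  qed
  moreover have "?C \<subseteq> carrier V" using c(1) by blast
  ultimately have full: "?C = carrier V" by blast
  have "U \<inter> M = {\<zero>}" using UM u(2) m(2) by blast
  moreover have "T ` M \<subseteq> M" using TM by blast
  ultimately show "\<exists>U'. submodule class_ring U' V \<and> T ` U' \<subseteq> U' \<and> U \<inter> U' = {\<zero>} \<and> U <+>\<^bsub>V\<^esub> U' = carrier V"
    using Ms full by blast
qed

section \<open>The operator of a braid generator\<close>

text \<open>What remains of the representation once a single braid generator is fixed: the commutation rules
  of \<open>s = \<rho>(\<sigma>\<^sub>i)\<close> with the operators \<open>g j = \<rho>(x\<^sub>j)\<close>.\<close>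
locale klm_data =
  fixes V :: "('a::field, 'v) module" (structure) and n i :: nat and lam :: 'a
    and g :: "nat \<Rightarrow> 'v \<Rightarrow> 'v" and s :: "'v \<Rightarrow> 'v"
  assumes V: "vectorspace class_ring V" and fd: "vectorspace.fin_dim class_ring V"
    and i: "i \<in> {1..<n}" and lam1: "lam \<noteq> 1"
    and g: "j \<in> {1..n} \<Longrightarrow> g j \<in> lin V V"
    and s: "s \<in> lin V V" and s_bij: "bij_betw s (carrier V) (carrier V)"
    and s_g: "v \<in> carrier V \<Longrightarrow> s (g i v) = g (Suc i) (s v)"
    and g_s_g: "v \<in> carrier V \<Longrightarrow> g (Suc i) (s (g (Suc i) v)) = g i (g (Suc i) (s v))"
    and s_g_far: "j \<in> {1..n} \<Longrightarrow> j \<noteq> i \<Longrightarrow> j \<noteq> Suc i \<Longrightarrow> v \<in> carrier V \<Longrightarrow> s (g j v) = g j (s v)"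
begin

interpretation A: abelian_group V by (rule vs_group[OF V])

abbreviation Vn :: "('a, nat \<Rightarrow> 'v) module" where "Vn \<equiv> power_space n V"
abbreviation S :: "(nat \<Rightarrow> 'v) \<Rightarrow> nat \<Rightarrow> 'v" where "S \<equiv> LM_sigma n V g (\<lambda>_. s) i"
abbreviation far :: "nat set" where "far \<equiv> {1..n} - {i, Suc i}"

definition W :: "nat \<Rightarrow> 'v set" where "W j = {v \<in> carrier V. g j v = v}"

lemma ii: "i \<in> {1..n}" "Suc i \<in> {1..n}" using i by auto

lemma Vn: "vectorspace class_ring Vn" by (rule power_space_vs[OF V])

lemma Vn_nth: "w \<in> carrier Vn \<Longrightarrow> j \<in> {1..n} \<Longrightarrow> w j \<in> carrier V" by auto

lemma Vn_eqI: "v \<in> carrier Vn \<Longrightarrow> w \<in> carrier Vn \<Longrightarrow> (\<And>j. j \<in> {1..n} \<Longrightarrow> v j = w j) \<Longrightarrow> v = w"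
  unfolding power_space_simps by (rule PiE_ext)

lemma position_cases:
  assumes "j \<in> {1..n}"
  obtains "j = i" | "j = Suc i" | "j \<in> far"
  using assms by blast

lemma s_closed: "v \<in> carrier V \<Longrightarrow> s v \<in> carrier V" by (rule linD(1)[OF s])
lemma g_closed: "j \<in> {1..n} \<Longrightarrow> v \<in> carrier V \<Longrightarrow> g j v \<in> carrier V" by (rule linD(1)[OF g])
lemmas gi_closed = g_closed[OF ii(1)] g_closed[OF ii(2)]
lemma s_zero: "s \<zero> = \<zero>" by (rule lin_zero[OF V V s])
lemma g_zero: "j \<in> {1..n} \<Longrightarrow> g j \<zero> = \<zero>" by (rule lin_zero[OF V V g])
lemma s_inj: "u \<in> carrier V \<Longrightarrow> v \<in> carrier V \<Longrightarrow> s u = s v \<Longrightarrow> u = v"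
  using s_bij by (auto simp: bij_betw_def dest: inj_onD)

lemmas closed = s_closed gi_closed vs_smult_closed[OF V]

lemma S_nth:
  assumes "w \<in> carrier Vn"
  shows "S w i = s (g i (w (Suc i)))"
    "S w (Suc i) = s (w i \<oplus> (w (Suc i) \<ominus> g (Suc i) (w (Suc i))))"
    "j \<in> far \<Longrightarrow> S w j = s (w j)"
  using assms i by (auto simp: LM_sigma_def)

lemma S_closed: "w \<in> carrier Vn \<Longrightarrow> S w \<in> carrier Vn"
proof -
  assume w: "w \<in> carrier Vn"
  have "S w j \<in> carrier V" if "j \<in> {1..n}" for j
    using that
  proof (cases rule: position_cases)
    case 1 then show ?thesis using S_nth(1)[OF w] Vn_nth[OF w] ii closed by simp
  next
    case 2 then show ?thesis using S_nth(2)[OF w] Vn_nth[OF w ii(1)] Vn_nth[OF w ii(2)] closed by simp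
  next
    case 3 then show ?thesis using S_nth(3)[OF w 3] Vn_nth[OF w that] closed by simp
  qed
  moreover have "S w \<in> extensional {1..n}" using w by (simp add: LM_sigma_def)
  ultimately show "S w \<in> carrier Vn" by (simp add: PiE_iff)
qed

lemma S_lin: "S \<in> lin Vn Vn"
proof -
  interpret Vn: abelian_group Vn by (rule vs_group[OF Vn])
  note l = linD[OF s] linD[OF g[OF ii(1)]] linD[OF g[OF ii(2)]]
  show ?thesis
  proof (rule linI)
    fix u v assume u: "u \<in> carrier Vn" and v: "v \<in> carrier Vn"
    have uv: "u \<oplus>\<^bsub>Vn\<^esub> v \<in> carrier Vn" using u v by (rule Vn.a_closed)
    note c = Vn_nth[OF u ii(1)] Vn_nth[OF u ii(2)] Vn_nth[OF v ii(1)] Vn_nth[OF v ii(2)]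
    have n: "(x \<oplus>\<^bsub>Vn\<^esub> y) j = x j \<oplus> y j" if "j \<in> {1..n}" for x y j using that by simp
    show "S (u \<oplus>\<^bsub>Vn\<^esub> v) = S u \<oplus>\<^bsub>Vn\<^esub> S v"
    proof (rule Vn_eqI[OF S_closed[OF uv] Vn.a_closed[OF S_closed[OF u] S_closed[OF v]]])
      fix j assume j: "j \<in> {1..n}"
      then show "S (u \<oplus>\<^bsub>Vn\<^esub> v) j = (S u \<oplus>\<^bsub>Vn\<^esub> S v) j"
      proof (cases rule: position_cases)
        case 1
        show ?thesis unfolding n[OF j] unfolding 1 S_nth(1)[OF uv] S_nth(1)[OF u] S_nth(1)[OF v] n[OF ii(2)]
          using c closed by (simp add: l(2) l(5))
      next
        case 2
        show ?thesis unfolding n[OF j] unfolding 2 S_nth(2)[OF uv] S_nth(2)[OF u] S_nth(2)[OF v] n[OF ii(1)] n[OF ii(2)]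
          using c closed by (simp add: l(2)[symmetric] l(8) a_minus_def A.minus_add A.a_ac)
      next
        case 3
        show ?thesis unfolding n[OF j] S_nth(3)[OF uv 3] S_nth(3)[OF u 3] S_nth(3)[OF v 3]
          by (rule l(2)[OF Vn_nth[OF u j] Vn_nth[OF v j]])
      qed
    qed
  next
    fix d v assume v: "v \<in> carrier Vn"
    have dv: "d \<odot>\<^bsub>Vn\<^esub> v \<in> carrier Vn" by (rule vs_smult_closed[OF Vn v])
    note c = Vn_nth[OF v ii(1)] Vn_nth[OF v ii(2)]
    have n: "(d \<odot>\<^bsub>Vn\<^esub> x) j = d \<odot> x j" if "j \<in> {1..n}" for x j using that by simp
    show "S (d \<odot>\<^bsub>Vn\<^esub> v) = d \<odot>\<^bsub>Vn\<^esub> S v"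
    proof (rule Vn_eqI[OF S_closed[OF dv] vs_smult_closed[OF Vn S_closed[OF v]]])
      fix j assume j: "j \<in> {1..n}"
      then show "S (d \<odot>\<^bsub>Vn\<^esub> v) j = (d \<odot>\<^bsub>Vn\<^esub> S v) j"
      proof (cases rule: position_cases)
        case 1
        show ?thesis unfolding n[OF j] unfolding 1 S_nth(1)[OF dv] S_nth(1)[OF v] n[OF ii(2)]
          using c closed by (simp add: l(3) l(6))
      next
        case 2
        show ?thesis unfolding n[OF j] unfolding 2 S_nth(2)[OF dv] S_nth(2)[OF v] n[OF ii(1)] n[OF ii(2)]
          using c closed
          by (simp add: l(3)[symmetric] l(9) a_minus_def vs_r_distr[OF V] vs_smult_minus[OF V])
      next
        case 3
        show ?thesis unfolding n[OF j] S_nth(3)[OF dv 3] S_nth(3)[OF v 3]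
          by (rule l(3)[OF Vn_nth[OF v j]])
      qed
    qed
  qed (rule S_closed)
qed

lemma W_iff: "u \<in> W j \<longleftrightarrow> u \<in> carrier V \<and> g j u = u" by (simp add: W_def)

lemma W_submodule: "j \<in> {1..n} \<Longrightarrow> submodule class_ring (W j) V"
  by (rule submoduleI[OF V])
     (auto simp: W_iff g_zero linD(2)[OF g] linD(3)[OF g] vs_smult_closed[OF V])

lemma s_W_far: "j \<in> far \<Longrightarrow> u \<in> W j \<Longrightarrow> s u \<in> W j"
  using s_g_far[of j u] by (auto simp: W_iff s_closed)

lemma s_W_i: "u \<in> W i \<Longrightarrow> s u \<in> W (Suc i)"
  using s_g[of u] by (auto simp: W_iff s_closed)

text \<open>If \<open>g\<^sub>i\<^sub>+\<^sub>1 u = u\<close> then \<open>g\<^sub>i (s g\<^sub>i u) = g\<^sub>i g\<^sub>i\<^sub>+\<^sub>1 s u = g\<^sub>i\<^sub>+\<^sub>1 s g\<^sub>i\<^sub>+\<^sub>1 u = s g\<^sub>i u\<close>.\<close>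
lemma sg_W_Suc: "u \<in> W (Suc i) \<Longrightarrow> s (g i u) \<in> W i"
  using s_g[of u] g_s_g[of u] by (auto simp: W_iff closed)

text \<open>Each of the \<open>n - 2\<close> components other than \<open>i\<close> and \<open>i + 1\<close> contributes one factor.\<close>
lemma char_poly_far_blocks:
  fixes H defines "H \<equiv> block_space n V (\<lambda>_. carrier V) far"
  shows "endo_char_poly (sub_space Vn H) S = endo_char_poly V s ^ (n - 2)"
    and "vectorspace.fin_dim class_ring (sub_space Vn H)"
proof -
  let ?U = "\<lambda>_ :: nat. carrier V"
  let ?B = "block_space n V ?U"
  have U: "submodule class_ring (carrier V) V"
    by (rule submoduleI[OF V]) (auto simp: vs_smult_closed[OF V])
  have sub: "submodule class_ring (?B I) Vn" for I by (rule block_space_submodule[OF V U])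
  have zz: "\<zero> \<ominus> \<zero> = \<zero>"
    by (simp only: a_minus_def A.r_neg A.zero_closed)
  have SI: "S w \<in> ?B ({} \<union> I')" if I': "I' \<subseteq> far" and w: "w \<in> ?B ({} \<union> I')" for I' w
  proof -
    have wc: "w \<in> carrier Vn" by (rule block_spaceD(1)[OF w])
    have z: "w j = \<zero>" if "j \<in> {1..n}" "j \<notin> I'" for j using block_spaceD(3)[OF w that(1)] that by simp
    have zi: "w i = \<zero>" "w (Suc i) = \<zero>"
      using z[OF ii(1)] z[OF ii(2)] I' by blast+
    have "S w j = \<zero>" if j: "j \<in> {1..n}" "j \<notin> I'" for j
      using j(1)
    proof (cases rule: position_cases)
      case 1 then show ?thesis by (simp only: S_nth(1)[OF wc] zi g_zero[OF ii(1)] s_zero)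
    next
      case 2 then show ?thesis by (simp add: S_nth(2)[OF wc] zi g_zero[OF ii(2)] s_zero zz)
    next
      case 3 then show ?thesis by (simp only: S_nth(3)[OF wc 3] z[OF j] s_zero)
    qed
    moreover have "S w j \<in> carrier V" if "j \<in> {1..n}" for j using Vn_nth[OF S_closed[OF wc] that] .
    ultimately show ?thesis using S_closed[OF wc] unfolding block_space_def by blast
  qed
  have B0: "?B {} = {\<zero>\<^bsub>Vn\<^esub>}"
  proof -
    have "w = \<zero>\<^bsub>Vn\<^esub>" if "w \<in> ?B {}" for w
    proof (rule Vn_eqI)
      show "w \<in> carrier Vn" by (rule block_spaceD(1)[OF that])
      show "\<zero>\<^bsub>Vn\<^esub> \<in> carrier Vn" using submoduleD(1,2)[OF Vn sub] by blast
      show "w j = \<zero>\<^bsub>Vn\<^esub> j" if "j \<in> {1..n}" for j using block_spaceD(3)[OF \<open>w \<in> ?B {}\<close> that] that by simp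
    qed
    with submoduleD(2)[OF Vn sub[of "{}"]] show ?thesis by blast
  qed
  have S0: "S \<in> lin (sub_space Vn (?B {})) (sub_space Vn (?B {}))"
    by (rule lin_sub_space[OF S_lin submodule.subset[OF sub]]) (use SI[of "{}"] in simp)
  note z = char_poly_zero_space[OF submodule_vs[OF Vn sub] _ S0]
  have cz: "carrier (sub_space Vn (?B {})) = {\<zero>\<^bsub>sub_space Vn (?B {})\<^esub>}" by (simp add: B0 del: power_space_simps)
  have far: "far \<subseteq> {1..n} - {}" by auto
  have Ss: "S w k = s (w k)" if "k \<in> far" "w \<in> carrier Vn" for k w using S_nth(3)[OF that(2,1)] .
  have sU: "s u \<in> carrier V" if "k \<in> far" "u \<in> carrier V" for k u using s_closed[OF that(2)] .
  note b = char_poly_blocks[where U = ?U and J = "{}", OF V fd U S_lin SI Ss s sU z(2)[OF cz] far]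
  have "card far = n - 2" using ii i by (simp add: card_Diff_subset)
  then show "endo_char_poly (sub_space Vn H) S = endo_char_poly V s ^ (n - 2)"
    using b(1) z(1)[OF cz] by (simp add: H_def)
  show "vectorspace.fin_dim class_ring (sub_space Vn H)" using b(2) by (simp add: H_def)
qed

text \<open>Two intertwining surjections onto \<open>V\<close> are used in turn: \<open>w \<mapsto> w\<^sub>i - g\<^sub>i\<^sub>+\<^sub>1 w\<^sub>i\<^sub>+\<^sub>1\<close>, which carries \<open>S\<close> to
  \<open>- s g\<^sub>i\<close>, and on its kernel \<open>w \<mapsto> w\<^sub>i\<^sub>+\<^sub>1\<close>, which carries \<open>S\<close> to \<open>s\<close>.\<close>
lemma char_poly_S:
  shows "endo_char_poly Vn S = endo_char_poly V s ^ (n - 1) * det_z_plus V (s \<circ> g i)"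
    and "vectorspace.fin_dim class_ring Vn"
proof -
  let ?U = "\<lambda>_ :: nat. carrier V"
  let ?B = "block_space n V ?U far"
  define p where "p w = w i \<ominus> g (Suc i) (w (Suc i))" for w
  define H where "H = {w \<in> carrier Vn. p w = \<zero>}"
  note l = linD[OF s] linD[OF g[OF ii(1)]] linD[OF g[OF ii(2)]]
  have sg: "s \<circ> g i \<in> lin V V" using lin_comp[OF g[OF ii(1)] s] by (simp add: comp_def)
  have p: "p \<in> lin Vn V"
  proof (rule linI)
    fix v assume "v \<in> carrier Vn"
    then show "p v \<in> carrier V" unfolding p_def using Vn_nth ii closed by simp
  next
    fix u v assume u: "u \<in> carrier Vn" and v: "v \<in> carrier Vn"
    note c = Vn_nth[OF u ii(1)] Vn_nth[OF u ii(2)] Vn_nth[OF v ii(1)] Vn_nth[OF v ii(2)]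
    have n: "(u \<oplus>\<^bsub>Vn\<^esub> v) j = u j \<oplus> v j" if "j \<in> {1..n}" for j using that by simp
    show "p (u \<oplus>\<^bsub>Vn\<^esub> v) = p u \<oplus> p v"
      unfolding p_def n[OF ii(1)] n[OF ii(2)] using c closed
      by (simp add: l(8) a_minus_def A.minus_add A.a_ac)
  next
    fix d v assume v: "v \<in> carrier Vn"
    note c = Vn_nth[OF v ii(1)] Vn_nth[OF v ii(2)]
    have n: "(d \<odot>\<^bsub>Vn\<^esub> v) j = d \<odot> v j" if "j \<in> {1..n}" for j using that by simp
    show "p (d \<odot>\<^bsub>Vn\<^esub> v) = d \<odot> p v"
      unfolding p_def n[OF ii(1)] n[OF ii(2)] using c closed
      by (simp add: l(9) a_minus_def vs_r_distr[OF V] vs_smult_minus[OF V])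
  qed
  have psurj: "p ` carrier Vn = carrier V"
  proof
    show "p ` carrier Vn \<subseteq> carrier V" using linD(1)[OF p] by blast
    show "carrier V \<subseteq> p ` carrier Vn"
    proof
      fix u assume u: "u \<in> carrier V"
      let ?w = "\<lambda>j\<in>{1..n}. if j = i then u else \<zero>"
      have "?w \<in> carrier Vn" using u by auto
      moreover have "p ?w = u" using u ii by (simp add: p_def g_zero a_minus_def)
      ultimately show "u \<in> p ` carrier Vn" by (metis imageI)
    qed
  qed
  \<comment> \<open>The operator that \<open>S\<close> induces on the image of \<open>p\<close>.\<close>
  define N where "N = (\<lambda>v. \<ominus> (s \<circ> g i) v)"
  have N: "N \<in> lin V V"
    unfolding N_def by (rule linI) (use linD[OF sg] in \<open>simp_all add: A.minus_add vs_smult_minus[OF V]\<close>)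
  have pN: "p (S w) = N (p w)" if w: "w \<in> carrier Vn" for w
  proof -
    let ?a = "w i" let ?b = "w (Suc i)" let ?g = "g (Suc i)"
    have c: "?a \<in> carrier V" "?b \<in> carrier V" using Vn_nth[OF w] ii by auto
    let ?f = "\<lambda>v. s (g i v)"
    have fc: "?f v \<in> carrier V" if "v \<in> carrier V" for v using that closed by simp
    have fm: "?f (u \<ominus> v) = ?f u \<ominus> ?f v" if "u \<in> carrier V" "v \<in> carrier V" for u v
      using lin_minus[OF V V sg that] by simp
    have fa: "?f (u \<oplus> v) = ?f u \<oplus> ?f v" if "u \<in> carrier V" "v \<in> carrier V" for u v
      using linD(2)[OF sg that] by simp
    have gb: "?g ?b \<in> carrier V" using c closed by simp
    have "p (S w) = ?f ?b \<ominus> ?f (?a \<oplus> (?b \<ominus> ?g ?b))"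
      unfolding p_def S_nth(1)[OF w] S_nth(2)[OF w] using s_g[of "?a \<oplus> (?b \<ominus> ?g ?b)"] c gb by simp
    also have "\<dots> = ?f ?b \<ominus> (?f ?a \<oplus> (?f ?b \<ominus> ?f (?g ?b)))"
      using c gb fa[of ?a "?b \<ominus> ?g ?b"] fm[of ?b "?g ?b"] by simp
    also have "\<dots> = \<ominus> (?f ?a \<ominus> ?f (?g ?b))"
      using fc[OF c(1)] fc[OF c(2)] fc[OF gb]
      by (simp add: a_minus_def A.minus_add A.a_ac A.r_neg1 A.r_neg2 A.cancel_past)
    also have "\<dots> = N (p w)" unfolding N_def p_def using fm[OF c(1) gb] by simp
    finally show ?thesis .
  qed
  have Hs: "submodule class_ring H Vn"
    using mod_hom.ker_is_submodule[OF lin_mod_hom[OF Vn V p]] mod_hom.ker_def[OF lin_mod_hom[OF Vn V p]]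
    by (simp add: H_def)
  have HX: "vectorspace class_ring (sub_space Vn H)" by (rule submodule_vs[OF Vn Hs])
  have wi: "w i = g (Suc i) (w (Suc i))" if "w \<in> H" for w
  proof -
    have "w \<in> carrier Vn" "p w = \<zero>" using that by (auto simp: H_def)
    then show ?thesis unfolding p_def using Vn_nth[of w] ii closed by simp
  qed
  have Hc: "w \<in> H \<Longrightarrow> w \<in> carrier Vn" for w by (simp add: H_def)
  have pSH: "S w \<in> H" if "w \<in> H" for w
    using that pN[of w] S_closed[of w] lin_zero[OF V V N] by (simp add: H_def del: power_space_simps)
  have SH: "S \<in> lin (sub_space Vn H) (sub_space Vn H)"
    by (rule lin_sub_space[OF S_lin submodule.subset[OF Hs] pSH])
  define q where "q w = w (Suc i)" for w :: "nat \<Rightarrow> 'v"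
  have q: "q \<in> lin (sub_space Vn H) V"
    by (rule linI) (use Vn_nth[OF Hc ii(2)] ii in \<open>auto simp: q_def\<close>)
  have qsurj: "q ` carrier (sub_space Vn H) = carrier V"
  proof
    show "q ` carrier (sub_space Vn H) \<subseteq> carrier V" using linD(1)[OF q] by blast
    show "carrier V \<subseteq> q ` carrier (sub_space Vn H)"
    proof
      fix u assume u: "u \<in> carrier V"
      let ?w = "\<lambda>j\<in>{1..n}. if j = i then g (Suc i) u else if j = Suc i then u else \<zero>"
      have "?w \<in> carrier Vn" using u gi_closed(2)[OF u] by auto
      moreover have "p ?w = \<zero>" using u ii gi_closed(2)[OF u] by (simp add: p_def a_minus_def A.r_neg)
      ultimately have "?w \<in> H" by (simp add: H_def)
      moreover have "q ?w = u" using ii by (simp add: q_def)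
      ultimately show "u \<in> q ` carrier (sub_space Vn H)" by force
    qed
  qed
  have qker: "?B = {w \<in> carrier (sub_space Vn H). q w = \<zero>}"
  proof -
    have "w \<in> H \<and> q w = \<zero>" if w: "w \<in> ?B" for w
    proof -
      have z: "w i = \<zero>" "w (Suc i) = \<zero>" using block_spaceD(3)[OF w] ii by auto
      then have "p w = \<zero>" unfolding p_def by (simp add: g_zero[OF ii(2)])
      then show ?thesis using z block_spaceD(1)[OF w] by (simp add: H_def q_def del: power_space_simps)
    qed
    moreover have "w \<in> ?B" if w: "w \<in> H" "q w = \<zero>" for w
    proof -
      have "w (Suc i) = \<zero>" "w i = \<zero>" using w wi[OF w(1)] g_zero[OF ii(2)] by (simp_all add: q_def)
      then show ?thesis using Hc[OF w(1)] Vn_nth[OF Hc[OF w(1)]] unfolding block_space_def by auto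
    qed
    ultimately show ?thesis by auto
  qed
  have qS: "q (S w) = s (q w)" if "w \<in> carrier (sub_space Vn H)" for w
  proof -
    have w: "w \<in> H" using that by simp
    let ?b = "w (Suc i)"
    have c: "?b \<in> carrier V" "g (Suc i) ?b \<in> carrier V" using Vn_nth[OF Hc[OF w] ii(2)] closed by auto
    have "q (S w) = s (g (Suc i) ?b \<oplus> (?b \<ominus> g (Suc i) ?b))"
      unfolding q_def S_nth(2)[OF Hc[OF w]] wi[OF w] ..
    also have "\<dots> = s ?b" using c by (simp add: a_minus_def A.cancel_past)
    finally show ?thesis by (simp add: q_def)
  qed
  have fdB: "vectorspace.fin_dim class_ring (sub_space (sub_space Vn H) ?B)"
    using char_poly_far_blocks(2) by simp
  note e1 = char_poly_exact[where V = "sub_space Vn H" and Y = V and p = q and U = ?B and T = S and T' = s,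
    OF HX V q qsurj qker SH s qS fdB fd]
  note e2 = char_poly_exact[where V = Vn and Y = V and p = p and U = H and T = S and T' = N,
    OF Vn V p psurj H_def S_lin N pN e1(2) fd]
  show "vectorspace.fin_dim class_ring Vn" by (rule e2(2))
  have "endo_char_poly Vn S = endo_char_poly V s ^ (n - 2) * endo_char_poly V s * endo_char_poly V N"
    using e1(1) e2(1) char_poly_far_blocks(1) by simp
  also have "endo_char_poly V s ^ (n - 2) * endo_char_poly V s = endo_char_poly V s ^ (n - 1)"
  proof -
    have "n - 1 = Suc (n - 2)" using i by auto
    then show ?thesis by simp
  qed
  also have "endo_char_poly V N = det_z_plus V (s \<circ> g i)"
    unfolding N_def by (rule det_z_plus_char_poly[OF V sg fd, symmetric])
  finally show "endo_char_poly Vn S = endo_char_poly V s ^ (n - 1) * det_z_plus V (s \<circ> g i)" .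
qed

abbreviation K :: "(nat \<Rightarrow> 'v) set" where "K \<equiv> block_space n V W {1..n}"

lemma S_block_W:
  assumes I': "I' \<subseteq> far" and w: "w \<in> block_space n V W ({i, Suc i} \<union> I')"
  shows "S w \<in> block_space n V W ({i, Suc i} \<union> I')"
proof -
  have wc: "w \<in> carrier Vn" by (rule block_spaceD(1)[OF w])
  have wi: "w i \<in> W i" "w (Suc i) \<in> W (Suc i)" using block_spaceD(2)[OF w] ii by auto
  have "(j \<in> {i, Suc i} \<union> I' \<longrightarrow> S w j \<in> W j) \<and> (j \<notin> {i, Suc i} \<union> I' \<longrightarrow> S w j = \<zero>)"
    if j: "j \<in> {1..n}" for j
    using j
  proof (cases rule: position_cases)
    case 1
    then show ?thesis using sg_W_Suc[OF wi(2)] S_nth(1)[OF wc] by simp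
  next
    case 2
    have "w (Suc i) \<in> carrier V" "w i \<in> carrier V" "g (Suc i) (w (Suc i)) = w (Suc i)" using wi by (auto simp: W_iff)
    then have "S w (Suc i) = s (w i)" using S_nth(2)[OF wc] by (simp add: a_minus_def A.r_neg)
    with 2 show ?thesis using s_W_i[OF wi(1)] by simp
  next
    case 3
    have "S w j = s (w j)" by (rule S_nth(3)[OF wc 3])
    moreover have "s (w j) \<in> W j" if "j \<in> I'" using s_W_far[OF 3] block_spaceD(2)[OF w j] that by blast
    moreover have "s (w j) = \<zero>" if "j \<notin> {i, Suc i} \<union> I'" using block_spaceD(3)[OF w j that] s_zero by simp
    ultimately show ?thesis using 3 by auto
  qed
  then show ?thesis using S_closed[OF wc] unfolding block_space_def by blast
qed

text \<open>Here \<open>S (a, b) = (s g\<^sub>i b, s a)\<close>, because \<open>b - g\<^sub>i\<^sub>+\<^sub>1 b = 0\<close> on \<open>W\<^sub>i\<^sub>+\<^sub>1\<close>. Identifying \<open>W\<^sub>i\<^sub>+\<^sub>1\<close> with \<open>W\<^sub>i\<close> through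
  \<open>s\<close> makes this the swap \<open>(a, b) \<mapsto> (s g\<^sub>i s b, a)\<close>.\<close>
lemma char_poly_pair:
  defines "Y \<equiv> sub_space Vn (block_space n V W {i, Suc i})"
  shows "endo_char_poly Y S = det_z2_minus (sub_space V (W i)) (s \<circ> g i \<circ> s)"
    and "vectorspace.fin_dim class_ring Y"
proof -
  let ?B = "block_space n V W {i, Suc i}" let ?X = "sub_space V (W i)"
  have Bs: "submodule class_ring ?B Vn" by (rule block_space_submodule[OF V W_submodule])
  have Y: "vectorspace class_ring Y" unfolding Y_def by (rule submodule_vs[OF Vn Bs])
  have X: "vectorspace class_ring ?X" by (rule submodule_vs[OF V W_submodule[OF ii(1)]])
  have fdX: "vectorspace.fin_dim class_ring ?X" by (rule submodule_fin_dim[OF V fd W_submodule[OF ii(1)]])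
  \<comment> \<open>The vector with components \<open>a\<close> and \<open>b\<close> in the positions \<open>i\<close> and \<open>i + 1\<close>.\<close>
  define pr where "pr a b = (\<lambda>j\<in>{1..n}. if j = i then a else if j = Suc i then b else \<zero>)" for a b
  have pr_nth: "pr a b i = a" "pr a b (Suc i) = b" "j \<in> far \<Longrightarrow> pr a b j = \<zero>" for a b j
    using ii by (auto simp: pr_def)
  have pr_B: "pr a b \<in> ?B" if "a \<in> W i" "b \<in> W (Suc i)" for a b
    using that by (auto simp: pr_def block_space_def W_iff)
  have pr_add: "pr a b \<oplus>\<^bsub>Vn\<^esub> pr a' b' = pr (a \<oplus> a') (b \<oplus> b')" for a b a' b'
    by (auto simp: pr_def fun_eq_iff)
  have pr_smult: "d \<odot>\<^bsub>Vn\<^esub> pr a b = pr (d \<odot> a) (d \<odot> b)" for d a b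
    by (auto simp: pr_def fun_eq_iff vs_smult_zero[OF V])
  have zW: "\<zero> \<in> W j" if "j \<in> {1..n}" for j by (rule submoduleD(2)[OF V W_submodule[OF that]])
  have Wc: "a \<in> W j \<Longrightarrow> a \<in> carrier V" for a j by (simp add: W_iff)
  let ?j1 = "\<lambda>a. pr a \<zero>" let ?j2 = "\<lambda>a. pr \<zero> (s a)"
  have Y_ops: "carrier Y = ?B" "u \<oplus>\<^bsub>Y\<^esub> v = u \<oplus>\<^bsub>Vn\<^esub> v" "d \<odot>\<^bsub>Y\<^esub> v = d \<odot>\<^bsub>Vn\<^esub> v" for u v d
    by (simp_all add: Y_def del: power_space_simps)
  have j1: "?j1 \<in> lin ?X Y"
  proof (rule linI)
    show "?j1 a \<in> carrier Y" if "a \<in> carrier ?X" for a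
      unfolding Y_ops using that by (intro pr_B zW ii) simp
    show "?j1 (a \<oplus>\<^bsub>?X\<^esub> a') = ?j1 a \<oplus>\<^bsub>Y\<^esub> ?j1 a'" for a a' unfolding Y_ops pr_add by simp
    show "?j1 (d \<odot>\<^bsub>?X\<^esub> a) = d \<odot>\<^bsub>Y\<^esub> ?j1 a" for d a unfolding Y_ops pr_smult by (simp add: vs_smult_zero[OF V])
  qed
  have j2: "?j2 \<in> lin ?X Y"
  proof (rule linI)
    show "?j2 a \<in> carrier Y" if "a \<in> carrier ?X" for a
      unfolding Y_ops using that by (intro pr_B zW ii s_W_i) simp
    show "?j2 (a \<oplus>\<^bsub>?X\<^esub> a') = ?j2 a \<oplus>\<^bsub>Y\<^esub> ?j2 a'" if "a \<in> carrier ?X" "a' \<in> carrier ?X" for a a'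
      unfolding Y_ops pr_add using that Wc by (simp add: linD(2)[OF s])
    show "?j2 (d \<odot>\<^bsub>?X\<^esub> a) = d \<odot>\<^bsub>Y\<^esub> ?j2 a" if "a \<in> carrier ?X" for d a
      unfolding Y_ops pr_smult using that Wc by (simp add: vs_smult_zero[OF V] linD(3)[OF s])
  qed
  have SY: "S \<in> lin Y Y" unfolding Y_def
    by (rule lin_sub_space[OF S_lin submodule.subset[OF Bs]]) (use S_block_W[of "{}"] in simp)
  have fl: "s \<circ> g i \<circ> s \<in> lin V V"
    using lin_comp[OF s lin_comp[OF g[OF ii(1)] s]] by (simp add: comp_def)
  have fW: "(s \<circ> g i \<circ> s) a \<in> W i" if "a \<in> W i" for a using sg_W_Suc[OF s_W_i[OF that]] by simp
  have f: "s \<circ> g i \<circ> s \<in> lin ?X ?X"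
    by (rule lin_sub_space[OF fl submodule.subset[OF W_submodule[OF ii(1)]] fW])
  have pr_inj: "a = a' \<and> b = b'" if "pr a b = pr a' b'" for a b a' b'
    using that pr_nth(1,2) by metis
  have zero: "\<zero>\<^bsub>Y\<^esub> = pr \<zero> \<zero>" by (auto simp: Y_def pr_def fun_eq_iff)
  have plus: "?j1 a \<oplus>\<^bsub>Y\<^esub> ?j2 b = pr a (s b)" if "a \<in> W i" "b \<in> W i" for a b
    using pr_add[of a "\<zero>" "\<zero>" "s b"] Wc[OF that(1)] s_closed[OF Wc[OF that(2)]]
    by (simp add: Y_def del: power_space_simps)
  have inj: "a = \<zero>\<^bsub>?X\<^esub> \<and> b = \<zero>\<^bsub>?X\<^esub>"
    if ab: "a \<in> carrier ?X" "b \<in> carrier ?X" "?j1 a \<oplus>\<^bsub>Y\<^esub> ?j2 b = \<zero>\<^bsub>Y\<^esub>" for a b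
  proof -
    have "pr a (s b) = pr \<zero> \<zero>" using ab plus zero by simp
    from pr_inj[OF this] have "a = \<zero>" "s b = s \<zero>" by (auto simp: s_zero)
    then show ?thesis using s_inj[of b "\<zero>"] ab(2) Wc by simp
  qed
  have pr_ext: "w = pr (w i) (w (Suc i))" if "w \<in> ?B" for w
  proof (rule Vn_eqI)
    show "w \<in> carrier Vn" by (rule block_spaceD(1)[OF that])
    have "w i \<in> W i" "w (Suc i) \<in> W (Suc i)" using block_spaceD(2)[OF that] ii by auto
    then show "pr (w i) (w (Suc i)) \<in> carrier Vn" using block_spaceD(1)[OF pr_B] by blast
    show "w j = pr (w i) (w (Suc i)) j" if "j \<in> {1..n}" for j
      using that
    proof (cases rule: position_cases)
      case 3 then show ?thesis using block_spaceD(3)[OF \<open>w \<in> ?B\<close> that] pr_nth(3)[OF 3] by auto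
    qed (simp_all add: pr_nth)
  qed
  have surj: "\<exists>a\<in>carrier ?X. \<exists>b\<in>carrier ?X. y = ?j1 a \<oplus>\<^bsub>Y\<^esub> ?j2 b" if "y \<in> carrier Y" for y
  proof -
    have yB: "y \<in> ?B" using that by (simp add: Y_def)
    then have y: "y i \<in> W i" "y (Suc i) \<in> W (Suc i)" using block_spaceD(2)[OF yB] ii by auto
    obtain b where b: "b \<in> carrier V" "s b = y (Suc i)"
      using s_bij Wc[OF y(2)] by (metis bij_betw_imp_surj_on imageE)
    have "s (g i b) = s b" using s_g[OF b(1)] b(2) y(2) by (simp add: W_iff)
    then have "b \<in> W i" using s_inj[of "g i b" b] b closed by (simp add: W_iff)
    then show ?thesis using y pr_ext[OF yB] b plus by force
  qed
  have S_pr: "S (pr a b) = pr (s (g i b)) (s a)" if ab: "a \<in> W i" "b \<in> W (Suc i)" for a b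
  proof -
    have m: "pr a b \<in> ?B" by (rule pr_B[OF ab])
    have c: "pr a b \<in> carrier Vn" by (rule block_spaceD(1)[OF m])
    have SB: "S (pr a b) \<in> ?B" using S_block_W[of "{}" "pr a b"] m by simp
    have "S (pr a b) (Suc i) = s a"
      using S_nth(2)[OF c] ab by (simp add: pr_nth W_iff a_minus_def A.r_neg)
    then show ?thesis using pr_ext[OF SB] S_nth(1)[OF c] by (simp add: pr_nth)
  qed
  have T1: "S (?j1 a) = ?j2 a" if "a \<in> carrier ?X" for a
    using S_pr[of a "\<zero>"] that zW[OF ii(2)] by (simp add: g_zero[OF ii(1)] s_zero)
  have T2: "S (?j2 a) = ?j1 ((s \<circ> g i \<circ> s) a)" if "a \<in> carrier ?X" for a
    using S_pr[of "\<zero>" "s a"] that zW[OF ii(1)] s_W_i by (simp add: s_zero)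
  note d = det_z2_minus_char_poly[where W = ?X and Y = Y and f = "s \<circ> g i \<circ> s" and ?j1.0 = ?j1 and ?j2.0 = ?j2 and T = S,
    OF X Y fdX f j1 j2 SY inj surj T1 T2]
  show "endo_char_poly Y S = det_z2_minus ?X (s \<circ> g i \<circ> s)" by (rule d(1))
  show "vectorspace.fin_dim class_ring Y" by (rule d(2))
qed

lemma K_submodule: "submodule class_ring K Vn"
  by (rule block_space_submodule[OF V W_submodule])

lemma pair_far: "{i, Suc i} \<union> far = {1..n}" using ii by auto

lemma S_K: "w \<in> K \<Longrightarrow> S w \<in> K"
  using S_block_W[of far w] unfolding pair_far by blast

lemma char_poly_K:
  "endo_char_poly (sub_space Vn K) S =
    (\<Prod>k\<in>far. endo_char_poly (sub_space V (W k)) s) * det_z2_minus (sub_space V (W i)) (s \<circ> g i \<circ> s)"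
proof -
  have far: "far \<subseteq> {1..n} - {i, Suc i}" by auto
  have Ss: "S w k = s (w k)" if "k \<in> far" "w \<in> carrier Vn" for k w using S_nth(3)[OF that(2,1)] .
  have "endo_char_poly (sub_space Vn (block_space n V W ({i, Suc i} \<union> far))) S =
      endo_char_poly (sub_space Vn (block_space n V W {i, Suc i})) S * (\<Prod>k\<in>far. endo_char_poly (sub_space V (W k)) s)"
    by (rule char_poly_blocks(1)[OF V fd W_submodule S_lin S_block_W Ss s s_W_far char_poly_pair(2) far])
  then show ?thesis unfolding pair_far char_poly_pair(1) by (simp add: mult.commute)
qed

end

section \<open>The common fixed space and the quotient\<close>

context klm_data begin

interpretation A: abelian_group V by (rule vs_group[OF V])

abbreviation LMx :: "nat \<Rightarrow> (nat \<Rightarrow> 'v) \<Rightarrow> nat \<Rightarrow> 'v" where "LMx \<equiv> LM_x n V g lam"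

definition L :: "(nat \<Rightarrow> 'v) set" where "L = (\<Inter>j\<in>{1..n}. eigenspace Vn (LMx j) 1)"

text \<open>The contribution of the component \<open>l\<close> to the \<open>j\<close>-th block row of the operator of \<open>x\<^sub>j\<close>.\<close>
definition entry :: "(nat \<Rightarrow> 'v) \<Rightarrow> nat \<Rightarrow> nat \<Rightarrow> 'v" where
  "entry w j l = (if l < j then lam \<odot> (g l (w l) \<ominus> w l)
     else if l = j then lam \<odot> g l (w l) else g l (w l) \<ominus> w l)"

definition row_sum :: "(nat \<Rightarrow> 'v) \<Rightarrow> nat \<Rightarrow> 'v" where
  "row_sum w j = (\<Oplus> l\<in>{1..n}. entry w j l)"

text \<open>The product \<open>g\<^sub>j \<cdots> g\<^sub>n\<close>; for \<open>j = n + 1\<close> it is the identity.\<close>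
definition tail_prod :: "nat \<Rightarrow> 'v \<Rightarrow> 'v" where "tail_prod j = foldr g [j..<Suc n]"

definition E :: "'v set" where "E = {v \<in> carrier V. lam \<odot> tail_prod 1 v = v}"

lemma entry_closed:
  assumes "w \<in> carrier Vn" "l \<in> {1..n}"
  shows "entry w j l \<in> carrier V"
  using Vn_nth[OF assms] g_closed[OF assms(2) Vn_nth[OF assms]]
  by (auto simp: entry_def vs_smult_closed[OF V])

lemma LMx_eq: "w \<in> carrier Vn \<Longrightarrow> j \<in> {1..n} \<Longrightarrow> LMx j w = (\<lambda>k\<in>{1..n}. if k = j then row_sum w j else w k)"
proof -
  assume w: "w \<in> carrier Vn" and j: "j \<in> {1..n}"
  have "row_sum w j = (\<Oplus>l\<in>{1..n}. if l < j then lam \<odot> (g l (w l) \<ominus> w l)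
          else if l = j then lam \<odot> g j (w j) else g l (w l) \<ominus> w l)"
    unfolding row_sum_def
  proof (rule A.finsum_cong'[symmetric])
    fix l assume "l \<in> {1..n}"
    show "(if l < j then lam \<odot> (g l (w l) \<ominus> w l)
          else if l = j then lam \<odot> g j (w j) else g l (w l) \<ominus> w l) = entry w j l"
      by (simp add: entry_def)
  qed (use entry_closed[OF w] in auto)
  then show ?thesis by (simp only: LM_x_def restrict_apply'[OF w])
qed

lemma row_sum_closed: "w \<in> carrier Vn \<Longrightarrow> row_sum w j \<in> carrier V"
  unfolding row_sum_def by (rule A.finsum_closed) (use entry_closed in auto)

lemma L_rows: "w \<in> L \<longleftrightarrow> w \<in> carrier Vn \<and> (\<forall>j\<in>{1..n}. row_sum w j = w j)"
proof -
  have cl: "LMx j w \<in> carrier Vn" if "w \<in> carrier Vn" "j \<in> {1..n}" for w j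
    unfolding LMx_eq[OF that] using Vn_nth[OF that(1)] row_sum_closed[OF that(1)] by auto
  have fixed: "LMx j w = w \<longleftrightarrow> row_sum w j = w j" if w: "w \<in> carrier Vn" and j: "j \<in> {1..n}" for w j
  proof
    assume "LMx j w = w"
    from fun_cong[OF this, of j] show "row_sum w j = w j" unfolding LMx_eq[OF w j] using j by simp
  next
    assume "row_sum w j = w j"
    then show "LMx j w = w" by (intro Vn_eqI[OF cl[OF w j] w]) (simp add: LMx_eq[OF w j])
  qed
  have "eigenspace Vn (LMx j) 1 = {w \<in> carrier Vn. LMx j w = w}" if "j \<in> {1..n}" for j
    by (rule eigenspace_one_iff[OF Vn cl[OF _ that]])
  then have "L = (\<Inter>j\<in>{1..n}. {w \<in> carrier Vn. LMx j w = w})" unfolding L_def by auto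
  moreover have "{1..n} \<noteq> {}" using ii by auto
  ultimately show ?thesis using fixed by auto
qed

text \<open>The rows \<open>j\<close> and \<open>j + 1\<close> have the same entries except in the columns \<open>j\<close> and \<open>j + 1\<close>. If the equation
  for \<open>j\<close> holds, the left-hand side of the next one is \<open>w\<^sub>j\<^sub>+\<^sub>1 + (1 - \<lambda>) (w\<^sub>j - g\<^sub>j\<^sub>+\<^sub>1 w\<^sub>j\<^sub>+\<^sub>1)\<close>, and \<open>1 - \<lambda>\<close> is
  invertible.\<close>
lemma consecutive_rows:
  assumes w: "w \<in> carrier Vn" and j: "j \<in> {1..<n}" and r: "row_sum w j = w j"
  shows "row_sum w (Suc j) = w (Suc j) \<longleftrightarrow> w j = g (Suc j) (w (Suc j))"
proof -
  have jj: "j \<in> {1..n}" "Suc j \<in> {1..n}" using j by auto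
  let ?R = "{1..n} - {j, Suc j}"
  have dec: "{1..n} = insert j (insert (Suc j) ?R)" using jj by auto
  \<comment> \<open>The part of the row outside these two columns is common to both rows.\<close>
  define R where "R = (\<Oplus> l\<in>?R. entry w j l)"
  have ec: "entry w k l \<in> carrier V" if "l \<in> {1..n}" for k l by (rule entry_closed[OF w that])
  have Rc: "R \<in> carrier V" unfolding R_def by (rule A.finsum_closed) (use ec in auto)
  have rs: "row_sum w k = entry w k j \<oplus> (entry w k (Suc j) \<oplus> (\<Oplus> l\<in>?R. entry w k l))" for k
  proof -
    have "row_sum w k = (\<Oplus> l\<in>insert j (insert (Suc j) ?R). entry w k l)"
      unfolding row_sum_def using dec by simp
    also have "\<dots> = entry w k j \<oplus> (\<Oplus> l\<in>insert (Suc j) ?R. entry w k l)"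
      by (rule A.finsum_insert) (use ec jj in auto)
    also have "(\<Oplus> l\<in>insert (Suc j) ?R. entry w k l) = entry w k (Suc j) \<oplus> (\<Oplus> l\<in>?R. entry w k l)"
      by (rule A.finsum_insert) (use ec jj in auto)
    finally show ?thesis .
  qed
  have same: "(\<Oplus> l\<in>?R. entry w (Suc j) l) = R"
    unfolding R_def by (rule A.finsum_cong') (use ec in \<open>auto simp: entry_def\<close>)
  define u v x y where "u = w j" and "v = w (Suc j)" and "x = lam \<odot> g j u" and "y = g (Suc j) v"
  have uv: "u \<in> carrier V" "v \<in> carrier V" using Vn_nth[OF w] jj by (auto simp: u_def v_def)
  have gu: "g j u \<in> carrier V" and y: "y \<in> carrier V" using g_closed jj uv by (simp_all add: y_def del: atLeastAtMost_iff)
  have x: "x \<in> carrier V" using gu by (simp add: x_def vs_smult_closed[OF V])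
  have e: "entry w j j = x" "entry w j (Suc j) = y \<ominus> v"
    "entry w (Suc j) j = lam \<odot> (g j u \<ominus> u)" "entry w (Suc j) (Suc j) = lam \<odot> y"
    by (simp_all add: entry_def x_def y_def u_def v_def)
  note sm = vs_smult_closed[OF V]
  have r1: "x \<oplus> (y \<ominus> v \<oplus> R) = u" using r unfolding rs e R_def[symmetric] u_def[symmetric] .
  have Ru: "R = \<ominus> (y \<ominus> v) \<oplus> (\<ominus> x \<oplus> u)"
    unfolding r1[symmetric] using x y uv Rc by (simp add: A.r_neg1 a_minus_def)
  have "row_sum w (Suc j) = lam \<odot> (g j u \<ominus> u) \<oplus> (lam \<odot> y \<oplus> R)"
    unfolding rs same e ..
  also have "lam \<odot> (g j u \<ominus> u) = x \<oplus> \<ominus> (lam \<odot> u)"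
    using gu uv by (simp add: a_minus_def vs_r_distr[OF V] vs_smult_minus[OF V] x_def)
  also have "x \<oplus> \<ominus> (lam \<odot> u) \<oplus> (lam \<odot> y \<oplus> R) =
      v \<oplus> ((u \<ominus> y) \<oplus> (\<ominus> (lam \<odot> u) \<oplus> lam \<odot> y))"
    unfolding Ru using x y uv sm[OF uv(1), of lam] sm[OF y, of lam]
    by (simp add: a_minus_def A.minus_add A.a_ac A.r_neg1 A.r_neg2 A.cancel_past)
  also have "(u \<ominus> y) \<oplus> (\<ominus> (lam \<odot> u) \<oplus> lam \<odot> y) = (1 - lam) \<odot> (u \<ominus> y)"
  proof -
    have uy: "u \<ominus> y \<in> carrier V" using uv y by simp
    have "(1 - lam) \<odot> (u \<ominus> y) = (u \<ominus> y) \<oplus> \<ominus> (lam \<odot> (u \<ominus> y))"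
      using vs_l_distr[OF V uy, of 1 "- lam"] vs_minus_smult[OF V uy, of lam] vs_one[OF V uy] by simp
    also have "lam \<odot> (u \<ominus> y) = lam \<odot> u \<oplus> \<ominus> (lam \<odot> y)"
      using uv y by (simp add: a_minus_def vs_r_distr[OF V] vs_smult_minus[OF V])
    also have "\<ominus> (lam \<odot> u \<oplus> \<ominus> (lam \<odot> y)) = \<ominus> (lam \<odot> u) \<oplus> lam \<odot> y"
      using sm[OF uv(1), of lam] sm[OF y, of lam] by (simp add: A.minus_add)
    finally show ?thesis by simp
  qed
  finally have rS: "row_sum w (Suc j) = v \<oplus> (1 - lam) \<odot> (u \<ominus> y)" .
  have uy: "u \<ominus> y \<in> carrier V" using uv y by simp
  have "row_sum w (Suc j) = v \<longleftrightarrow> (1 - lam) \<odot> (u \<ominus> y) = \<zero>"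
    unfolding rS using uv sm[OF uy] A.add.l_cancel_one by simp
  also have "\<dots> \<longleftrightarrow> u \<ominus> y = \<zero>"
  proof
    assume "(1 - lam) \<odot> (u \<ominus> y) = \<zero>"
    then have "inverse (1 - lam) \<odot> ((1 - lam) \<odot> (u \<ominus> y)) = \<zero>" by (simp add: vs_smult_zero[OF V])
    then show "u \<ominus> y = \<zero>"
      using vs_assoc[OF V uy, of "inverse (1 - lam)" "1 - lam"] lam1 by (simp add: vs_one[OF V uy])
  qed (simp add: vs_smult_zero[OF V])
  also have "\<dots> \<longleftrightarrow> u = y" using uv y by simp
  finally show ?thesis unfolding u_def v_def y_def .
qed

lemma telescope:
  assumes w: "w \<in> carrier Vn" and m: "1 \<le> m" "m \<le> n"
  shows "(\<Oplus> l\<in>{2..m}. w (l - 1) \<ominus> w l) = w 1 \<ominus> w m"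
  using m
proof (induction m rule: nat_induct_at_least)
  case base
  have "w 1 \<in> carrier V" using Vn_nth[OF w, of 1] base by simp
  then show ?case by (simp add: a_minus_def A.r_neg)
next
  case (Suc m)
  have c: "w l \<in> carrier V" if "1 \<le> l" "l \<le> Suc m" for l using Vn_nth[OF w, of l] that Suc.prems by simp
  have "{2..Suc m} = insert (Suc m) {2..m}" using Suc.hyps by auto
  then have "(\<Oplus> l\<in>{2..Suc m}. w (l - 1) \<ominus> w l) =
      (\<Oplus> l\<in>insert (Suc m) {2..m}. w (l - 1) \<ominus> w l)" by simp
  also have "\<dots> = (w (Suc m - 1) \<ominus> w (Suc m)) \<oplus> (\<Oplus> l\<in>{2..m}. w (l - 1) \<ominus> w l)"
    by (rule A.finsum_insert) (use Suc.hyps c in \<open>auto intro!: A.minus_closed\<close>)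
  also have "\<dots> = (w m \<ominus> w (Suc m)) \<oplus> (w 1 \<ominus> w m)" using Suc.IH Suc.prems by simp
  also have "\<dots> = w 1 \<ominus> w (Suc m)" using c[of 1] c[of m] c[of "Suc m"] Suc.hyps
    by (simp add: a_minus_def A.a_ac A.r_neg1 A.r_neg2 A.cancel_past)
  finally show ?case .
qed

text \<open>Along the chain \<open>g\<^sub>l w\<^sub>l - w\<^sub>l = w\<^sub>l\<^sub>-\<^sub>1 - w\<^sub>l\<close>, so the first row telescopes to
  \<open>\<lambda> g\<^sub>1 w\<^sub>1 + w\<^sub>1 - w\<^sub>n\<close>.\<close>
lemma first_row:
  assumes w: "w \<in> carrier Vn" and ch: "\<And>j. j \<in> {1..<n} \<Longrightarrow> w j = g (Suc j) (w (Suc j))"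
  shows "row_sum w 1 = w 1 \<longleftrightarrow> lam \<odot> g 1 (w 1) = w n"
proof -
  have n1: "1 \<in> {1..n}" "n \<in> {1..n}" using i by auto
  have c: "w 1 \<in> carrier V" "w n \<in> carrier V" using Vn_nth[OF w] n1 by blast+
  have gc: "lam \<odot> g 1 (w 1) \<in> carrier V" by (rule vs_smult_closed[OF V g_closed[OF n1(1) c(1)]])
  have ec: "entry w k l \<in> carrier V" if "l \<in> {1..n}" for k l by (rule entry_closed[OF w that])
  have wc: "w l \<in> carrier V" if "1 \<le> l" "l \<le> n" for l using Vn_nth[OF w, of l] that by simp
  have "{1..n} = insert 1 {2..n}" using n1 by auto
  then have "row_sum w 1 = (\<Oplus> l\<in>insert 1 {2..n}. entry w 1 l)" by (simp add: row_sum_def)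
  also have "\<dots> = entry w 1 1 \<oplus> (\<Oplus> l\<in>{2..n}. entry w 1 l)"
    by (rule A.finsum_insert) (use ec n1 in auto)
  also have "(\<Oplus> l\<in>{2..n}. entry w 1 l) = (\<Oplus> l\<in>{2..n}. w (l - 1) \<ominus> w l)"
  proof (rule A.finsum_cong')
    fix l assume l: "l \<in> {2..n}"
    then obtain k where k: "l = Suc k" "k \<in> {1..<n}" by (cases l) auto
    then have "w (l - 1) = g l (w l)" using ch[OF k(2)] by simp
    then show "entry w 1 l = w (l - 1) \<ominus> w l" using l by (simp add: entry_def)
  qed (use wc in auto)
  also have "\<dots> = w 1 \<ominus> w n" by (rule telescope[OF w]) (use n1 in auto)
  also have "entry w 1 1 = lam \<odot> g 1 (w 1)" by (simp add: entry_def)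
  finally have r: "row_sum w 1 = lam \<odot> g 1 (w 1) \<oplus> (w 1 \<ominus> w n)" .
  also have "\<dots> = w 1 \<oplus> (lam \<odot> g 1 (w 1) \<ominus> w n)" using c gc by (simp add: a_minus_def A.a_ac)
  finally have r: "row_sum w 1 = w 1 \<oplus> (lam \<odot> g 1 (w 1) \<ominus> w n)" .
  have d: "lam \<odot> g 1 (w 1) \<ominus> w n \<in> carrier V" using gc c by (simp only: A.minus_closed)
  have "row_sum w 1 = w 1 \<longleftrightarrow> lam \<odot> g 1 (w 1) \<ominus> w n = \<zero>"
    unfolding r using A.add.l_cancel_one[OF c(1) d] by simp
  also have "\<dots> \<longleftrightarrow> lam \<odot> g 1 (w 1) = w n" using gc c by (simp only: A.minus_other_side)
  finally show ?thesis .
qed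

lemma L_chain:
  "w \<in> L \<longleftrightarrow> w \<in> carrier Vn \<and> (\<forall>j\<in>{1..<n}. w j = g (Suc j) (w (Suc j))) \<and> lam \<odot> g 1 (w 1) = w n"
proof (cases "w \<in> carrier Vn")
  case w: True
  have "(\<forall>j\<in>{1..n}. row_sum w j = w j) \<longleftrightarrow>
      (\<forall>j\<in>{1..<n}. w j = g (Suc j) (w (Suc j))) \<and> row_sum w 1 = w 1"
  proof
    assume r: "\<forall>j\<in>{1..n}. row_sum w j = w j"
    have "w j = g (Suc j) (w (Suc j))" if "j \<in> {1..<n}" for j
      using consecutive_rows[OF w that] r that by auto
    with r i show "(\<forall>j\<in>{1..<n}. w j = g (Suc j) (w (Suc j))) \<and> row_sum w 1 = w 1" by auto
  next
    assume c: "(\<forall>j\<in>{1..<n}. w j = g (Suc j) (w (Suc j))) \<and> row_sum w 1 = w 1"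
    have "j \<le> n \<longrightarrow> row_sum w j = w j" if "1 \<le> j" for j
      using that
    proof (induction j rule: nat_induct_at_least)
      case base
      then show ?case using c by simp
    next
      case (Suc j)
      then show ?case using consecutive_rows[OF w, of j] c by auto
    qed
    then show "\<forall>j\<in>{1..n}. row_sum w j = w j" by auto
  qed
  then show ?thesis unfolding L_rows using first_row[OF w] w by blast
next
  case False
  then show ?thesis unfolding L_rows by blast
qed

lemma tail_prod_step: "j \<le> n \<Longrightarrow> tail_prod j v = g j (tail_prod (Suc j) v)"
  and tail_prod_end: "tail_prod (Suc n) v = v"
  unfolding tail_prod_def by (simp_all add: upt_conv_Cons del: upt_Suc)

lemma tail_prod_lin: "1 \<le> j \<Longrightarrow> j \<le> Suc n \<Longrightarrow> tail_prod j \<in> lin V V"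
proof (induction "Suc n - j" arbitrary: j)
  case 0
  then have "tail_prod j = (\<lambda>v. v)" using tail_prod_end by (auto simp: fun_eq_iff)
  then show ?case by (auto intro: linI)
next
  case (Suc m)
  then have j: "j \<in> {1..n}" "j \<le> n" by auto
  have "tail_prod j = (\<lambda>v. g j (tail_prod (Suc j) v))" using tail_prod_step[OF j(2)] by auto
  moreover have "tail_prod (Suc j) \<in> lin V V" using Suc by (intro Suc.hyps(1)) auto
  ultimately show ?case using lin_comp[OF _ g[OF j(1)]] by simp
qed

text \<open>The operator \<open>s\<close> commutes with \<open>g\<^sub>i g\<^sub>i\<^sub>+\<^sub>1\<close> but with neither factor, so the product must not start between
  the two. The induction passes over both at once.\<close>
lemma s_tail_prod:
  "1 \<le> j \<Longrightarrow> j \<le> Suc n \<Longrightarrow> j \<noteq> Suc i \<Longrightarrow> v \<in> carrier V \<Longrightarrow> s (tail_prod j v) = tail_prod j (s v)"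
proof (induction "Suc n - j" arbitrary: j rule: less_induct)
  case less
  show ?case
  proof (cases "j = Suc n")
    case True
    then show ?thesis by (simp add: tail_prod_end)
  next
    case False
    then have j: "j \<in> {1..n}" "j \<le> n" using less.prems by auto
    have c: "tail_prod k v \<in> carrier V" if "1 \<le> k" "k \<le> Suc n" for k
      using linD(1)[OF tail_prod_lin[OF that] less.prems(4)] .
    show ?thesis
    proof (cases "j = i")
      case True
      have t: "tail_prod i u = g i (g (Suc i) (tail_prod (Suc (Suc i)) u))" for u
        using tail_prod_step[of i u] tail_prod_step[of "Suc i" u] i by simp
      have IH: "s (tail_prod (Suc (Suc i)) v) = tail_prod (Suc (Suc i)) (s v)"
        using less.hyps[of "Suc (Suc i)"] less.prems(4) True i by auto
      let ?u = "tail_prod (Suc (Suc i)) v"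
      have u: "?u \<in> carrier V" using i by (intro c) auto
      have "s (tail_prod i v) = g (Suc i) (s (g (Suc i) ?u))"
        unfolding t using s_g[of "g (Suc i) ?u"] gi_closed(2)[OF u] by simp
      also have "\<dots> = g i (g (Suc i) (s ?u))" by (rule g_s_g[OF u])
      finally show ?thesis unfolding True t IH .
    next
      case nji: False
      have u: "tail_prod (Suc j) v \<in> carrier V" using j by (intro c) auto
      have IH: "s (tail_prod (Suc j) v) = tail_prod (Suc j) (s v)"
        using less.hyps[of "Suc j"] less.prems(4) j nji by auto
      show ?thesis unfolding tail_prod_step[OF j(2)]
        using s_g_far[OF j(1) nji less.prems(3) u] IH by simp
    qed
  qed
qed

lemma chain_tail_prod:
  assumes w: "w \<in> carrier Vn"
  shows "(\<forall>j\<in>{1..<n}. w j = g (Suc j) (w (Suc j))) \<longleftrightarrow> (\<forall>j\<in>{1..n}. w j = tail_prod (Suc j) (w n))"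
proof
  assume c: "\<forall>j\<in>{1..<n}. w j = g (Suc j) (w (Suc j))"
  have *: "1 \<le> j \<Longrightarrow> j \<le> n \<Longrightarrow> w j = tail_prod (Suc j) (w n)" for j
  proof (induction "n - j" arbitrary: j)
    case 0
    then have "j = n" by simp
    then show ?case by (simp add: tail_prod_end)
  next
    case (Suc m)
    have le: "Suc j \<le> n" using Suc.hyps(2) by linarith
    have "m = n - Suc j" "1 \<le> Suc j" using Suc.hyps(2) by linarith+
    note IH = Suc.hyps(1)[OF this le]
    have "w j = g (Suc j) (w (Suc j))" by (rule bspec[OF c]) (use le Suc.prems in simp)
    also have "\<dots> = g (Suc j) (tail_prod (Suc (Suc j)) (w n))" by (rule arg_cong[OF IH])
    also have "\<dots> = tail_prod (Suc j) (w n)" by (rule tail_prod_step[OF le, symmetric])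
    finally show ?case .
  qed
  show "\<forall>j\<in>{1..n}. w j = tail_prod (Suc j) (w n)"
  proof
    fix j assume "j \<in> {1..n}"
    then have "1 \<le> j" "j \<le> n" by auto
    then show "w j = tail_prod (Suc j) (w n)" by (rule *)
  qed
next
  assume t: "\<forall>j\<in>{1..n}. w j = tail_prod (Suc j) (w n)"
  show "\<forall>j\<in>{1..<n}. w j = g (Suc j) (w (Suc j))"
  proof
    fix j assume j: "j \<in> {1..<n}"
    then have "j \<in> {1..n}" "Suc j \<in> {1..n}" by auto
    then have "w j = tail_prod (Suc j) (w n)" "w (Suc j) = tail_prod (Suc (Suc j)) (w n)" using t by blast+
    note t = this
    have "tail_prod (Suc j) (w n) = g (Suc j) (tail_prod (Suc (Suc j)) (w n))"
      by (rule tail_prod_step) (use j in simp)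
    then show "w j = g (Suc j) (w (Suc j))" unfolding t(1)[symmetric] t(2)[symmetric] .
  qed
qed

lemma L_iff: "w \<in> L \<longleftrightarrow> w \<in> carrier Vn \<and> (\<forall>j\<in>{1..n}. w j = tail_prod (Suc j) (w n)) \<and> w n \<in> E"
proof (cases "w \<in> carrier Vn")
  case w: True
  have n1: "1 \<in> {1..n}" "n \<in> {1..n}" using i by auto
  have "lam \<odot> g 1 (w 1) = w n \<longleftrightarrow> w n \<in> E" if "\<forall>j\<in>{1..n}. w j = tail_prod (Suc j) (w n)"
  proof -
    have "w 1 = tail_prod (Suc 1) (w n)" using that n1 by blast
    then have "g 1 (w 1) = tail_prod 1 (w n)" using tail_prod_step[of 1 "w n"] n1 by simp
    then show ?thesis using Vn_nth[OF w n1(2)] by (simp add: E_def del: One_nat_def)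
  qed
  then show ?thesis unfolding L_chain chain_tail_prod[OF w] using w chain_tail_prod[OF w] by blast
next
  case False
  then show ?thesis unfolding L_chain by blast
qed

lemma n_pos: "n \<in> {1..n}" "1 \<in> {1..n}" using i by auto

lemma E_submodule: "submodule class_ring E V"
proof -
  have l: "tail_prod 1 \<in> lin V V" by (rule tail_prod_lin) auto
  show ?thesis
  proof (rule submoduleI[OF V])
    show "E \<subseteq> carrier V" by (auto simp: E_def)
    show "\<zero> \<in> E" using lin_zero[OF V V l] by (simp add: E_def vs_smult_zero[OF V])
  next
    fix u v assume "u \<in> E" "v \<in> E"
    then show "u \<oplus> v \<in> E" using linD(1,2)[OF l] by (simp add: E_def vs_r_distr[OF V])
  next
    fix c v assume v: "v \<in> E"
    then have vc: "v \<in> carrier V" by (simp add: E_def)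
    have "lam \<odot> (c \<odot> tail_prod 1 v) = c \<odot> (lam \<odot> tail_prod 1 v)"
      using vs_assoc[OF V linD(1)[OF l vc], of lam c] vs_assoc[OF V linD(1)[OF l vc], of c lam]
      by (simp add: mult.commute)
    then show "c \<odot> v \<in> E" using v linD(3)[OF l vc] by (simp add: E_def vs_smult_closed[OF V])
  qed
qed

lemma s_E: "v \<in> E \<Longrightarrow> s v \<in> E"
proof -
  assume v: "v \<in> E"
  then have vc: "v \<in> carrier V" "lam \<odot> tail_prod 1 v = v" by (auto simp: E_def)
  have tc: "tail_prod 1 v \<in> carrier V" by (rule linD(1)[OF tail_prod_lin vc(1)]) auto
  have "lam \<odot> tail_prod 1 (s v) = lam \<odot> s (tail_prod 1 v)"
    using s_tail_prod[of 1 v] vc i by simp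
  also have "\<dots> = s v" using linD(3)[OF s tc, of lam] vc by simp
  finally show "s v \<in> E" using vc s_closed by (simp add: E_def)
qed

lemma L_submodule: "submodule class_ring L Vn"
proof -
  have t: "tail_prod (Suc j) \<in> lin V V" if "j \<in> {1..n}" for j by (rule tail_prod_lin) (use that in auto)
  note e = submoduleD[OF V E_submodule]
  interpret Vn: abelian_group Vn by (rule vs_group[OF Vn])
  show ?thesis
  proof (rule submoduleI[OF Vn])
    show "L \<subseteq> carrier Vn" using L_iff by blast
    have z: "\<zero>\<^bsub>Vn\<^esub> j = \<zero>" if "j \<in> {1..n}" for j using that by simp
    show "\<zero>\<^bsub>Vn\<^esub> \<in> L"
      unfolding L_iff using z n_pos e(2) lin_zero[OF V V t] Vn.zero_closed by metis
  next
    fix u v assume "u \<in> L" "v \<in> L"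
    then have u: "u \<in> carrier Vn" "\<And>j. j \<in> {1..n} \<Longrightarrow> u j = tail_prod (Suc j) (u n)" "u n \<in> E"
      and v: "v \<in> carrier Vn" "\<And>j. j \<in> {1..n} \<Longrightarrow> v j = tail_prod (Suc j) (v n)" "v n \<in> E"
      unfolding L_iff by blast+
    have a: "(u \<oplus>\<^bsub>Vn\<^esub> v) j = u j \<oplus> v j" if "j \<in> {1..n}" for j using that by simp
    have "(u \<oplus>\<^bsub>Vn\<^esub> v) j = tail_prod (Suc j) ((u \<oplus>\<^bsub>Vn\<^esub> v) n)" if j: "j \<in> {1..n}" for j
      unfolding a[OF j] a[OF n_pos(1)] u(2)[OF j] v(2)[OF j]
      by (rule linD(2)[OF t[OF j] e(1)[OF u(3)] e(1)[OF v(3)], symmetric])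
    moreover have "(u \<oplus>\<^bsub>Vn\<^esub> v) n \<in> E" unfolding a[OF n_pos(1)] by (rule e(3)[OF u(3) v(3)])
    ultimately show "u \<oplus>\<^bsub>Vn\<^esub> v \<in> L" unfolding L_iff using Vn.a_closed[OF u(1) v(1)] by blast
  next
    fix c v assume "v \<in> L"
    then have v: "v \<in> carrier Vn" "\<And>j. j \<in> {1..n} \<Longrightarrow> v j = tail_prod (Suc j) (v n)" "v n \<in> E"
      unfolding L_iff by blast+
    have a: "(c \<odot>\<^bsub>Vn\<^esub> v) j = c \<odot> v j" if "j \<in> {1..n}" for j using that by simp
    have "(c \<odot>\<^bsub>Vn\<^esub> v) j = tail_prod (Suc j) ((c \<odot>\<^bsub>Vn\<^esub> v) n)" if j: "j \<in> {1..n}" for j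
      unfolding a[OF j] a[OF n_pos(1)] v(2)[OF j] by (rule linD(3)[OF t[OF j] e(1)[OF v(3)], symmetric])
    moreover have "(c \<odot>\<^bsub>Vn\<^esub> v) n \<in> E" unfolding a[OF n_pos(1)] by (rule e(4)[OF v(3)])
    ultimately show "c \<odot>\<^bsub>Vn\<^esub> v \<in> L" unfolding L_iff using vs_smult_closed[OF Vn v(1)] by blast
  qed
qed

lemma S_L_last: "w \<in> L \<Longrightarrow> S w n = s (w n)"
  and S_L: "w \<in> L \<Longrightarrow> S w \<in> L"
proof -
  assume w: "w \<in> L"
  have wc: "w \<in> carrier Vn" and t: "\<And>j. j \<in> {1..n} \<Longrightarrow> w j = tail_prod (Suc j) (w n)" and E: "w n \<in> E"
    using w unfolding L_iff by blast+
  have chain: "w i = g (Suc i) (w (Suc i))" using w i unfolding L_chain by blast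
  have wn: "w n \<in> carrier V" by (rule Vn_nth[OF wc n_pos(1)])
  have Si: "S w (Suc i) = s (w (Suc i))"
  proof -
    have c: "w (Suc i) \<in> carrier V" "g (Suc i) (w (Suc i)) \<in> carrier V" using Vn_nth[OF wc ii(2)] gi_closed by auto
    show ?thesis unfolding S_nth(2)[OF wc] chain using c by (simp add: a_minus_def A.cancel_past)
  qed
  have *: "S w j = tail_prod (Suc j) (s (w n))" if j: "j \<in> {1..n}" for j
    using j
  proof (cases rule: position_cases)
    case 1
    have u: "tail_prod (Suc (Suc i)) (w n) \<in> carrier V" by (rule linD(1)[OF tail_prod_lin wn]) (use i in auto)
    have "S w i = s (g i (tail_prod (Suc (Suc i)) (w n)))" unfolding S_nth(1)[OF wc] t[OF ii(2), symmetric] ..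
    also have "\<dots> = g (Suc i) (tail_prod (Suc (Suc i)) (s (w n)))"
      unfolding s_g[OF u] using s_tail_prod[of "Suc (Suc i)" "w n"] wn i by simp
    also have "\<dots> = tail_prod (Suc i) (s (w n))" using tail_prod_step[of "Suc i"] i by simp
    finally show ?thesis unfolding 1 .
  next
    case 2
    show ?thesis unfolding 2 Si t[OF ii(2)] using s_tail_prod[of "Suc (Suc i)" "w n"] wn i by simp
  next
    case 3
    show ?thesis unfolding S_nth(3)[OF wc 3] t[OF j] using s_tail_prod[of "Suc j" "w n"] wn j 3 by simp
  qed
  show n: "S w n = s (w n)" using *[OF n_pos(1)] tail_prod_end by simp
  show "S w \<in> L" unfolding L_iff n using S_closed[OF wc] * s_E[OF E] by blast
qed

text \<open>A vector of \<open>L\<close> is determined by its last component, which ranges over \<open>E\<close>.\<close>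
lemma char_poly_L: "endo_char_poly (sub_space Vn L) S = endo_char_poly (sub_space V E) s"
proof -
  have X: "vectorspace class_ring (sub_space Vn L)" by (rule submodule_vs[OF Vn L_submodule])
  have Y: "vectorspace class_ring (sub_space V E)" by (rule submodule_vs[OF V E_submodule])
  have fX: "vectorspace.fin_dim class_ring (sub_space Vn L)"
    by (rule submodule_fin_dim[OF Vn char_poly_S(2) L_submodule])
  have t: "tail_prod (Suc j) \<in> lin V V" if "j \<in> {1..n}" for j by (rule tail_prod_lin) (use that in auto)
  have p: "(\<lambda>w. w n) \<in> lin (sub_space Vn L) (sub_space V E)"
  proof (rule linI)
    show "w n \<in> carrier (sub_space V E)" if "w \<in> carrier (sub_space Vn L)" for w
    proof -
      have "w \<in> L" using that by simp
      then have "w n \<in> E" unfolding L_iff by (elim conjE)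
      then show ?thesis by simp
    qed
  qed (use n_pos(1) in simp_all)
  have bij: "bij_betw (\<lambda>w. w n) (carrier (sub_space Vn L)) (carrier (sub_space V E))"
  proof (rule bij_betwI')
    fix u v assume "u \<in> carrier (sub_space Vn L)" "v \<in> carrier (sub_space Vn L)"
    then have *: "u \<in> L" "v \<in> L" by auto
    show "(u n = v n) = (u = v)"
    proof
      assume e: "u n = v n"
      show "u = v"
      proof (rule Vn_eqI)
        show "u \<in> carrier Vn" "v \<in> carrier Vn" using * unfolding L_iff by blast+
        fix j assume "j \<in> {1..n}"
        then have "u j = tail_prod (Suc j) (u n)" "v j = tail_prod (Suc j) (v n)" using * unfolding L_iff by blast+
        then show "u j = v j" using e by simp
      qed
    qed simp
  next
    fix w assume "w \<in> carrier (sub_space Vn L)"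
    then show "w n \<in> carrier (sub_space V E)" using linD(1)[OF p] by blast
  next
    fix v assume "v \<in> carrier (sub_space V E)"
    then have v: "v \<in> E" "v \<in> carrier V" by (auto simp: E_def)
    let ?w = "\<lambda>j\<in>{1..n}. tail_prod (Suc j) v"
    have wn: "?w n = v" using n_pos tail_prod_end by simp
    have wc: "?w \<in> carrier Vn" using linD(1)[OF t v(2)] by auto
    have "?w \<in> L" unfolding L_iff wn using v wc by simp
    then show "\<exists>w\<in>carrier (sub_space Vn L). v = w n"
      using wn by (intro bexI[of _ ?w]) simp_all
  qed
  have SL: "S \<in> lin (sub_space Vn L) (sub_space Vn L)"
    by (rule lin_sub_space[OF S_lin submodule.subset[OF L_submodule] S_L])
  have sE: "s \<in> lin (sub_space V E) (sub_space V E)"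
    by (rule lin_sub_space[OF s submodule.subset[OF E_submodule] s_E])
  show ?thesis by (rule char_poly_iso(1)[OF X Y p bij SL sE _ fX]) (use S_L_last in simp)
qed

text \<open>On \<open>L\<close> one has \<open>w\<^sub>j = g\<^sub>j\<^sub>+\<^sub>1 w\<^sub>j\<^sub>+\<^sub>1\<close>, on \<open>K\<close> this is \<open>w\<^sub>j\<^sub>+\<^sub>1\<close>. All components agree with \<open>w\<^sub>1\<close>, and the
  last condition of \<open>L\<close> reads \<open>\<lambda> w\<^sub>1 = w\<^sub>1\<close>.\<close>
lemma K_L_zero:
  assumes K: "w \<in> K" and L: "w \<in> L"
  shows "w = \<zero>\<^bsub>Vn\<^esub>"
proof -
  have wc: "w \<in> carrier Vn" by (rule block_spaceD(1)[OF K])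
  have fixed: "g j (w j) = w j" if "j \<in> {1..n}" for j using block_spaceD(2)[OF K that that] by (simp add: W_iff)
  have ch: "w j = w (Suc j)" if j: "j \<in> {1..<n}" for j
  proof -
    have "w j = g (Suc j) (w (Suc j))" using L j unfolding L_chain by blast
    then show ?thesis using fixed[of "Suc j"] j by simp
  qed
  have eq: "j \<le> n \<longrightarrow> w j = w 1" if "1 \<le> j" for j
    using that
  proof (induction j rule: nat_induct_at_least)
    case (Suc j)
    then show ?case using ch[of j] by auto
  qed simp
  have w1: "w 1 \<in> carrier V" by (rule Vn_nth[OF wc n_pos(2)])
  have "lam \<odot> g 1 (w 1) = w n" using L unfolding L_chain by blast
  then have "lam \<odot> w 1 = w 1" using fixed[OF n_pos(2)] eq[of n] n_pos by simp
  moreover have "(lam - 1) \<odot> w 1 = lam \<odot> w 1 \<oplus> \<ominus> w 1"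
    using vs_l_distr[OF V w1, of lam "- 1"] vs_minus_smult[OF V w1, of 1] vs_one[OF V w1] by simp
  ultimately have "(lam - 1) \<odot> w 1 = \<zero>" using A.r_neg[OF w1] by simp
  then have "inverse (lam - 1) \<odot> ((lam - 1) \<odot> w 1) = \<zero>" by (simp only: vs_smult_zero[OF V])
  then have z: "w 1 = \<zero>"
    using vs_assoc[OF V w1, of "inverse (lam - 1)" "lam - 1"] lam1 by (simp add: vs_one[OF V w1] del: One_nat_def)
  interpret Vn: abelian_group Vn by (rule vs_group[OF Vn])
  show ?thesis
  proof (rule Vn_eqI[OF wc Vn.zero_closed])
    fix j assume j: "j \<in> {1..n}"
    then show "w j = \<zero>\<^bsub>Vn\<^esub> j" using eq[of j] z by simp
  qed
qed

abbreviation KL :: "(nat \<Rightarrow> 'v) set" where "KL \<equiv> K <+>\<^bsub>Vn\<^esub> L"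

lemma KL_submodule: "submodule class_ring KL Vn"
  by (rule set_add_submodule[OF Vn K_submodule L_submodule])

lemma S_KL: "w \<in> KL \<Longrightarrow> S w \<in> KL"
  by (rule char_poly_direct_sum(2)[OF Vn char_poly_S(2) K_submodule L_submodule K_L_zero S_lin S_K S_L])

lemma char_poly_KL:
  "endo_char_poly (sub_space Vn KL) S =
    (\<Prod>k\<in>far. endo_char_poly (sub_space V (W k)) s) * det_z2_minus (sub_space V (W i)) (s \<circ> g i \<circ> s)
      * endo_char_poly (sub_space V E) s"
  using char_poly_direct_sum(1)[OF Vn char_poly_S(2) K_submodule L_submodule K_L_zero S_lin S_K S_L]
  unfolding char_poly_K char_poly_L .

lemma char_poly_KL_nonzero: "endo_char_poly (sub_space Vn KL) S \<noteq> 0"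
  by (rule endo_char_poly_nonzero[OF submodule_vs[OF Vn KL_submodule]
        lin_sub_space[OF S_lin submodule.subset[OF KL_submodule] S_KL]
        submodule_fin_dim[OF Vn char_poly_S(2) KL_submodule]])

lemma char_poly_quotient:
  "endo_char_poly V s ^ (n - 1) * det_z_plus V (s \<circ> g i) =
    endo_char_poly (sub_space Vn KL) S * endo_char_poly (quot_space Vn KL) (quot_map Vn KL S)"
  using char_poly_quot(1)[OF Vn KL_submodule S_lin S_KL char_poly_S(2)] unfolding char_poly_S(1) .

end

section \<open>The Katz--Long--Moody operator of a braid generator\<close>

theorem theorem5p4:
  fixes V :: "('a::field, 'v) module"
    and n i :: nat and lam :: 'a
    and \<theta> :: "nat word set \<Rightarrow> nat word set \<Rightarrow> nat word set"
    and \<rho> :: "nat word set \<times> nat word set \<Rightarrow> 'v \<Rightarrow> 'v"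
    and \<rho>LM :: "nat word set \<times> nat word set \<Rightarrow> (nat \<Rightarrow> 'v) \<Rightarrow> (nat \<Rightarrow> 'v)"
  assumes "n \<ge> 2"
    and "vectorspace class_ring V" and "vectorspace.fin_dim class_ring V"
    and "artin_action n \<theta>"
    and "\<rho> \<in> hom (free_braid_group n \<theta>) (GL V)"
    and "lam \<noteq> 0" and "lam \<noteq> 1"
    and "twisted_long_moody n \<theta> V \<rho> lam \<rho>LM"
    and "1 \<le> i" and "i \<le> n - 1"
    and g: "\<And>j. g j = \<rho> (x_gen n j)"
    and s: "s = \<rho> (sigma_gen n i)"
    and W: "\<And>j. W j = eigenspace V (g j) 1"
    and E: "E = eigenspace V (\<lambda>v. lam \<odot>\<^bsub>V\<^esub> foldr g [1..<Suc n] v) 1"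
    and Vn: "Vn = power_space n V"
    and KL: "KL = KLM_KL n V \<rho> \<rho>LM"
    and Q: "Q = KLM_space n V \<rho> \<rho>LM"
    and S: "S = \<rho>LM (sigma_gen n i)"
    and T: "T = KLM_rep n V \<rho> \<rho>LM (sigma_gen n i)"
    and num: "num = endo_char_poly V s ^ (n - 1) * det_z_plus V (s \<circ> g i)"
    and den: "den = (\<Prod>k\<in>{1..n} - {i, i + 1}. endo_char_poly (sub_space V (W k)) s)
                    * det_z2_minus (sub_space V (W i)) (s \<circ> g i \<circ> s)
                    * endo_char_poly (sub_space V E) s"
  shows "den dvd num \<and> endo_char_poly Q T = num div den \<and>
    (\<forall>a b. a \<noteq> 0 \<longrightarrow> b \<noteq> 0 \<longrightarrow>
       ((\<forall>q\<in>carrier Q. sub_scalar Q T a (sub_scalar Q T b q) = \<zero>\<^bsub>Q\<^esub>) \<longleftrightarrow>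
        (\<lambda>w. sub_scalar Vn S a (sub_scalar Vn S b w)) ` carrier Vn \<subseteq> KL) \<and>
       (a \<noteq> b \<longrightarrow>
        (\<lambda>w. sub_scalar Vn S a (sub_scalar Vn S b w)) ` carrier Vn \<subseteq> KL \<longrightarrow>
        semisimple_endo Q T \<and>
        ac_eigenvalues Q T \<subseteq> {to_ac a, to_ac b} \<and>
        {z. poly (map_poly to_ac (num div den)) z = 0} \<subseteq> {to_ac a, to_ac b}))"
proof -
  have i: "i \<in> {1..<n}" using assms(1,9,10) by auto
  note V = assms(2) and fd = assms(3)
  note rel = braid_rep_relations[OF assms(4) i assms(5) g s]
  have far: "s (g j v) = g j (s v)" if "j \<in> {1..n}" "j \<noteq> i" "j \<noteq> Suc i" "v \<in> carrier V" for j v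
    using rel(6)[of j v] that by simp
  interpret D: klm_data V n i lam g s
    by (rule klm_data.intro[OF V fd i assms(7) rel(1-3) rel(4,5)[unfolded Suc_eq_plus1[symmetric]] far])
  have i1: "i \<in> {1..n}" using i by auto
  have g_fun: "g = (\<lambda>l. \<rho> (x_gen n l))" using g by blast
  have LM: "\<rho>LM (x_gen n j) = LM_x n V g lam j" if "j \<in> {1..n}" for j
  proof -
    have "\<rho>LM (x_gen n j) = LM_x n V (\<lambda>l. \<rho> (x_gen n l)) lam j"
      using assms(8) that unfolding twisted_long_moody_def by blast
    then show ?thesis unfolding g_fun .
  qed
  have S': "S = LM_sigma n V g (\<lambda>_. s) i"
  proof -
    have "S = LM_sigma n V (\<lambda>l. \<rho> (x_gen n l)) (\<lambda>l. \<rho> (sigma_gen n l)) i"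
      using assms(8) i unfolding twisted_long_moody_def S by blast
    then show ?thesis unfolding LM_sigma_def g_fun s .
  qed
  have W': "W j = D.W j" if "j \<in> {1..n}" for j
    unfolding W D.W_def by (rule eigenspace_one_iff[OF V D.g_closed[OF that]])
  have E': "E = D.E"
  proof -
    have "lam \<odot>\<^bsub>V\<^esub> foldr g [1..<Suc n] v \<in> carrier V" if "v \<in> carrier V" for v
      using vs_smult_closed[OF V linD(1)[OF D.tail_prod_lin[of 1] that]] by (simp add: D.tail_prod_def)
    from eigenspace_one_iff[OF V this] show ?thesis by (simp add: E D.E_def D.tail_prod_def)
  qed
  have KL': "KL = D.KL"
  proof -
    have "KLM_K n V \<rho> = D.K"
      unfolding KLM_K_def block_space_def using W' by (auto simp: W g)
    moreover have "KLM_L n V \<rho>LM = D.L" unfolding KLM_L_def D.L_def using LM by simp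
    ultimately show ?thesis by (simp add: KL KLM_KL_def)
  qed
  have Q': "Q = quot_space Vn KL" by (simp add: Q KLM_space_def KL Vn)
  have T': "T = quot_map Vn KL S" by (simp add: T KLM_rep_def KL Vn S)
  have SKL: "\<And>w. w \<in> KL \<Longrightarrow> S w \<in> KL" using D.S_KL by (simp only: KL' S')
  have Vnv: "vectorspace class_ring Vn" unfolding Vn by (rule D.Vn)
  have KLs: "submodule class_ring KL Vn" unfolding KL' Vn by (rule D.KL_submodule)
  have Sl: "S \<in> lin Vn Vn" unfolding S' Vn by (rule D.S_lin)
  have Qv: "vectorspace class_ring Q" unfolding Q' by (rule quot_space_vs[OF Vnv KLs])
  have Tl: "T \<in> lin Q Q" unfolding T' Q' by (rule quot_map_lin[OF Vnv KLs Sl SKL])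
  have fQ: "vectorspace.fin_dim class_ring Q"
    unfolding Q' by (rule char_poly_quot(2)[OF Vnv KLs Sl SKL]) (simp_all add: Vn D.char_poly_S(2))
  have den': "den = endo_char_poly (sub_space Vn KL) S"
  proof -
    have "(\<Prod>k\<in>{1..n} - {i, i + 1}. endo_char_poly (sub_space V (W k)) s) =
        (\<Prod>k\<in>{1..n} - {i, Suc i}. endo_char_poly (sub_space V (D.W k)) s)"
      by (rule prod.cong) (use W' in auto)
    then show ?thesis unfolding den W'[OF i1] E' KL' Vn S' D.char_poly_KL by simp
  qed
  have eq: "num = den * endo_char_poly Q T"
    unfolding num den' Q' T' unfolding KL' Vn S' by (rule D.char_poly_quotient)
  have den0: "den \<noteq> 0" unfolding den' KL' Vn S' by (rule D.char_poly_KL_nonzero)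
  have quot: "endo_char_poly Q T = num div den" using eq den0 by simp
  have hecke: "(\<forall>q\<in>carrier Q. sub_scalar Q T a (sub_scalar Q T b q) = \<zero>\<^bsub>Q\<^esub>) \<longleftrightarrow>
      (\<lambda>w. sub_scalar Vn S a (sub_scalar Vn S b w)) ` carrier Vn \<subseteq> KL" for a b
    unfolding Q' T' by (rule quadratic_quot_iff[OF Vnv KLs Sl SKL])
  have ss: "semisimple_endo Q T \<and> ac_eigenvalues Q T \<subseteq> {to_ac a, to_ac b} \<and>
      {z. poly (map_poly to_ac (num div den)) z = 0} \<subseteq> {to_ac a, to_ac b}"
    if ab: "a \<noteq> b" and h: "(\<lambda>w. sub_scalar Vn S a (sub_scalar Vn S b w)) ` carrier Vn \<subseteq> KL" for a b
  proof -
    have q: "\<And>q. q \<in> carrier Q \<Longrightarrow> sub_scalar Q T a (sub_scalar Q T b q) = \<zero>\<^bsub>Q\<^esub>" using h hecke by blast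
    show ?thesis unfolding quot[symmetric]
      using quadratic_semisimple[OF Qv Tl ab q] quadratic_eigenvalues[OF Qv fQ Tl q] by blast
  qed
  have "den dvd num" unfolding eq by simp
  then show ?thesis
    using quot hecke ss by (intro conjI allI impI) (assumption | rule hecke | erule (1) ss[THEN conjunct1]
      | erule (1) ss[THEN conjunct2, THEN conjunct1] | erule (1) ss[THEN conjunct2, THEN conjunct2])+
qed

end
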